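(* Let $n\ge 2$, let $\mathcal{E}(\mathbb{S}^n)$ be the set of Riemannian metrics on $\mathbb{S}^n$ with respect to which all equators are minimal, and let $Curv_+(\mathbb{R}^{n+1})$ be the set of algebraic curvature tensors on $\mathbb{R}^{n+1}$ with positive sectional curvature. (1) Given $R\in Curv_+(\mathbb{R}^{n+1})$, let $k_R$ be the positive definite symmetric two-tensor on $\mathbb{S}^n$ given by $(k_R)_p(v,w)=R(p,v,p,w)$ for all $p\in\mathbb{S}^n$ and $v,w\in T_p\mathbb{S}^n$; let $D_R$ be the positive smooth function on $\mathbb{S}^n$ such that $dV_{k_R}=D_R^{\frac{n-1}{4}}dV_{\overline{g}}$; and set $g_R=\frac{1}{D_R}k_R$. (2) Given $g\in\mathcal{E}(\mathbb{S}^n)$, let $F_g$ be the positive smooth function on $\mathbb{S}^n$ such that $dV_g=F_g^{\frac{n+1}{4}}dV_{\overline{g}}$; set $k_g=\frac{1}{F_g}g$; and let $R_g$ be the algebraic curvature tensor on $\mathbb{R}^{n+1}$ such that $R_g(p,v,p,v)=(k_g)_p(v,v)$ for every $p\in\mathbb{S}^n$ and every $v\in T_p\mathbb{S}^n$. Then the maps $$g\in\mathcal{E}(\mathbb{S}^n)\mapsto R_g\in Curv_+(\mathbb{R}^{n+1})\quad\text{and}\quad R\in Curv_+(\mathbb{R}^{n+1})\mapsto g_R\in\mathcal{E}(\mathbb{S}^n)$$ are well-defined and are the inverse of each other.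
   Context: $\mathbb{S}^n\subset\mathbb{R}^{n+1}$ is the unit sphere centred at the origin, $\overline{g}$ is its canonical metric of constant sectional curvature one, and $T_p\mathbb{S}^n$ is identified with the orthogonal complement of $p$ in $\mathbb{R}^{n+1}$. An equator of $\mathbb{S}^n$ is the intersection of $\mathbb{S}^n$ with a hyperplane of $\mathbb{R}^{n+1}$ through the origin. A hypersurface is minimal if its mean curvature vanishes identically (for $n=2$: it is a geodesic up to parametrization). For a positive definite symmetric two-tensor $h$, $dV_h$ denotes its Riemannian volume element. An algebraic curvature tensor in $\mathbb{R}^{n+1}$ is a $4$-linear map $R:(\mathbb{R}^{n+1})^4\to\mathbb{R}$ such that $R(x,y,z,w)=-R(y,x,z,w)=-R(x,y,w,z)$, $R(x,y,z,w)=R(z,w,x,y)$ and $R(x,y,z,w)+R(x,z,w,y)+R(x,w,y,z)=0$. It has positive sectional curvature if $R(v,w,v,w)>0$ for every orthonormal pair $v,w\in\mathbb{R}^{n+1}$. *)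

theory Defs
  imports "HOL-Analysis.Analysis"
begin

text \<open>
  Throughout, the ambient space is \<open>real ^ 'm\<close> with \<open>CARD('m) = n + 1\<close>, so that
  \<open>sphere 0 1\<close> is the unit sphere of dimension \<open>n = CARD('m) - 1\<close>.
  Functions, vector fields and tensors on the sphere are total functions that take the value 0
  at arguments outside their domain (base point off the sphere, non-tangent vector), so that
  equality of functions is equality of the geometric objects.
\<close>

type_synonym 'm scalar_field = "real ^ 'm \<Rightarrow> real"
type_synonym 'm vector_field = "real ^ 'm \<Rightarrow> real ^ 'm"
type_synonym 'm tensor2 = "real ^ 'm \<Rightarrow> real ^ 'm \<Rightarrow> real ^ 'm \<Rightarrow> real"
type_synonym 'm tensor4 = "real ^ 'm \<Rightarrow> real ^ 'm \<Rightarrow> real ^ 'm \<Rightarrow> real ^ 'm \<Rightarrow> real"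

abbreviation Sph :: "(real ^ 'm::finite) set"
  where "Sph \<equiv> sphere 0 1"

definition tspace :: "real ^ 'm::finite \<Rightarrow> (real ^ 'm) set"
  where "tspace p = {v. p \<bullet> v = 0}"

primrec Ck_on ::
  "nat \<Rightarrow> 'a::real_normed_vector set \<Rightarrow> ('a \<Rightarrow> 'b::real_normed_vector) \<Rightarrow> bool"
  where
    "Ck_on 0 U f \<longleftrightarrow> continuous_on U f"
  | "Ck_on (Suc k) U f \<longleftrightarrow>
       (\<forall>x\<in>U. f differentiable (at x)) \<and>
       (\<forall>v. Ck_on k U (\<lambda>x. frechet_derivative f (at x) v))"

text \<open>Used only for open \<open>U\<close> and finite-dimensional \<open>'a\<close>.\<close>

definition smooth_on_open ::
  "'a::real_normed_vector set \<Rightarrow> ('a \<Rightarrow> 'b::real_normed_vector) \<Rightarrow> bool"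
  where "smooth_on_open U f \<longleftrightarrow> (\<forall>k. Ck_on k U f)"

text \<open>Smoothness on the embedded submanifold: locally the restriction of a smooth map.\<close>

definition smooth_on_sphere ::
  "(real ^ 'm::finite \<Rightarrow> 'b::real_normed_vector) \<Rightarrow> bool"
  where "smooth_on_sphere f \<longleftrightarrow>
    (\<forall>p\<in>Sph. \<exists>U F. open U \<and> p \<in> U \<and> smooth_on_open U F \<and> (\<forall>x\<in>U \<inter> Sph. F x = f x))"

definition scalar_fields :: "('m::finite) scalar_field set"
  where "scalar_fields = {f. smooth_on_sphere f \<and> (\<forall>p. p \<notin> Sph \<longrightarrow> f p = 0)}"

definition vector_fields :: "('m::finite) vector_field set"
  where "vector_fields =
    {X. smooth_on_sphere X \<and> (\<forall>p\<in>Sph. X p \<in> tspace p) \<and> (\<forall>p. p \<notin> Sph \<longrightarrow> X p = 0)}"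

text \<open>
  The differential of \<open>f\<close> at a point \<open>p\<close> of the sphere, applied to a tangent vector \<open>v\<close>.
  Here \<open>sgn x = x /\<^sub>R norm x\<close> is the radial retraction onto the sphere, so this is the derivative
  of \<open>f\<close> along the curve \<open>sgn (p + t *\<^sub>R v)\<close> in the sphere, whose velocity at \<open>t = 0\<close> is \<open>v\<close>.
\<close>

definition sderiv ::
  "(real ^ 'm::finite \<Rightarrow> 'b::real_normed_vector) \<Rightarrow> real ^ 'm \<Rightarrow> real ^ 'm \<Rightarrow> 'b"
  where "sderiv f p v = frechet_derivative (\<lambda>x. f (sgn x)) (at p) v"

text \<open>
  Lie bracket, computed by differentiating vector fields as maps into the ambient space
  (the second fundamental form of the sphere is symmetric, so the result is again tangent).
\<close>

definition lie_bracket ::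
  "('m::finite) vector_field \<Rightarrow> 'm vector_field \<Rightarrow> real ^ 'm \<Rightarrow> real ^ 'm"
  where "lie_bracket X Y p = sderiv Y p (X p) - sderiv X p (Y p)"

definition riemannian_metric :: "('m::finite) tensor2 \<Rightarrow> bool"
  where "riemannian_metric g \<longleftrightarrow>
    (\<forall>p v w. \<not> (p \<in> Sph \<and> v \<in> tspace p \<and> w \<in> tspace p) \<longrightarrow> g p v w = 0) \<and>
    (\<forall>p\<in>Sph. \<forall>u\<in>tspace p. \<forall>v\<in>tspace p. \<forall>w\<in>tspace p. \<forall>a b.
       g p (a *\<^sub>R u + b *\<^sub>R v) w = a * g p u w + b * g p v w) \<and>
    (\<forall>p\<in>Sph. \<forall>v\<in>tspace p. \<forall>w\<in>tspace p. g p v w = g p w v) \<and>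
    (\<forall>p\<in>Sph. \<forall>v\<in>tspace p. v \<noteq> 0 \<longrightarrow> g p v v > 0) \<and>
    (\<forall>X\<in>vector_fields. \<forall>Y\<in>vector_fields. smooth_on_sphere (\<lambda>p. g p (X p) (Y p)))"

definition round_metric :: "('m::finite) tensor2"
  where "round_metric p v w =
    (if p \<in> Sph \<and> v \<in> tspace p \<and> w \<in> tspace p then v \<bullet> w else 0)"

definition is_levi_civita ::
  "('m::finite) tensor2 \<Rightarrow> ('m vector_field \<Rightarrow> 'm vector_field \<Rightarrow> 'm vector_field) \<Rightarrow> bool"
  where "is_levi_civita g nabla \<longleftrightarrow>
    (\<forall>X Y. \<not> (X \<in> vector_fields \<and> Y \<in> vector_fields) \<longrightarrow> nabla X Y = (\<lambda>p. 0)) \<and>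
    (\<forall>X\<in>vector_fields. \<forall>Y\<in>vector_fields. nabla X Y \<in> vector_fields) \<and>
    (\<forall>X\<in>vector_fields. \<forall>Y\<in>vector_fields. \<forall>Z\<in>vector_fields. \<forall>p.
       nabla (\<lambda>q. X q + Y q) Z p = nabla X Z p + nabla Y Z p \<and>
       nabla X (\<lambda>q. Y q + Z q) p = nabla X Y p + nabla X Z p) \<and>
    (\<forall>f\<in>scalar_fields. \<forall>X\<in>vector_fields. \<forall>Y\<in>vector_fields. \<forall>p\<in>Sph.
       nabla (\<lambda>q. f q *\<^sub>R X q) Y p = f p *\<^sub>R nabla X Y p \<and>
       nabla X (\<lambda>q. f q *\<^sub>R Y q) p = f p *\<^sub>R nabla X Y p + sderiv f p (X p) *\<^sub>R Y p) \<and>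
    (\<forall>X\<in>vector_fields. \<forall>Y\<in>vector_fields. \<forall>p\<in>Sph.
       nabla X Y p - nabla Y X p = lie_bracket X Y p) \<and>
    (\<forall>X\<in>vector_fields. \<forall>Y\<in>vector_fields. \<forall>Z\<in>vector_fields. \<forall>p\<in>Sph.
       sderiv (\<lambda>q. g q (Y q) (Z q)) p (X p) = g p (nabla X Y p) (Z p) + g p (Y p) (nabla X Z p))"

definition levi_civita ::
  "('m::finite) tensor2 \<Rightarrow> 'm vector_field \<Rightarrow> 'm vector_field \<Rightarrow> 'm vector_field"
  where "levi_civita g = (THE nabla. is_levi_civita g nabla)"

text \<open>The tangent space at \<open>p\<close> of an embedded submanifold \<open>M\<close>: velocities of curves in \<open>M\<close>.\<close>

definition tangent_at :: "(real ^ 'm::finite) set \<Rightarrow> real ^ 'm \<Rightarrow> (real ^ 'm) set"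
  where "tangent_at M p =
    {v. \<exists>c :: real \<Rightarrow> real ^ 'm. c 0 = p \<and> (\<forall>t. c t \<in> M) \<and> (c has_vector_derivative v) (at 0)}"

definition unit_normal ::
  "('m::finite) tensor2 \<Rightarrow> (real ^ 'm) set \<Rightarrow> real ^ 'm \<Rightarrow> real ^ 'm \<Rightarrow> bool"
  where "unit_normal g M p \<nu> \<longleftrightarrow>
    \<nu> \<in> tspace p \<and> g p \<nu> \<nu> = 1 \<and> (\<forall>v\<in>tangent_at M p. g p \<nu> v = 0)"

definition orthonormal_basis_at ::
  "('m::finite) tensor2 \<Rightarrow> (real ^ 'm) set \<Rightarrow> real ^ 'm \<Rightarrow> (real ^ 'm) set \<Rightarrow> bool"
  where "orthonormal_basis_at g M p B \<longleftrightarrow>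
    finite B \<and> span B = tangent_at M p \<and>
    (\<forall>v\<in>B. \<forall>w\<in>B. g p v w = (if v = w then 1 else 0))"

text \<open>
  The second fundamental form of the hypersurface \<open>M\<close> at \<open>p\<close>, with respect to the unit normal
  \<open>\<nu>\<close>, on tangent vectors \<open>u\<close>, \<open>w\<close> of \<open>M\<close>: the value \<open>g (nabla U W) \<nu>\<close> common to all vector
  fields \<open>U\<close>, \<open>W\<close> extending \<open>u\<close>, \<open>w\<close> that are tangent to \<open>M\<close> along \<open>M\<close>.
\<close>

definition second_fundamental_form ::
  "('m::finite) tensor2 \<Rightarrow> (real ^ 'm) set \<Rightarrow> real ^ 'm \<Rightarrow> real ^ 'm \<Rightarrow>
   real ^ 'm \<Rightarrow> real ^ 'm \<Rightarrow> real"
  where "second_fundamental_form g M p \<nu> u w =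
    (THE c. \<forall>U\<in>vector_fields. \<forall>W\<in>vector_fields.
       U p = u \<and> W p = w \<and> (\<forall>q\<in>M. U q \<in> tangent_at M q \<and> W q \<in> tangent_at M q) \<longrightarrow>
       g p (levi_civita g U W p) \<nu> = c)"

text \<open>The trace; it does not depend on the orthonormal basis.\<close>

definition mean_curvature ::
  "('m::finite) tensor2 \<Rightarrow> (real ^ 'm) set \<Rightarrow> real ^ 'm \<Rightarrow> real ^ 'm \<Rightarrow> real"
  where "mean_curvature g M p \<nu> =
    (\<Sum>e\<in>(SOME B. orthonormal_basis_at g M p B). second_fundamental_form g M p \<nu> e e)"

definition minimal_hypersurface :: "('m::finite) tensor2 \<Rightarrow> (real ^ 'm) set \<Rightarrow> bool"
  where "minimal_hypersurface g M \<longleftrightarrow>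
    (\<forall>p\<in>M. \<forall>\<nu>. unit_normal g M p \<nu> \<longrightarrow> mean_curvature g M p \<nu> = 0)"

definition equators :: "(real ^ 'm::finite) set set"
  where "equators = {Sph \<inter> {x. a \<bullet> x = 0} | a. a \<noteq> 0}"

definition minimal_equator_metrics :: "('m::finite) tensor2 set"
  where "minimal_equator_metrics =
    {g. riemannian_metric g \<and> (\<forall>M\<in>equators. minimal_hypersurface g M)}"

text \<open>
  The Leibniz formula for matrices indexed by \<open>{..<n}\<close>; the determinant of the library is
  indexed by a type, whereas here the size \<open>CARD('m) - 1\<close> is a term.
\<close>

definition det_nat :: "nat \<Rightarrow> (nat \<Rightarrow> nat \<Rightarrow> real) \<Rightarrow> real"
  where "det_nat n A = (\<Sum>\<pi> | \<pi> permutes {..<n}. of_int (sign \<pi>) * (\<Prod>i<n. A i (\<pi> i)))"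

text \<open>
  The Riemannian volume element \<open>dV\<^sub>h\<close> as a density: its value at \<open>p\<close> on the tangent vectors
  \<open>v 0, \<dots>, v (n - 1)\<close> is the \<open>h\<close>-volume of the parallelepiped they span.
\<close>

definition volume_element ::
  "('m::finite) tensor2 \<Rightarrow> real ^ 'm \<Rightarrow> (nat \<Rightarrow> real ^ 'm) \<Rightarrow> real"
  where "volume_element h p v = sqrt (det_nat (CARD('m) - 1) (\<lambda>i j. h p (v i) (v j)))"

definition volume_factor :: "real \<Rightarrow> ('m::finite) tensor2 \<Rightarrow> 'm scalar_field \<Rightarrow> bool"
  where "volume_factor s h f \<longleftrightarrow>
    f \<in> scalar_fields \<and> (\<forall>p\<in>Sph. f p > 0) \<and>
    (\<forall>p\<in>Sph. \<forall>v. (\<forall>i<CARD('m) - 1. v i \<in> tspace p) \<longrightarrow>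
       volume_element h p v = f p powr s * volume_element round_metric p v)"

definition algebraic_curvature_tensor :: "('m::finite) tensor4 \<Rightarrow> bool"
  where "algebraic_curvature_tensor R \<longleftrightarrow>
    (\<forall>y z w. linear (\<lambda>x. R x y z w)) \<and> (\<forall>x z w. linear (\<lambda>y. R x y z w)) \<and>
    (\<forall>x y w. linear (\<lambda>z. R x y z w)) \<and> (\<forall>x y z. linear (\<lambda>w. R x y z w)) \<and>
    (\<forall>x y z w. R x y z w = - R y x z w \<and> R x y z w = - R x y w z) \<and>
    (\<forall>x y z w. R x y z w = R z w x y) \<and>
    (\<forall>x y z w. R x y z w + R x z w y + R x w y z = 0)"

definition Curv_plus :: "('m::finite) tensor4 set"
  where "Curv_plus =
    {R. algebraic_curvature_tensor R \<and>
        (\<forall>v w. norm v = 1 \<and> norm w = 1 \<and> v \<bullet> w = 0 \<longrightarrow> R v w v w > 0)}"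

text \<open>
  With \<open>n = CARD('m) - 1\<close>, the exponents \<open>(n - 1) / 4\<close> and \<open>(n + 1) / 4\<close> are
  \<open>(real CARD('m) - 2) / 4\<close> and \<open>real CARD('m) / 4\<close>.
\<close>

definition k_of_curv :: "('m::finite) tensor4 \<Rightarrow> 'm tensor2"
  where "k_of_curv R p v w =
    (if p \<in> Sph \<and> v \<in> tspace p \<and> w \<in> tspace p then R p v p w else 0)"

definition is_D :: "('m::finite) tensor4 \<Rightarrow> 'm scalar_field \<Rightarrow> bool"
  where "is_D R D \<longleftrightarrow> volume_factor ((real CARD('m) - 2) / 4) (k_of_curv R) D"

definition D_of_curv :: "('m::finite) tensor4 \<Rightarrow> 'm scalar_field"
  where "D_of_curv R = (THE D. is_D R D)"

definition metric_of_curv :: "('m::finite) tensor4 \<Rightarrow> 'm tensor2"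
  where "metric_of_curv R p v w = 1 / D_of_curv R p * k_of_curv R p v w"

definition is_F :: "('m::finite) tensor2 \<Rightarrow> 'm scalar_field \<Rightarrow> bool"
  where "is_F g F \<longleftrightarrow> volume_factor (real CARD('m) / 4) g F"

definition F_of_metric :: "('m::finite) tensor2 \<Rightarrow> 'm scalar_field"
  where "F_of_metric g = (THE F. is_F g F)"

definition k_of_metric :: "('m::finite) tensor2 \<Rightarrow> 'm tensor2"
  where "k_of_metric g p v w = 1 / F_of_metric g p * g p v w"

definition is_curv_of_metric :: "('m::finite) tensor2 \<Rightarrow> 'm tensor4 \<Rightarrow> bool"
  where "is_curv_of_metric g R \<longleftrightarrow>
    algebraic_curvature_tensor R \<and>
    (\<forall>p\<in>Sph. \<forall>v\<in>tspace p. R p v p v = k_of_metric g p v v)"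

definition curv_of_metric :: "('m::finite) tensor2 \<Rightarrow> 'm tensor4"
  where "curv_of_metric g = (THE R. is_curv_of_metric g R)"

end

theory Submission
  imports Defs
begin

text \<open>
  Write \<open>dg p u v v\<close> for the covariant derivative of \<open>g\<close> in the direction \<open>u\<close> with respect to the
  round connection. Equators are totally geodesic for the round metric, so their second
  fundamental form for \<open>g\<close> only sees the difference of the two connections, which is the Koszul
  expression in \<open>dg\<close>. Taking the trace, the mean curvature at \<open>p\<close> of the equator with \<open>g\<close>-unit
  normal \<open>\<nu>\<close> vanishes iff \<open>dg p \<nu> \<nu> \<nu> = 2 * div \<nu> - tr \<nu>\<close>, where \<open>div \<nu>\<close> and \<open>tr \<nu>\<close> are the
  \<open>g\<close>-traces of \<open>dg p\<close> with \<open>\<nu>\<close> in the last and in the first slot. Every \<open>g\<close>-unit tangent vector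
  at \<open>p\<close> is normal to an equator through \<open>p\<close>, so all equators are minimal iff
  \<open>dg p v v v = \<alpha> v * g p v v\<close> with the one-form \<open>\<alpha> = 2 * div - tr\<close>. Polarising this cubic
  identity and tracing gives \<open>tr + 2 * div = (n + 2) * \<alpha>\<close>, hence \<open>tr = (n + 1) / 2 * \<alpha>\<close>. By
  Jacobi's formula \<open>tr\<close> is the logarithmic derivative of the determinant of \<open>g\<close>, that is, of the
  square of its volume density \<open>F powr ((n + 1) / 4)\<close>; so \<open>\<alpha> = d (ln F)\<close>, and minimality of all
  equators says that the cubic part of the derivative of \<open>g / F\<close> vanishes: \<open>k = g / F\<close> is a
  Killing tensor. Equivalently \<open>k\<close>, evaluated on the velocity of a great circle, is constant along
  it (\<open>equators_minimal_iff_great_circle_invariant\<close>).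

  It remains to identify such \<open>k\<close> with curvature tensors. If \<open>R\<close> is a curvature tensor then
  \<open>R p v p v\<close> depends only on the bivector of \<open>p\<close> and \<open>v\<close>, which is constant along the great
  circle. Conversely \<open>Q x y = norm x ^ 2 * k p y' y'\<close>, with \<open>p\<close> the direction of \<open>x\<close> and \<open>y'\<close> the
  part of \<open>y\<close> orthogonal to it, is a quadratic form in \<open>y\<close>; invariance along great circles makes
  \<open>Q\<close> symmetric in \<open>x\<close> and \<open>y\<close> (\<open>great_circle_invariant_swap\<close>), so \<open>Q\<close> is biquadratic. A symmetric
  biquadratic form vanishing on the diagonal is the sectional curvature form of a unique algebraic
  curvature tensor (\<open>curvature_tensor_of_biquadratic\<close>, \<open>curvature_tensor_eqI\<close>).

  Finally, dividing a metric by the function that represents its volume density exchanges the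
  exponents \<open>(n - 1) / 4\<close> and \<open>(n + 1) / 4\<close> and replaces that function by its reciprocal
  (\<open>volume_factor_rescale\<close>), so \<open>R \<mapsto> g\<^sub>R\<close> and \<open>g \<mapsto> R\<^sub>g\<close> undo each other.
\<close>

section \<open>Calculus of smooth maps\<close>

lemma Ck_on_cong:
  assumes "open U" "\<And>x. x \<in> U \<Longrightarrow> f x = g x" "Ck_on k U f"
  shows "Ck_on k U g"
  using assms(2,3)
proof (induction k arbitrary: f g)
  case 0
  then show ?case by (simp cong: continuous_on_cong)
next
  case (Suc k)
  have fr: "frechet_derivative g (at x) = frechet_derivative f (at x)" if "x \<in> U" for x
    using frechet_derivative_transform_within_open[of f x U g] Suc.prems that assms(1) by simp
  have "g differentiable (at x)" if "x \<in> U" for x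
    using Suc.prems that assms(1) unfolding differentiable_def Ck_on.simps
    by (metis has_derivative_transform_within_open)
  moreover have "Ck_on k U (\<lambda>x. frechet_derivative g (at x) v)" for v
    using Suc.IH[of "\<lambda>x. frechet_derivative f (at x) v"] Suc.prems(2) fr by auto
  ultimately show ?case by simp
qed

lemma Ck_on_SucI:
  assumes "open U" "\<And>x. x \<in> U \<Longrightarrow> (f has_derivative f' x) (at x)"
    "\<And>v. Ck_on k U (\<lambda>x. f' x v)"
  shows "Ck_on (Suc k) U f"
proof -
  have "frechet_derivative f (at x) = f' x" if "x \<in> U" for x
    using assms(2)[OF that] frechet_derivative_at by metis
  then have "Ck_on k U (\<lambda>x. frechet_derivative f (at x) v)" for v
    using Ck_on_cong[OF assms(1) _ assms(3)] by simp
  then show ?thesis using assms(2) by (auto simp: differentiable_def)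
qed

lemma Ck_on_SucD:
  assumes "Ck_on (Suc k) U f"
  shows "x \<in> U \<Longrightarrow> (f has_derivative frechet_derivative f (at x)) (at x)"
    "Ck_on k U (\<lambda>x. frechet_derivative f (at x) v)"
  using assms by (auto simp: frechet_derivative_works)

lemma Ck_on_Suc_imp: "Ck_on (Suc k) U f \<Longrightarrow> Ck_on k U f"
proof (induction k arbitrary: f)
  case 0
  then show ?case
    by (auto intro!: continuous_at_imp_continuous_on differentiable_imp_continuous_within)
next
  case (Suc k)
  then have "Ck_on (Suc k) U (\<lambda>x. frechet_derivative f (at x) v)" for v
    by (subst (asm) Ck_on.simps(2)) blast
  then show ?case using Suc.IH Suc.prems by simp
qed

lemma Ck_on_subset: "Ck_on k U f \<Longrightarrow> V \<subseteq> U \<Longrightarrow> Ck_on k V f"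
  by (induction k arbitrary: f) (auto intro: continuous_on_subset)

lemma Ck_on_local:
  assumes "\<And>x. x \<in> U \<Longrightarrow> \<exists>V. open V \<and> x \<in> V \<and> Ck_on k V f"
  shows "Ck_on k U f"
  using assms
proof (induction k arbitrary: f)
  case 0
  then show ?case
    by (metis Ck_on.simps(1) continuous_at_imp_continuous_on continuous_on_eq_continuous_at)
next
  case (Suc k)
  have "Ck_on k U (\<lambda>x. frechet_derivative f (at x) v)" for v
  proof (rule Suc.IH)
    fix x assume "x \<in> U"
    then obtain V where "open V" "x \<in> V" "Ck_on (Suc k) V f" using Suc.prems by blast
    then show "\<exists>V. open V \<and> x \<in> V \<and> Ck_on k V (\<lambda>x. frechet_derivative f (at x) v)"
      by auto
  qed
  moreover have "f differentiable (at x)" if "x \<in> U" for x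
    using Suc.prems[OF that] by auto
  ultimately show ?case by simp
qed

lemma Ck_on_const: "Ck_on k U (\<lambda>x. c)"
  by (induction k arbitrary: c) auto

lemma Ck_on_linear:
  assumes "open U" "bounded_linear L" "Ck_on k U f"
  shows "Ck_on k U (\<lambda>x. L (f x))"
  using assms(3)
proof (induction k arbitrary: f)
  case 0
  then show ?case
    using bounded_linear.continuous_on[OF assms(2)] by simp
next
  case (Suc k)
  show ?case
    by (rule Ck_on_SucI[OF assms(1) bounded_linear.has_derivative[OF assms(2) Ck_on_SucD(1)[OF Suc.prems]]])
       (auto intro: Suc.IH Ck_on_SucD(2)[OF Suc.prems])
qed

lemma Ck_on_add:
  assumes "open U" "Ck_on k U f" "Ck_on k U g"
  shows "Ck_on k U (\<lambda>x. f x + g x)"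
  using assms(2,3)
proof (induction k arbitrary: f g)
  case 0
  then show ?case by (simp add: continuous_on_add)
next
  case (Suc k)
  show ?case
    by (rule Ck_on_SucI[OF assms(1) has_derivative_add[OF Ck_on_SucD(1)[OF Suc.prems(1)]
      Ck_on_SucD(1)[OF Suc.prems(2)]]])
       (auto intro: Suc.IH Ck_on_SucD(2)[OF Suc.prems(1)]  Ck_on_SucD(2)[OF Suc.prems(2)])
qed

lemma Ck_on_bilinear:
  assumes "open U" "bounded_bilinear b" "Ck_on k U f" "Ck_on k U g"
  shows "Ck_on k U (\<lambda>x. b (f x) (g x))"
  using assms(3,4)
proof (induction k arbitrary: f g)
  case 0
  then show ?case using bounded_bilinear.continuous_on[OF assms(2)] by simp
next
  case (Suc k)
  show ?case
    by (rule Ck_on_SucI[OF assms(1) bounded_bilinear.FDERIV[OF assms(2) Ck_on_SucD(1)[OF Suc.prems(1)]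
      Ck_on_SucD(1)[OF Suc.prems(2)]]])
       (auto intro!: Ck_on_add Suc.IH assms(1) Ck_on_SucD(2)[OF Suc.prems(1)]
         Ck_on_SucD(2)[OF Suc.prems(2)]
        Ck_on_Suc_imp[OF Suc.prems(1)] Ck_on_Suc_imp[OF Suc.prems(2)])
qed

lemma Ck_on_sum:
  assumes "open U" "\<And>i. i \<in> I \<Longrightarrow> Ck_on k U (f i)"
  shows "Ck_on k U (\<lambda>x. \<Sum>i\<in>I. f i x)"
  using assms(2)
  by (induction I rule: infinite_finite_induct) (auto intro: Ck_on_add Ck_on_const assms(1))

text \<open>The inner derivative is expanded in an orthonormal basis, so that the induction hypothesis
  applies to the partial derivatives of the outer function, which are \<open>Ck_on k\<close> one by one.\<close>

lemma Ck_on_compose: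
  fixes h :: "'a::real_normed_vector \<Rightarrow> 'c::euclidean_space"
  assumes U: "open U" and V: "open V" and hUV: "\<And>x. x \<in> U \<Longrightarrow> h x \<in> V"
    and "Ck_on k V f" "Ck_on k U h"
  shows "Ck_on k U (\<lambda>x. f (h x))"
  using assms(4,5)
proof (induction k arbitrary: f)
  case 0
  then show ?case
    using continuous_on_compose2[of V f U h] hUV by auto
next
  case (Suc k)
  let ?Df = "\<lambda>y. frechet_derivative f (at y)" and ?Dh = "\<lambda>x. frechet_derivative h (at x)"
  have d: "((\<lambda>x. f (h x)) has_derivative (\<lambda>v. \<Sum>b\<in>Basis. (?Dh x v \<bullet> b) *\<^sub>R ?Df (h x) b)) (at x)"
    if "x \<in> U" for x
  proof -
    have 1: "(f has_derivative ?Df (h x)) (at (h x))"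
      using Ck_on_SucD(1)[OF Suc.prems(1)] hUV that by blast
    have 2: "(h has_derivative ?Dh x) (at x)"
      using Ck_on_SucD(1)[OF Suc.prems(2)] that by blast
    have l: "linear (?Df (h x))" using 1 has_derivative_linear by blast
    have e: "?Df (h x) w = (\<Sum>b\<in>Basis. (w \<bullet> b) *\<^sub>R ?Df (h x) b)" for w
      using linear_sum[OF l, of "\<lambda>b. (w \<bullet> b) *\<^sub>R b" Basis]
      by (simp add: euclidean_representation linear_scale[OF l])
    show ?thesis
      by (rule has_derivative_eq_rhs[OF has_derivative_compose[OF 2 1] ext]) (rule e)
  qed
  have "Ck_on k U (\<lambda>x. ?Dh x v \<bullet> b)" for v b
    by (rule Ck_on_linear[OF U bounded_linear_inner_left Ck_on_SucD(2)[OF Suc.prems(2)]])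
  moreover have "Ck_on k U (\<lambda>x. ?Df (h x) b)" for b
    by (rule Suc.IH[OF Ck_on_SucD(2)[OF Suc.prems(1)] Ck_on_Suc_imp[OF Suc.prems(2)]])
  ultimately show ?case
    by (intro Ck_on_SucI[OF U d] Ck_on_sum U Ck_on_bilinear[OF U bounded_bilinear_scaleR]) 
qed

lemma Ck_on_powr: "Ck_on k {0<..} (\<lambda>t::real. t powr a)"
proof (induction k arbitrary: a)
  case 0
  show ?case by (auto intro!: continuous_on_powr continuous_on_id continuous_on_const)
next
  case (Suc k)
  have d: "((\<lambda>t. t powr a) has_derivative (\<lambda>v. v * (a * t powr (a - 1)))) (at t)" 
    if "t \<in> {0<..}" for t :: real
    using has_real_derivative_powr[of t a] that
    by (simp add: has_field_derivative_def mult.commute[of _ "a * t powr (a - 1)"])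
  have "Ck_on k {0<..} (\<lambda>t. (v * a) * t powr (a - 1))" for v :: real
    by (rule Ck_on_linear[OF _ bounded_linear_mult_right]) (auto intro: Suc)
  then have "Ck_on k {0<..} (\<lambda>t. v * (a * t powr (a - 1)))" for v :: real
    by (simp add: mult.assoc)
  then show ?case by (intro Ck_on_SucI[OF _ d]) auto
qed

lemma smooth_cong:
  assumes "open U" "\<And>x. x \<in> U \<Longrightarrow> f x = g x" "smooth_on_open U f"
  shows "smooth_on_open U g"
  using Ck_on_cong[OF assms(1), of f g] assms(2,3) unfolding smooth_on_open_def by blast

lemma smooth_local:
  assumes "\<And>x. x \<in> U \<Longrightarrow> \<exists>V. open V \<and> x \<in> V \<and> smooth_on_open V f"
  shows "smooth_on_open U f"
  using Ck_on_local assms unfolding smooth_on_open_def by metis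

lemma smooth_subset: "smooth_on_open U f \<Longrightarrow> V \<subseteq> U \<Longrightarrow> smooth_on_open V f"
  unfolding smooth_on_open_def using Ck_on_subset by blast

lemma smooth_has_derivative:
  assumes "smooth_on_open U f" "x \<in> U"
  shows "(f has_derivative frechet_derivative f (at x)) (at x)"
proof -
  have "Ck_on (Suc 0) U f" using assms unfolding smooth_on_open_def by blast
  from Ck_on_SucD(1)[OF this assms(2)] show ?thesis .
qed

lemma smooth_frechet_derivative:
  assumes "smooth_on_open U f"
  shows "smooth_on_open U (\<lambda>x. frechet_derivative f (at x) v)"
  unfolding smooth_on_open_def
proof
  fix k
  have "Ck_on (Suc k) U f" using assms unfolding smooth_on_open_def by blast
  then show "Ck_on k U (\<lambda>x. frechet_derivative f (at x) v)" by simp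
qed

lemma smooth_const: "smooth_on_open U (\<lambda>x. c)"
  by (simp add: smooth_on_open_def Ck_on_const)

lemma smooth_linear:
  "open U \<Longrightarrow> bounded_linear L \<Longrightarrow> smooth_on_open U f \<Longrightarrow> smooth_on_open U (\<lambda>x. L (f x))"
  by (simp add: smooth_on_open_def Ck_on_linear)

lemma smooth_ident: "open U \<Longrightarrow> smooth_on_open U (\<lambda>x. x)"
  unfolding smooth_on_open_def
proof
  fix k assume U: "open U"
  show "Ck_on k U (\<lambda>x. x)"
  proof (cases k)
    case (Suc j)
    show ?thesis unfolding Suc
      by (rule Ck_on_SucI[OF U has_derivative_ident]) (rule Ck_on_const)
  qed (simp add: continuous_on_id)
qed

lemma smooth_add:
  "open U \<Longrightarrow> smooth_on_open U f \<Longrightarrow> smooth_on_open U g \<Longrightarrow> smooth_on_open U (\<lambda>x. f x + g x)"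
  by (simp add: smooth_on_open_def Ck_on_add)

lemma smooth_bilinear:
  "open U \<Longrightarrow> bounded_bilinear b \<Longrightarrow> smooth_on_open U f \<Longrightarrow> smooth_on_open U g \<Longrightarrow>
    smooth_on_open U (\<lambda>x. b (f x) (g x))"
  by (simp add: smooth_on_open_def Ck_on_bilinear)

lemmas smooth_inner = smooth_bilinear[OF _ bounded_bilinear_inner]
  and smooth_scaleR = smooth_bilinear[OF _ bounded_bilinear_scaleR]
  and smooth_mult = smooth_bilinear[OF _ bounded_bilinear_mult]

lemma smooth_minus:
  "open U \<Longrightarrow> smooth_on_open U f \<Longrightarrow> smooth_on_open U (\<lambda>x. - f x)"
  using smooth_linear[of U "\<lambda>y. - y" f] bounded_linear_minus[OF bounded_linear_ident] by simp

lemma smooth_diff: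
  "open U \<Longrightarrow> smooth_on_open U f \<Longrightarrow> smooth_on_open U g \<Longrightarrow> smooth_on_open U (\<lambda>x. f x - g x)"
  using smooth_add[of U f "\<lambda>x. - g x"] smooth_minus[of U g] by simp

lemma smooth_sum:
  "open U \<Longrightarrow> (\<And>i. i \<in> I \<Longrightarrow> smooth_on_open U (f i)) \<Longrightarrow> smooth_on_open U (\<lambda>x. \<Sum>i\<in>I. f i x)"
  by (simp add: smooth_on_open_def Ck_on_sum)

lemma smooth_prod:
  fixes f :: "'i \<Rightarrow> 'a::real_normed_vector \<Rightarrow> real"
  assumes "open U" "\<And>i. i \<in> I \<Longrightarrow> smooth_on_open U (f i)"
  shows "smooth_on_open U (\<lambda>x. \<Prod>i\<in>I. f i x)"
  using assms(2)
  by (induction I rule: infinite_finite_induct) (auto intro: smooth_mult smooth_const assms(1))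

lemma smooth_compose:
  fixes h :: "'a::real_normed_vector \<Rightarrow> 'c::euclidean_space"
  shows "open U \<Longrightarrow> open V \<Longrightarrow> (\<And>x. x \<in> U \<Longrightarrow> h x \<in> V) \<Longrightarrow> smooth_on_open V f \<Longrightarrow>
    smooth_on_open U h \<Longrightarrow> smooth_on_open U (\<lambda>x. f (h x))"
  by (simp add: smooth_on_open_def Ck_on_compose)

lemma smooth_powr:
  "open U \<Longrightarrow> (\<And>x. x \<in> U \<Longrightarrow> 0 < f x) \<Longrightarrow> smooth_on_open U f \<Longrightarrow>
    smooth_on_open U (\<lambda>x. f x powr a :: real)"
  by (rule smooth_compose[of U "{0<..}"]) (auto simp: smooth_on_open_def Ck_on_powr)

lemma smooth_vec_lambda:
  fixes f :: "'i::finite \<Rightarrow> 'a::real_normed_vector \<Rightarrow> 'b::euclidean_space"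
  assumes U: "open U" and f: "\<And>i. smooth_on_open U (f i)"
  shows "smooth_on_open U (\<lambda>x. \<chi> i. f i x)"
proof -
  have bl: "bounded_linear (\<lambda>y::'b. axis i y)" for i :: 'i
    by (rule linear_conv_bounded_linear[THEN iffD1])
       (auto intro!: linearI simp: vec_eq_iff axis_def)
  have "(\<lambda>x. \<chi> i. f i x) = (\<lambda>x. \<Sum>i\<in>UNIV. axis i (f i x))"
    by (simp add: fun_eq_iff vec_eq_iff axis_def)
  moreover have "smooth_on_open U (\<lambda>x. \<Sum>i\<in>UNIV. axis i (f i x))"
    by (rule smooth_sum[OF U smooth_linear[OF U bl f]])
  ultimately show ?thesis by simp
qed

lemma smooth_vec_nth:
  fixes f :: "'a::real_normed_vector \<Rightarrow> 'b::real_normed_vector ^ 'i::finite"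
  assumes "open U" "smooth_on_open U f"
  shows "smooth_on_open U (\<lambda>x. f x $ i)"
  using smooth_linear[OF assms(1) bounded_linear_vec_nth assms(2)] .

lemma smooth_matrix_iff:
  fixes A :: "'a::real_normed_vector \<Rightarrow> real ^ 'n::finite ^ 'm::finite"
  assumes "open U"
  shows "smooth_on_open U A \<longleftrightarrow> (\<forall>i j. smooth_on_open U (\<lambda>x. A x $ i $ j))"
proof
  assume "smooth_on_open U A"
  then show "\<forall>i j. smooth_on_open U (\<lambda>x. A x $ i $ j)"
    by (simp add: smooth_vec_nth assms)
next
  assume "\<forall>i j. smooth_on_open U (\<lambda>x. A x $ i $ j)"
  then have "smooth_on_open U (\<lambda>x. \<chi> i. \<chi> j. A x $ i $ j)"
    by (intro smooth_vec_lambda assms) auto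
  then show "smooth_on_open U A" by simp
qed

lemma smooth_det:
  fixes A :: "'a::real_normed_vector \<Rightarrow> real ^ 'n::finite ^ 'n"
  assumes U: "open U" and A: "smooth_on_open U A"
  shows "smooth_on_open U (\<lambda>x. det (A x))"
  unfolding det_def
  using smooth_matrix_iff[OF U, of A] A
  by (intro smooth_sum[OF U] smooth_mult[OF U smooth_const] smooth_prod[OF U]) auto

lemma smooth_matrix_vector_mult:
  fixes A :: "'a::real_normed_vector \<Rightarrow> real ^ 'n::finite ^ 'm::finite"
  assumes U: "open U" and A: "smooth_on_open U A" and v: "smooth_on_open U v"
  shows "smooth_on_open U (\<lambda>x. A x *v v x)"
  unfolding matrix_vector_mult_def
  using smooth_matrix_iff[OF U, of A] A
  by (intro smooth_vec_lambda[OF U] smooth_sum[OF U] smooth_mult[OF U] smooth_vec_nth[OF U v]) auto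

text \<open>Cramer's rule expresses the solution of a linear system by determinants, and the determinant is
  a polynomial in the entries.\<close>

lemma smooth_linear_system:
  fixes A :: "'a::real_normed_vector \<Rightarrow> real ^ 'n::finite ^ 'n"
  assumes U: "open U" and A: "smooth_on_open U A" and b: "smooth_on_open U b"
    and pos: "\<And>x. x \<in> U \<Longrightarrow> det (A x) > 0" and eq: "\<And>x. x \<in> U \<Longrightarrow> A x *v s x = b x"
  shows "smooth_on_open U s"
proof -
  let ?C = "\<lambda>k x. (\<chi> i j. if j = k then b x $ i else A x $ i $ j) :: real^'n^'n"
  have "smooth_on_open U (\<lambda>x. ?C k x $ i $ j)" for i j k
    using smooth_matrix_iff[OF U, of A] A smooth_vec_nth[OF U b] by (cases "j = k") auto
  then have C: "smooth_on_open U (?C k)" for k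
    using smooth_matrix_iff[OF U, of "?C k"] by blast
  have sm: "smooth_on_open U (\<lambda>x. \<chi> k. det (?C k x) * det (A x) powr - 1)"
    by (intro smooth_vec_lambda[OF U] smooth_mult[OF U] smooth_det[OF U C]
        smooth_powr[OF U pos smooth_det[OF U A]])
  have "(\<chi> k. det (?C k x) * det (A x) powr - 1) = s x" if "x \<in> U" for x
    using cramer[of "A x" "s x" "b x"] eq[OF that] pos[OF that]
    by (simp add: powr_minus divide_inverse)
  from smooth_cong[OF U this sm] show ?thesis .
qed

section \<open>Smooth maps and derivatives on the sphere\<close>

lemma open_punctured: "open (- {0} :: 'a::real_normed_vector set)"
  by (simp add: open_Compl)

lemma sgn_in_Sph: "x \<noteq> 0 \<Longrightarrow> sgn x \<in> Sph"
  by (simp add: norm_sgn)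

lemma sgn_Sph: "p \<in> Sph \<Longrightarrow> sgn p = p"
  by (simp add: sgn_div_norm)

lemma Sph_nonzero: "p \<in> Sph \<Longrightarrow> p \<noteq> 0"
  by auto

lemma Sph_inner: "p \<in> Sph \<Longrightarrow> p \<bullet> p = 1"
  by (simp add: dot_square_norm)

lemma smooth_sgn: "smooth_on_open (- {0}) (sgn :: real ^ 'm::finite \<Rightarrow> real ^ 'm)"
proof -
  have sm: "smooth_on_open (- {0}) (\<lambda>x :: real ^ 'm. (x \<bullet> x) powr (- 1 / 2) *\<^sub>R x)"
    by (intro smooth_scaleR smooth_powr smooth_inner smooth_ident open_punctured) auto
  have "(x \<bullet> x) powr (- 1 / 2) *\<^sub>R x = sgn x" for x :: "real ^ 'm"
  proof (cases "x = 0")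
    case False
    then have "(x \<bullet> x) powr (- 1 / 2) = inverse (sqrt (x \<bullet> x))"
      by (simp add: powr_minus powr_half_sqrt)
    then show ?thesis by (simp add: sgn_div_norm norm_eq_sqrt_inner)
  qed simp
  then show ?thesis using sm by simp
qed

text \<open>A smooth map on the sphere extends to the punctured space as a map that is constant along rays.
  This global extension replaces the local ones in the definition and is the one that \<open>sderiv\<close>
  differentiates, so the rules for open sets carry over to the sphere.\<close>

lemma smooth_on_sphere_iff:
  fixes f :: "real ^ 'm::finite \<Rightarrow> 'b::real_normed_vector"
  shows "smooth_on_sphere f \<longleftrightarrow> smooth_on_open (- {0}) (\<lambda>x. f (sgn x))"
proof
  assume f: "smooth_on_sphere f"
  show "smooth_on_open (- {0}) (\<lambda>x. f (sgn x))"
  proof (rule smooth_local)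
    fix x :: "real ^ 'm" assume "x \<in> - {0}"
    then have "sgn x \<in> Sph" using sgn_in_Sph by blast
    then obtain U F where U: "open U" "sgn x \<in> U" "smooth_on_open U F"
      and F: "\<forall>y\<in>U \<inter> Sph. F y = f y"
      using f unfolding smooth_on_sphere_def by blast
    let ?V = "sgn -` U \<inter> - {0}"
    have "continuous_on (- {0} :: (real ^ 'm) set) sgn"
      using smooth_sgn[where 'm = 'm] unfolding smooth_on_open_def by (metis Ck_on.simps(1))
    then have V: "open ?V"
      using continuous_on_open_vimage[OF open_punctured] U(1) by blast
    have "smooth_on_open ?V (\<lambda>y. F (sgn y))"
      by (rule smooth_compose[OF V U(1) _ U(3) smooth_subset[OF smooth_sgn]]) auto
    then have "smooth_on_open ?V (\<lambda>y. f (sgn y))"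
      by (rule smooth_cong[OF V, rotated]) (use F in \<open>auto simp: norm_sgn\<close>)
    then show "\<exists>V. open V \<and> x \<in> V \<and> smooth_on_open V (\<lambda>y. f (sgn y))"
      using V U(2) \<open>x \<in> - {0}\<close> by (intro exI[of _ ?V]) auto
  qed
next
  assume "smooth_on_open (- {0}) (\<lambda>x. f (sgn x))"
  then show "smooth_on_sphere f"
    unfolding smooth_on_sphere_def
    by (intro ballI exI[of _ "- {0}"] exI[of _ "\<lambda>x. f (sgn x)"])
      (auto simp: open_punctured sgn_Sph)
qed

lemma sph_cong:
  assumes "\<And>p. p \<in> Sph \<Longrightarrow> f p = g p" "smooth_on_sphere f"
  shows "smooth_on_sphere g"
  using assms(2) unfolding smooth_on_sphere_iff
  by (rule smooth_cong[OF open_punctured, rotated]) (use assms(1) sgn_in_Sph in auto)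

lemma sph_const: "smooth_on_sphere (\<lambda>p. c)"
  by (simp add: smooth_on_sphere_iff smooth_const)

lemma sph_ident: "smooth_on_sphere (\<lambda>p. p)"
  using smooth_sgn by (simp add: smooth_on_sphere_iff)

lemma sph_add:
  "smooth_on_sphere f \<Longrightarrow> smooth_on_sphere g \<Longrightarrow> smooth_on_sphere (\<lambda>p. f p + g p)"
  unfolding smooth_on_sphere_iff by (rule smooth_add[OF open_punctured])

lemma sph_diff:
  "smooth_on_sphere f \<Longrightarrow> smooth_on_sphere g \<Longrightarrow> smooth_on_sphere (\<lambda>p. f p - g p)"
  unfolding smooth_on_sphere_iff by (rule smooth_diff[OF open_punctured])

lemma sph_scaleR:
  "smooth_on_sphere f \<Longrightarrow> smooth_on_sphere g \<Longrightarrow> smooth_on_sphere (\<lambda>p. f p *\<^sub>R g p)"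
  unfolding smooth_on_sphere_iff by (rule smooth_scaleR[OF open_punctured])

lemma sph_mult:
  fixes f g :: "real ^ 'm::finite \<Rightarrow> real"
  shows "smooth_on_sphere f \<Longrightarrow> smooth_on_sphere g \<Longrightarrow> smooth_on_sphere (\<lambda>p. f p * g p)"
  unfolding smooth_on_sphere_iff by (rule smooth_mult[OF open_punctured])

lemma sph_inner:
  "smooth_on_sphere f \<Longrightarrow> smooth_on_sphere g \<Longrightarrow> smooth_on_sphere (\<lambda>p. f p \<bullet> g p)"
  unfolding smooth_on_sphere_iff by (rule smooth_inner[OF open_punctured])

lemma sph_sum:
  "(\<And>i. i \<in> I \<Longrightarrow> smooth_on_sphere (f i)) \<Longrightarrow> smooth_on_sphere (\<lambda>p. \<Sum>i\<in>I. f i p)"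
  unfolding smooth_on_sphere_iff by (rule smooth_sum[OF open_punctured])

lemma sph_powr:
  "(\<And>p. p \<in> Sph \<Longrightarrow> 0 < f p) \<Longrightarrow> smooth_on_sphere f \<Longrightarrow> smooth_on_sphere (\<lambda>p. f p powr a :: real)"
  unfolding smooth_on_sphere_iff by (rule smooth_powr[OF open_punctured]) (auto simp: norm_sgn)

lemma sph_vec_lambda:
  fixes f :: "'i::finite \<Rightarrow> real ^ 'm::finite \<Rightarrow> 'b::euclidean_space"
  shows "(\<And>i. smooth_on_sphere (f i)) \<Longrightarrow> smooth_on_sphere (\<lambda>p. \<chi> i. f i p)"
  unfolding smooth_on_sphere_iff by (rule smooth_vec_lambda[OF open_punctured])

lemma sph_vec_nth:
  fixes f :: "real ^ 'm::finite \<Rightarrow> 'b::real_normed_vector ^ 'i::finite"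
  shows "smooth_on_sphere f \<Longrightarrow> smooth_on_sphere (\<lambda>p. f p $ i)"
  unfolding smooth_on_sphere_iff by (rule smooth_vec_nth[OF open_punctured])

lemma sph_det:
  fixes A :: "real ^ 'm::finite \<Rightarrow> real ^ 'n::finite ^ 'n"
  shows "smooth_on_sphere A \<Longrightarrow> smooth_on_sphere (\<lambda>p. det (A p))"
  unfolding smooth_on_sphere_iff by (rule smooth_det[OF open_punctured])

lemma sph_matrix_vector_mult:
  fixes A :: "real ^ 'm::finite \<Rightarrow> real ^ 'n::finite ^ 'k::finite"
  shows "smooth_on_sphere A \<Longrightarrow> smooth_on_sphere f \<Longrightarrow> smooth_on_sphere (\<lambda>p. A p *v f p)"
  unfolding smooth_on_sphere_iff by (rule smooth_matrix_vector_mult[OF open_punctured])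

lemma sph_linear_system:
  fixes A :: "real ^ 'm::finite \<Rightarrow> real ^ 'n::finite ^ 'n"
  assumes "smooth_on_sphere A" "smooth_on_sphere b"
    "\<And>p. p \<in> Sph \<Longrightarrow> det (A p) > 0" "\<And>p. p \<in> Sph \<Longrightarrow> A p *v s p = b p"
  shows "smooth_on_sphere s"
  unfolding smooth_on_sphere_iff
  by (rule smooth_linear_system[OF open_punctured, of "\<lambda>x. A (sgn x)" "\<lambda>x. b (sgn x)"])
    (use assms sgn_in_Sph in \<open>auto simp: smooth_on_sphere_iff\<close>)

lemma has_sderiv:
  assumes "smooth_on_sphere f" "p \<in> Sph"
  shows "((\<lambda>x. f (sgn x)) has_derivative sderiv f p) (at p)"
proof -
  have e: "sderiv f p = frechet_derivative (\<lambda>x. f (sgn x)) (at p)"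
    by (rule ext) (simp add: sderiv_def)
  show ?thesis unfolding e
    by (rule smooth_has_derivative[of "- {0}"])
      (use assms Sph_nonzero in \<open>auto simp: smooth_on_sphere_iff\<close>)
qed

lemma sderivI:
  assumes "((\<lambda>x. f (sgn x)) has_derivative D) (at p)"
  shows "sderiv f p v = D v"
  using frechet_derivative_at[OF assms] by (simp add: sderiv_def)

lemma linear_sderiv: "smooth_on_sphere f \<Longrightarrow> p \<in> Sph \<Longrightarrow> linear (sderiv f p)"
  using has_sderiv has_derivative_linear by blast

lemma sderiv_cong:
  assumes "\<And>q. q \<in> Sph \<Longrightarrow> f q = g q" "smooth_on_sphere f" "p \<in> Sph"
  shows "sderiv g p v = sderiv f p v"
proof (rule sderivI)
  show "((\<lambda>x. g (sgn x)) has_derivative sderiv f p) (at p)"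
    by (rule has_derivative_transform_within_open[OF has_sderiv[OF assms(2,3)] open_punctured])
      (use assms sgn_in_Sph Sph_nonzero in auto)
qed

lemma sderiv_const: "sderiv (\<lambda>p. c) p v = 0"
  by (simp add: sderiv_def)

lemma sderiv_add:
  assumes "smooth_on_sphere f" "smooth_on_sphere g" "p \<in> Sph"
  shows "sderiv (\<lambda>q. f q + g q) p v = sderiv f p v + sderiv g p v"
  by (rule sderivI[OF has_derivative_add[OF has_sderiv[OF assms(1,3)] has_sderiv[OF assms(2,3)]]])

lemma sderiv_linear:
  assumes "bounded_linear L" "smooth_on_sphere f" "p \<in> Sph"
  shows "sderiv (\<lambda>q. L (f q)) p v = L (sderiv f p v)"
  by (rule sderivI[OF bounded_linear.has_derivative[OF assms(1) has_sderiv[OF assms(2,3)]]])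

lemma sderiv_bilinear:
  assumes "bounded_bilinear b" "smooth_on_sphere f" "smooth_on_sphere g" "p \<in> Sph"
  shows "sderiv (\<lambda>q. b (f q) (g q)) p v = b (f p) (sderiv g p v) + b (sderiv f p v) (g p)"
  using sderivI[OF bounded_bilinear.FDERIV[OF assms(1) has_sderiv[OF assms(2,4)] has_sderiv[OF
    assms(3,4)]], of v]
  by (simp add: sgn_Sph[OF assms(4)])

lemmas sderiv_inner = sderiv_bilinear[OF bounded_bilinear_inner]
  and sderiv_scaleR = sderiv_bilinear[OF bounded_bilinear_scaleR]

lemma bounded_bilinear_matrix_vector_mult:
  "bounded_bilinear ((*v) :: real ^ 'n::finite ^ 'm::finite \<Rightarrow> real ^ 'n \<Rightarrow> real ^ 'm)"
  unfolding bilinear_conv_bounded_bilinear[symmetric] bilinear_def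
  by (auto intro!: linearI simp: matrix_vector_mult_add_rdistrib matrix_vector_right_distrib
      scaleR_matrix_vector_assoc matrix_vector_mult_scaleR)

lemmas sderiv_matrix_vector = sderiv_bilinear[OF bounded_bilinear_matrix_vector_mult]

text \<open>The derivative of the radial retraction at a point of the sphere is the orthogonal projection
  onto the tangent space.\<close>

lemma sderiv_ident:
  assumes "p \<in> Sph" shows "sderiv (\<lambda>q. q) p v = v - (p \<bullet> v) *\<^sub>R p"
proof (rule sderivI)
  have p: "norm p = 1" "p \<noteq> 0" using assms by auto
  have "((\<lambda>x. inverse (norm x) *\<^sub>R x) has_derivative
      (\<lambda>v. inverse (norm p) *\<^sub>R v + (- (inverse (norm p) * (v \<bullet> sgn p) * inverse (norm p))) *\<^sub>R p)) (at p)"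
    by (rule derivative_eq_intros refl has_derivative_norm | simp add: p)+
  then show "(sgn has_derivative (\<lambda>v. v - (p \<bullet> v) *\<^sub>R p)) (at p)"
    using p by (simp add: sgn_div_norm[abs_def] inner_commute sgn_Sph[OF assms] scaleR_minus_left)
qed

lemma sderiv_along_curve:
  assumes f: "smooth_on_sphere f" and c: "\<And>s. c s \<in> Sph"
    and d: "(c has_vector_derivative w) (at t)"
  shows "((\<lambda>s. f (c s)) has_vector_derivative sderiv f (c t) w) (at t)"
proof -
  have "((\<lambda>s. f (sgn (c s))) has_derivative (\<lambda>h. sderiv f (c t) (h *\<^sub>R w))) (at t)"
    by (rule has_derivative_compose[OF d[unfolded has_vector_derivative_def] has_sderiv[OF f c]])
  then show ?thesis
    using linear_scale[OF linear_sderiv[OF f c]] sgn_Sph[OF c]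
    by (simp add: has_vector_derivative_def)
qed

text \<open>The derivative along a field is a combination of partial derivatives with the components of the
  field as coefficients; only the partial derivatives in fixed directions are known to be smooth.\<close>

lemma sph_sderiv:
  fixes f :: "real ^ 'm::finite \<Rightarrow> 'b::real_normed_vector"
  assumes f: "smooth_on_sphere f" and X: "smooth_on_sphere X"
  shows "smooth_on_sphere (\<lambda>p. sderiv f p (X p))"
proof -
  let ?g = "\<lambda>b x. frechet_derivative (\<lambda>x. f (sgn x)) (at x) b"
  have g: "smooth_on_open (- {0}) (?g b)" for b
    by (rule smooth_frechet_derivative) (use f in \<open>simp add: smooth_on_sphere_iff\<close>)
  have "smooth_on_open (- {0}) (\<lambda>x. ?g b (sgn x))" for b
    by (rule smooth_compose[OF open_punctured open_punctured _ g smooth_sgn]) (auto simp: sgn_zero_iff)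
  then have "smooth_on_sphere (?g b)" for b by (simp add: smooth_on_sphere_iff)
  then have "smooth_on_sphere (\<lambda>p. \<Sum>b\<in>Basis. (X p \<bullet> b) *\<^sub>R ?g b p)"
    by (intro sph_sum sph_scaleR sph_inner X sph_const)
  moreover have "(\<Sum>b\<in>Basis. (X p \<bullet> b) *\<^sub>R ?g b p) = sderiv f p (X p)" if "p \<in> Sph" for p
  proof -
    have l: "linear (sderiv f p)" by (rule linear_sderiv[OF f that])
    have "sderiv f p (X p) = sderiv f p (\<Sum>b\<in>Basis. (X p \<bullet> b) *\<^sub>R b)"
      by (simp add: euclidean_representation)
    also have "\<dots> = (\<Sum>b\<in>Basis. (X p \<bullet> b) *\<^sub>R sderiv f p b)"
      by (simp only: linear_sum[OF l] linear_scale[OF l])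
    finally show ?thesis by (simp add: sderiv_def)
  qed
  ultimately show ?thesis by (rule sph_cong[rotated])
qed

section \<open>Tangent vectors and vector fields\<close>

definition tproj :: "real ^ 'm::finite \<Rightarrow> real ^ 'm \<Rightarrow> real ^ 'm"
  where "tproj p v = v - (p \<bullet> v) *\<^sub>R p"

lemma tspace_iff: "v \<in> tspace p \<longleftrightarrow> p \<bullet> v = 0"
  by (simp add: tspace_def)

lemma tspace_subspace: "subspace (tspace p)"
  unfolding tspace_def by (rule subspace_hyperplane)

lemmas tspace_add = subspace_add[OF tspace_subspace]
  and tspace_diff = subspace_diff[OF tspace_subspace]
  and tspace_scale = subspace_scale[OF tspace_subspace]
  and tspace_zero = subspace_0[OF tspace_subspace]
  and tspace_sum = subspace_sum[OF tspace_subspace]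

lemma tproj_tspace: "p \<in> Sph \<Longrightarrow> tproj p v \<in> tspace p"
  by (simp add: tproj_def tspace_iff inner_diff_right Sph_inner del: mem_sphere_0)

lemma tproj_id: "v \<in> tspace p \<Longrightarrow> tproj p v = v"
  by (simp add: tproj_def tspace_iff)

lemma tproj_inner: "w \<in> tspace p \<Longrightarrow> tproj p v \<bullet> w = v \<bullet> w"
  by (simp add: tproj_def tspace_iff inner_diff_left)

lemma tproj_add: "tproj p (v + w) = tproj p v + tproj p w"
  by (simp add: tproj_def inner_add_right algebra_simps)

lemma tproj_scale: "tproj p (c *\<^sub>R v) = c *\<^sub>R tproj p v"
  by (simp add: tproj_def algebra_simps)

lemma tproj_diff: "tproj p (v - w) = tproj p v - tproj p w"
  by (simp add: tproj_def inner_diff_right algebra_simps)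

lemma sph_tproj: "smooth_on_sphere f \<Longrightarrow> smooth_on_sphere (\<lambda>p. tproj p (f p))"
  unfolding tproj_def by (intro sph_diff sph_scaleR sph_inner sph_ident)

text \<open>The simplest way to extend a tangent vector at one point to a global tangent field. These fields
  are also tangent to every equator whose normal is orthogonal to \<open>v\<close>, which makes them admissible
  in the second fundamental form.\<close>

definition const_field :: "real ^ 'm::finite \<Rightarrow> 'm vector_field"
  where "const_field v p = (if p \<in> Sph then tproj p v else 0)"

lemma vector_fieldsD:
  assumes "X \<in> vector_fields"
  shows "smooth_on_sphere X" "X p \<in> tspace p" "p \<notin> Sph \<Longrightarrow> X p = 0"
  using assms tspace_zero[of p] unfolding vector_fields_def by (cases "p \<in> Sph"; auto)+

lemma const_field: "const_field v \<in> vector_fields"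
proof -
  have "smooth_on_sphere (\<lambda>p. tproj p v)" by (intro sph_tproj sph_const)
  then have "smooth_on_sphere (const_field v)"
    by (rule sph_cong[rotated]) (simp add: const_field_def)
  then show ?thesis
    unfolding vector_fields_def using tproj_tspace by (auto simp: const_field_def)
qed

lemma const_field_eq: "p \<in> Sph \<Longrightarrow> v \<in> tspace p \<Longrightarrow> const_field v p = v"
  by (simp add: const_field_def tproj_id)

text \<open>Differentiating \<open>q \<bullet> X q = 0\<close>. The normal part of the ambient derivative is thus symmetric in
  the two fields, which is why the Lie bracket is tangent.\<close>

lemma inner_sderiv_field:
  assumes "X \<in> vector_fields" "p \<in> Sph" "v \<in> tspace p"
  shows "p \<bullet> sderiv X p v = - (v \<bullet> X p)"
proof -
  have "sderiv (\<lambda>q. q \<bullet> X q) p v = sderiv (\<lambda>q. 0) p v"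
    by (rule sderiv_cong) (use assms vector_fieldsD(2)[OF assms(1)] in \<open>auto simp: tspace_iff sph_const\<close>)
  then show ?thesis
    using sderiv_inner[OF sph_ident vector_fieldsD(1)[OF assms(1)] assms(2), of v] assms
    by (simp add: sderiv_const sderiv_ident tspace_iff del: mem_sphere_0)
qed

section \<open>A Riemannian metric as a field of matrices\<close>

lemma bilinear_matrix:
  fixes b :: "real ^ 'm::finite \<Rightarrow> real ^ 'm \<Rightarrow> real"
  assumes "\<And>w. linear (\<lambda>v. b v w)" "\<And>v. linear (b v)"
  shows "v \<bullet> ((\<chi> i j. b (axis i 1) (axis j 1)) *v w) = b v w"
proof -
  have "b v w = b (\<Sum>i\<in>UNIV. v $ i *s axis i 1) w" by (simp add: basis_expansion)
  also have "\<dots> = (\<Sum>i\<in>UNIV. v $ i * b (axis i 1) w)"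
    by (simp add: linear_sum[OF assms(1)] linear_scale[OF assms(1)] scalar_mult_eq_scaleR)
  also have "\<dots> = (\<Sum>i\<in>UNIV. v $ i * b (axis i 1) (\<Sum>j\<in>UNIV. w $ j *s axis j 1))"
    by (simp add: basis_expansion)
  also have "\<dots> = (\<Sum>i\<in>UNIV. v $ i * (\<Sum>j\<in>UNIV. b (axis i 1) (axis j 1) * w $ j))"
    by (simp add: linear_sum[OF assms(2)] linear_scale[OF assms(2)] scalar_mult_eq_scaleR mult.commute)
  finally show ?thesis by (simp add: inner_vec_def matrix_vector_mult_def)
qed

lemma linear_functional_vec:
  fixes L :: "real ^ 'm::finite \<Rightarrow> real"
  assumes "linear L"
  shows "(\<chi> k. L (axis k 1)) \<bullet> z = L z"
proof -
  have "L z = L (\<Sum>i\<in>UNIV. z $ i *s axis i 1)" by (simp add: basis_expansion)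
  also have "\<dots> = (\<Sum>i\<in>UNIV. z $ i * L (axis i 1))"
    by (simp add: linear_sum[OF assms] linear_scale[OF assms] scalar_mult_eq_scaleR)
  finally show ?thesis by (simp add: inner_vec_def mult.commute)
qed

text \<open>The segment from the identity to a positive definite matrix consists of invertible matrices, so
  the determinant keeps its sign along it.\<close>

lemma det_pos_of_positive_definite:
  fixes A :: "real ^ 'm::finite ^ 'm"
  assumes pd: "\<And>v. v \<noteq> 0 \<Longrightarrow> v \<bullet> (A *v v) > 0"
  shows "det A > 0"
proof (rule ccontr)
  let ?f = "\<lambda>t::real. det ((1 - t) *\<^sub>R mat 1 + t *\<^sub>R A)"
  assume neg: "\<not> det A > 0"
  have "continuous_on {0..1} ?f"
    unfolding det_def by (intro continuous_intros)
  then have "\<exists>t\<ge>0. t \<le> 1 \<and> ?f t = 0"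
    using neg by (intro IVT2') (auto simp: det_I)
  then obtain t where t: "0 \<le> t" "t \<le> 1" "?f t = 0" by blast
  let ?B = "(1 - t) *\<^sub>R mat 1 + t *\<^sub>R A"
  from t(3) have "\<not> invertible ?B" by (simp add: invertible_det_nz)
  then obtain v where v: "?B *v v = 0" "v \<noteq> 0"
    using matrix_left_invertible_ker invertible_left_inverse by blast
  have "v \<bullet> (?B *v v) = (1 - t) * (v \<bullet> v) + t * (v \<bullet> (A *v v))"
    by (simp add: matrix_vector_mult_add_rdistrib scaleR_matrix_vector_assoc[symmetric] inner_add_right)
  moreover have "(1 - t) * (v \<bullet> v) + t * (v \<bullet> (A *v v)) > 0"
  proof (cases "t = 0")
    case False
    then have "t * (v \<bullet> (A *v v)) > 0" using t pd[OF v(2)] by simp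
    moreover have "(1 - t) * (v \<bullet> v) \<ge> 0" using t by simp
    ultimately show ?thesis by linarith
  qed (use v(2) in simp)
  ultimately show False using v(1) by simp
qed

text \<open>The metric as a matrix on the ambient space. The summand \<open>p p\<^sup>T\<close> makes the point \<open>p\<close> a unit
  vector orthogonal to the tangent space, so the matrix is positive definite and its determinant
  is that of \<open>g\<close> relative to the round metric.\<close>

definition gmat :: "('m::finite) tensor2 \<Rightarrow> real ^ 'm \<Rightarrow> real ^ 'm ^ 'm"
  where "gmat g p = (\<chi> i j. g p (tproj p (axis i 1)) (tproj p (axis j 1)) + p $ i * p $ j)"

definition dmat :: "('m::finite) tensor2 \<Rightarrow> real ^ 'm \<Rightarrow> real ^ 'm \<Rightarrow> real ^ 'm ^ 'm"
  where "dmat g p u = sderiv (gmat g) p u"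

text \<open>On tangent vectors this is the covariant derivative of \<open>g\<close> with respect to the round connection,
  with \<open>u\<close> the direction of differentiation (see \<open>sderiv_metric\<close> below).\<close>

definition dg :: "('m::finite) tensor2 \<Rightarrow> real ^ 'm \<Rightarrow> real ^ 'm \<Rightarrow> real ^ 'm \<Rightarrow> real ^ 'm \<Rightarrow> real"
  where "dg g p u v w = v \<bullet> (dmat g p u *v w)"

text \<open>The vector that represents, for the standard inner product, the right-hand side of the Koszul
  formula in its third argument.\<close>

definition koszul :: "('m::finite) tensor2 \<Rightarrow> real ^ 'm \<Rightarrow> real ^ 'm \<Rightarrow> real ^ 'm \<Rightarrow> real ^ 'm"
  where "koszul g p x y =
    (1 / 2) *\<^sub>R (dmat g p x *v y + dmat g p y *v x - (\<chi> k. dg g p (axis k 1) x y))"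

text \<open>The Levi-Civita connection of \<open>g\<close> minus the round one. The tangential projection discards the
  normal component of \<open>koszul\<close>, which tangent test vectors do not see.\<close>

definition christoffel :: "('m::finite) tensor2 \<Rightarrow> real ^ 'm \<Rightarrow> real ^ 'm \<Rightarrow> real ^ 'm \<Rightarrow> real ^ 'm"
  where "christoffel g p x y = matrix_inv (gmat g p) *v tproj p (koszul g p x y)"

definition koszul_connection :: "('m::finite) tensor2 \<Rightarrow> 'm vector_field \<Rightarrow> 'm vector_field \<Rightarrow> 'm vector_field"
  where "koszul_connection g X Y p = (if X \<in> vector_fields \<and> Y \<in> vector_fields \<and> p \<in> Sph
     then tproj p (sderiv Y p (X p)) + christoffel g p (X p) (Y p) else 0)"

locale sphere_metric =
  fixes g :: "('m::finite) tensor2"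
  assumes riem: "riemannian_metric g"
begin

lemma g_off: "\<not> (p \<in> Sph \<and> v \<in> tspace p \<and> w \<in> tspace p) \<Longrightarrow> g p v w = 0"
  using riem unfolding riemannian_metric_def by blast

lemma g_comb: "p \<in> Sph \<Longrightarrow> u \<in> tspace p \<Longrightarrow> v \<in> tspace p \<Longrightarrow> w \<in> tspace p \<Longrightarrow>
    g p (a *\<^sub>R u + b *\<^sub>R v) w = a * g p u w + b * g p v w"
  using riem unfolding riemannian_metric_def by blast

lemma g_sym: "g p v w = g p w v"
proof (cases "p \<in> Sph \<and> v \<in> tspace p \<and> w \<in> tspace p")
  case True
  then show ?thesis using riem unfolding riemannian_metric_def by blast
next
  case False
  then show ?thesis using g_off[of p v w] g_off[of p w v] by auto
qed

lemma g_pos: "p \<in> Sph \<Longrightarrow> v \<in> tspace p \<Longrightarrow> v \<noteq> 0 \<Longrightarrow> g p v v > 0"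
  using riem unfolding riemannian_metric_def by blast

lemma g_smooth: "X \<in> vector_fields \<Longrightarrow> Y \<in> vector_fields \<Longrightarrow> smooth_on_sphere (\<lambda>p. g p (X p) (Y p))"
  using riem unfolding riemannian_metric_def by blast

lemma gmat_inner_general:
  assumes p: "p \<in> Sph"
  shows "v \<bullet> (gmat g p *v w) = g p (tproj p v) (tproj p w) + (p \<bullet> v) * (p \<bullet> w)"
proof -
  let ?b = "\<lambda>v w. g p (tproj p v) (tproj p w) + (p \<bullet> v) * (p \<bullet> w)"
  note T = tproj_tspace[OF p]
  have l: "linear (\<lambda>v. ?b v w)" for w
  proof (rule linearI)
    fix x y :: "real ^ 'm" and r :: real
    show "?b (x + y) w = ?b x w + ?b y w"
      using g_comb[OF p T T T, of 1 x 1 y w] by (simp add: tproj_add inner_add_right algebra_simps)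
    show "?b (r *\<^sub>R x) w = r *\<^sub>R ?b x w"
      using g_comb[OF p T T T, of r x 0 x w] by (simp add: tproj_scale algebra_simps)
  qed
  have "linear (?b v)" for v
  proof -
    have "(\<lambda>w. ?b w v) = ?b v"
      using g_sym[of p "tproj p v"] by (simp add: fun_eq_iff mult.commute)
    then show ?thesis using l[of v] by simp
  qed
  from bilinear_matrix[of ?b, OF l this]
  show ?thesis by (simp add: gmat_def inner_axis)
qed

lemma gmat_inner:
  assumes "p \<in> Sph" "v \<in> tspace p" "w \<in> tspace p"
  shows "v \<bullet> (gmat g p *v w) = g p v w"
  using gmat_inner_general[OF assms(1), of v w] assms by (simp add: tproj_id tspace_iff)

lemma gmat_sym: "p \<in> Sph \<Longrightarrow> v \<bullet> (gmat g p *v w) = (gmat g p *v v) \<bullet> w"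
  using gmat_inner_general[of p v w] gmat_inner_general[of p w v] g_sym[of p "tproj p v" "tproj p w"]
  by (simp add: inner_commute[of "gmat g p *v v"] mult.commute)

lemma g_zero: "g p v 0 = 0" "g p 0 v = 0"
proof -
  show "g p 0 v = 0"
  proof (cases "p \<in> Sph \<and> v \<in> tspace p")
    case True
    then show ?thesis using g_comb[of p 0 0 v 0 0] tspace_zero[of p] by simp
  qed (use g_off in blast)
  then show "g p v 0 = 0" using g_sym[of p v 0] by simp
qed

lemma gmat_point:
  assumes p: "p \<in> Sph" shows "gmat g p *v p = p"
proof -
  have "tproj p p = 0" using Sph_inner[OF p] by (simp add: tproj_def)
  then have "v \<bullet> (gmat g p *v p) = v \<bullet> p" for v
    using gmat_inner_general[OF p, of v p] Sph_inner[OF p] by (simp add: g_zero inner_commute)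
  then show ?thesis using vector_eq_rdot[of "gmat g p *v p" p] by (metis inner_commute)
qed

lemma gmat_tspace:
  assumes p: "p \<in> Sph" and w: "w \<in> tspace p"
  shows "gmat g p *v w \<in> tspace p"
  using gmat_sym[OF p, of p w] gmat_point[OF p] w by (simp add: tspace_iff)

lemma gmat_pos:
  assumes p: "p \<in> Sph" and "v \<noteq> 0"
  shows "v \<bullet> (gmat g p *v v) > 0"
proof (cases "tproj p v = 0")
  case True
  then have "p \<bullet> v \<noteq> 0" using assms(2) by (auto simp: tproj_def)
  then show ?thesis using True by (simp add: gmat_inner_general[OF p] g_zero flip: power2_eq_square)
next
  case False
  then show ?thesis
    using g_pos[OF p tproj_tspace[OF p] False] by (simp add: gmat_inner_general[OF p] add_pos_nonneg)
qed

lemma gmat_det_pos: "p \<in> Sph \<Longrightarrow> det (gmat g p) > 0"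
  by (rule det_pos_of_positive_definite) (rule gmat_pos)

lemma gmat_inverse:
  assumes "p \<in> Sph"
  shows "gmat g p *v (matrix_inv (gmat g p) *v v) = v" "matrix_inv (gmat g p) *v (gmat g p *v v) = v"
proof -
  have "invertible (gmat g p)" using gmat_det_pos[OF assms] by (simp add: invertible_det_nz)
  then have "gmat g p ** matrix_inv (gmat g p) = mat 1 \<and> matrix_inv (gmat g p) ** gmat g p = mat 1"
    unfolding invertible_def matrix_inv_def by (rule someI_ex)
  then show "gmat g p *v (matrix_inv (gmat g p) *v v) = v" "matrix_inv (gmat g p) *v (gmat g p *v v) = v"
    by (simp_all add: matrix_vector_mul_assoc)
qed

lemma gmat_smooth: "smooth_on_sphere (gmat g)"
proof -
  have "smooth_on_sphere (\<lambda>p. g p (tproj p (axis i 1)) (tproj p (axis j 1)) + p $ i * p $ j)" for i j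
  proof -
    have "smooth_on_sphere (\<lambda>p. g p (tproj p (axis i 1)) (tproj p (axis j 1)))"
      by (rule sph_cong[OF _ g_smooth[OF const_field[of "axis i 1"] const_field[of "axis j 1"]]])
        (simp add: const_field_def)
    then show ?thesis by (intro sph_add sph_mult sph_vec_nth sph_ident)
  qed
  then show ?thesis unfolding gmat_def[abs_def] by (intro sph_vec_lambda)
qed

section \<open>The covariant derivative of the metric\<close>

lemma linear_dmat: "p \<in> Sph \<Longrightarrow> linear (dmat g p)"
  using linear_sderiv[OF gmat_smooth] by (simp add: dmat_def[abs_def])

lemma dmat_comb: "p \<in> Sph \<Longrightarrow> dmat g p (u + v) = dmat g p u + dmat g p v"
  "p \<in> Sph \<Longrightarrow> dmat g p (c *\<^sub>R u) = c *\<^sub>R dmat g p u"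
  using linear_add[OF linear_dmat] linear_scale[OF linear_dmat] by blast+

lemma dg_add:
  assumes "p \<in> Sph"
  shows "dg g p (u + u') v w = dg g p u v w + dg g p u' v w"
    "dg g p u (v + v') w = dg g p u v w + dg g p u v' w"
    "dg g p u v (w + w') = dg g p u v w + dg g p u v w'"
  using assms by (simp_all add: dg_def dmat_comb matrix_vector_mult_add_rdistrib inner_add_right
      inner_add_left matrix_vector_right_distrib del: mem_sphere_0)

lemma dg_scale:
  assumes "p \<in> Sph"
  shows "dg g p (c *\<^sub>R u) v w = c * dg g p u v w"
    "dg g p u (c *\<^sub>R v) w = c * dg g p u v w"
    "dg g p u v (c *\<^sub>R w) = c * dg g p u v w"
  using assms by (simp_all add: dg_def dmat_comb scaleR_matrix_vector_assoc[symmetric]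
      matrix_vector_mult_scaleR del: mem_sphere_0)

lemma dg_sderiv:
  assumes p: "p \<in> Sph"
  shows "dg g p u v w = sderiv (\<lambda>q. v \<bullet> (gmat g q *v w)) p u"
proof -
  have "bounded_linear (\<lambda>A :: real ^ 'm ^ 'm. v \<bullet> (A *v w))"
    using bounded_linear_compose[OF bounded_linear_inner_right
        bounded_bilinear.bounded_linear_left[OF bounded_bilinear_matrix_vector_mult]] .
  from sderiv_linear[OF this gmat_smooth p] show ?thesis by (simp add: dg_def dmat_def)
qed

lemma dg_sym:
  assumes p: "p \<in> Sph"
  shows "dg g p u v w = dg g p u w v"
  unfolding dg_sderiv[OF p]
proof (rule sderiv_cong[OF _ _ p])
  show "smooth_on_sphere (\<lambda>q. w \<bullet> (gmat g q *v v))"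
    by (intro sph_inner sph_const sph_matrix_vector_mult gmat_smooth)
  show "w \<bullet> (gmat g q *v v) = v \<bullet> (gmat g q *v w)" if "q \<in> Sph" for q
    using gmat_sym[OF that, of v w] by (simp add: inner_commute)
qed

text \<open>Differentiating \<open>gmat g q *v q = q\<close>: the artificial normal direction contributes nothing to the
  trace of the derivative.\<close>

lemma dg_point:
  assumes p: "p \<in> Sph" and u: "u \<in> tspace p"
  shows "dg g p u p p = 0"
proof -
  have "sderiv (\<lambda>q. gmat g q *v q) p u = sderiv (\<lambda>q. q) p u"
    by (rule sderiv_cong) (use p gmat_point sph_ident in auto)
  then have "dmat g p u *v p + gmat g p *v u = u"
    using u sderiv_matrix_vector[OF gmat_smooth sph_ident p, of u]
    by (simp add: sderiv_ident[OF p] tspace_iff dmat_def add.commute)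
  then have "p \<bullet> (dmat g p u *v p) + p \<bullet> (gmat g p *v u) = p \<bullet> u"
    by (metis inner_add_right)
  then show ?thesis using u gmat_tspace[OF p u] by (simp add: dg_def tspace_iff)
qed

text \<open>The product rule identifies \<open>dg\<close> as a covariant derivative: \<open>tproj p (sderiv Y p u)\<close> is the
  round connection. Normal parts drop out because \<open>gmat g p\<close> preserves the tangent space.\<close>

lemma sderiv_metric:
  assumes p: "p \<in> Sph" and u: "u \<in> tspace p" and Y: "Y \<in> vector_fields" and Z: "Z \<in> vector_fields"
  shows "sderiv (\<lambda>q. g q (Y q) (Z q)) p u = dg g p u (Y p) (Z p)
     + g p (tproj p (sderiv Y p u)) (Z p) + g p (Y p) (tproj p (sderiv Z p u))"
proof -
  note sY = vector_fieldsD[OF Y] and sZ = vector_fieldsD[OF Z]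
  have "sderiv (\<lambda>q. g q (Y q) (Z q)) p u = sderiv (\<lambda>q. Y q \<bullet> (gmat g q *v Z q)) p u"
    by (rule sderiv_cong[OF _ _ p])
      (intro gmat_inner sY sZ sph_inner sph_matrix_vector_mult gmat_smooth | assumption)+
  also have "\<dots> = Y p \<bullet> (gmat g p *v sderiv Z p u + dmat g p u *v Z p) + sderiv Y p u \<bullet> (gmat g p *v Z p)"
    by (simp add: sderiv_inner[OF sY(1) sph_matrix_vector_mult[OF gmat_smooth sZ(1)] p]
       sderiv_matrix_vector[OF gmat_smooth sZ(1) p] dmat_def)
  also have "sderiv Y p u \<bullet> (gmat g p *v Z p) = g p (tproj p (sderiv Y p u)) (Z p)"
    using gmat_inner[OF p tproj_tspace[OF p] sZ(2)] tproj_inner[OF gmat_tspace[OF p sZ(2)]] by simp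
  also have "Y p \<bullet> (gmat g p *v sderiv Z p u + dmat g p u *v Z p)
      = sderiv Z p u \<bullet> (gmat g p *v Y p) + dg g p u (Y p) (Z p)"
    by (simp add: inner_add_right dg_def gmat_sym[OF p, of "Y p"] inner_commute[of "gmat g p *v Y p"])
  also have "sderiv Z p u \<bullet> (gmat g p *v Y p) = g p (tproj p (sderiv Z p u)) (Y p)"
    using gmat_inner[OF p tproj_tspace[OF p] sY(2)] tproj_inner[OF gmat_tspace[OF p sY(2)]] by simp
  finally show ?thesis using g_sym[of p "Y p"] by simp
qed

section \<open>The Levi-Civita connection\<close>

lemma koszul_inner:
  assumes p: "p \<in> Sph"
  shows "koszul g p x y \<bullet> z = (dg g p x y z + dg g p y x z - dg g p z x y) / 2"
proof -
  have "linear (\<lambda>z. dg g p z x y)"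
    by (rule linearI) (simp_all add: dg_add[OF p] dg_scale[OF p])
  from linear_functional_vec[OF this, of z]
  show ?thesis using dg_sym[OF p, of x y z] dg_sym[OF p, of y x z]
    by (simp add: koszul_def inner_diff_right inner_add_right dg_def inner_commute[of _ z])
qed

lemma christoffel_tspace:
  assumes p: "p \<in> Sph" shows "christoffel g p x y \<in> tspace p"
proof -
  have "p \<bullet> christoffel g p x y = p \<bullet> (gmat g p *v christoffel g p x y)"
    using gmat_sym[OF p, of p "christoffel g p x y"] gmat_point[OF p] by simp
  then show ?thesis
    using tproj_tspace[OF p] by (simp add: christoffel_def gmat_inverse[OF p] tspace_iff)
qed

lemma christoffel_inner:
  assumes p: "p \<in> Sph" and z: "z \<in> tspace p"
  shows "g p (christoffel g p x y) z = (dg g p x y z + dg g p y x z - dg g p z x y) / 2"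
proof -
  have "g p (christoffel g p x y) z = (gmat g p *v christoffel g p x y) \<bullet> z"
    using gmat_inner[OF p christoffel_tspace[OF p] z] gmat_sym[OF p] by simp
  also have "\<dots> = koszul g p x y \<bullet> z"
    using tproj_inner[OF z] by (simp add: christoffel_def gmat_inverse[OF p])
  finally show ?thesis by (simp add: koszul_inner[OF p])
qed

lemma g_linear:
  assumes p: "p \<in> Sph" and T: "u \<in> tspace p" "v \<in> tspace p"
  shows "g p (u + v) w = g p u w + g p v w" "g p (c *\<^sub>R u) w = c * g p u w"
    "g p w (u + v) = g p w u + g p w v" "g p w (c *\<^sub>R u) = c * g p w u"
    "g p (u - v) w = g p u w - g p v w"
proof -
  have *: "g p (a *\<^sub>R u + b *\<^sub>R v) w = a * g p u w + b * g p v w" for a b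
    using g_comb[OF p T] g_off by (cases "w \<in> tspace p") auto
  show 1: "g p (u + v) w = g p u w + g p v w" "g p (c *\<^sub>R u) w = c * g p u w"
    using *[of 1 1] *[of c 0] by auto
  show "g p (u - v) w = g p u w - g p v w"
    using *[of 1 "-1"] by auto
  show "g p w (u + v) = g p w u + g p w v" "g p w (c *\<^sub>R u) = c * g p w u"
    using 1 g_sym[of p w] by simp_all
qed

lemma g_cancel:
  assumes p: "p \<in> Sph" and T: "u \<in> tspace p" "v \<in> tspace p"
    and eq: "\<And>z. z \<in> tspace p \<Longrightarrow> g p u z = g p v z"
  shows "u = v"
proof (rule ccontr)
  assume "u \<noteq> v"
  then have "g p (u - v) (u - v) > 0" using g_pos[OF p tspace_diff[OF T]] by simp
  then show False using g_linear(5)[OF p T] eq[OF tspace_diff[OF T]] by simp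
qed

lemma christoffel_eqI:
  assumes p: "p \<in> Sph" and T: "u \<in> tspace p"
    and "\<And>z. z \<in> tspace p \<Longrightarrow> g p u z = (dg g p x y z + dg g p y x z - dg g p z x y) / 2"
  shows "christoffel g p x y = u"
  by (rule g_cancel[OF p christoffel_tspace[OF p] T]) (simp add: assms(3) christoffel_inner[OF p])

lemma christoffel_sym:
  assumes p: "p \<in> Sph" shows "christoffel g p x y = christoffel g p y x"
  by (rule christoffel_eqI[OF p christoffel_tspace[OF p]])
    (use christoffel_inner[OF p] dg_sym[OF p, of _ x y] in simp)

lemma christoffel_bilinear:
  assumes p: "p \<in> Sph"
  shows "christoffel g p (x + x') y = christoffel g p x y + christoffel g p x' y"
    "christoffel g p (c *\<^sub>R x) y = c *\<^sub>R christoffel g p x y"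
    "christoffel g p x (y + y') = christoffel g p x y + christoffel g p x y'"
    "christoffel g p x (c *\<^sub>R y) = c *\<^sub>R christoffel g p x y"
proof -
  note T = christoffel_tspace[OF p]
  show 1: "christoffel g p (x + x') y = christoffel g p x y + christoffel g p x' y" for x x' y
    by (rule christoffel_eqI[OF p tspace_add[OF T T]])
      (simp add: christoffel_inner[OF p] g_linear[OF p T T] dg_add[OF p] field_simps)
  show 2: "christoffel g p (c *\<^sub>R x) y = c *\<^sub>R christoffel g p x y" for x y
    by (rule christoffel_eqI[OF p tspace_scale[OF T]])
      (simp add: christoffel_inner[OF p] g_linear[OF p T T] dg_scale[OF p] field_simps)
  show "christoffel g p x (y + y') = christoffel g p x y + christoffel g p x y'"
    using 1[of y y' x] christoffel_sym[OF p, of x] by simp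
  show "christoffel g p x (c *\<^sub>R y) = c *\<^sub>R christoffel g p x y"
    using 2[of y x] christoffel_sym[OF p, of x] by simp
qed

lemma christoffel_smooth:
  assumes X: "smooth_on_sphere X" and Y: "smooth_on_sphere Y"
  shows "smooth_on_sphere (\<lambda>p. christoffel g p (X p) (Y p))"
proof -
  have d: "smooth_on_sphere (\<lambda>p. dmat g p (Z p))" if "smooth_on_sphere Z" for Z
    unfolding dmat_def by (rule sph_sderiv[OF gmat_smooth that])
  have "smooth_on_sphere (\<lambda>p. \<chi> k. dg g p (axis k 1) (X p) (Y p))"
    unfolding dg_def
    by (intro sph_vec_lambda sph_inner X sph_matrix_vector_mult Y d sph_const)
  then have "smooth_on_sphere (\<lambda>p. koszul g p (X p) (Y p))"
    unfolding koszul_def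
    by (intro sph_scaleR sph_const sph_diff sph_add sph_matrix_vector_mult X Y d)
  then have "smooth_on_sphere (\<lambda>p. tproj p (koszul g p (X p) (Y p)))" by (rule sph_tproj)
  then show ?thesis
    by (rule sph_linear_system[OF gmat_smooth]) (simp_all add: gmat_det_pos gmat_inverse christoffel_def
      del: mem_sphere_0)
qed

end

lemma vector_fieldsI:
  "smooth_on_sphere X \<Longrightarrow> (\<And>p. p \<in> Sph \<Longrightarrow> X p \<in> tspace p) \<Longrightarrow> (\<And>p. p \<notin> Sph \<Longrightarrow> X p = 0) \<Longrightarrow>
    X \<in> vector_fields"
  by (simp add: vector_fields_def)

lemma vector_fields_add:
  "X \<in> vector_fields \<Longrightarrow> Y \<in> vector_fields \<Longrightarrow> (\<lambda>q. X q + Y q) \<in> vector_fields"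
  by (rule vector_fieldsI) (simp_all add: sph_add tspace_add vector_fieldsD del: mem_sphere_0)

lemma vector_fields_scale:
  "f \<in> scalar_fields \<Longrightarrow> X \<in> vector_fields \<Longrightarrow> (\<lambda>q. f q *\<^sub>R X q) \<in> vector_fields"
  by (rule vector_fieldsI)
    (simp_all add: scalar_fields_def sph_scaleR tspace_scale vector_fieldsD del: mem_sphere_0)

lemma lie_bracket_tspace:
  assumes "X \<in> vector_fields" "Y \<in> vector_fields" "p \<in> Sph"
  shows "lie_bracket X Y p \<in> tspace p"
  using inner_sderiv_field[OF assms(1,3) vector_fieldsD(2)[OF assms(2)]]
    inner_sderiv_field[OF assms(2,3) vector_fieldsD(2)[OF assms(1)]]
  by (simp add: lie_bracket_def tspace_iff inner_diff_right inner_commute)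

context sphere_metric begin

lemma koszul_connection_eq: "X \<in> vector_fields \<Longrightarrow> Y \<in> vector_fields \<Longrightarrow> p \<in> Sph \<Longrightarrow>
    koszul_connection g X Y p = tproj p (sderiv Y p (X p)) + christoffel g p (X p) (Y p)"
  by (simp add: koszul_connection_def)

lemma koszul_connection_field:
  assumes "X \<in> vector_fields" "Y \<in> vector_fields"
  shows "koszul_connection g X Y \<in> vector_fields"
proof (rule vector_fieldsI)
  note X = vector_fieldsD[OF assms(1)] and Y = vector_fieldsD[OF assms(2)]
  have "smooth_on_sphere (\<lambda>p. tproj p (sderiv Y p (X p)) + christoffel g p (X p) (Y p))"
    by (intro sph_add sph_tproj sph_sderiv christoffel_smooth X Y)
  then show "smooth_on_sphere (koszul_connection g X Y)"
    by (rule sph_cong[rotated]) (simp add: koszul_connection_eq assms)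
  show "koszul_connection g X Y p \<in> tspace p" if "p \<in> Sph" for p
    using that assms by (auto simp: koszul_connection_eq intro!: tspace_add tproj_tspace christoffel_tspace)
qed (auto simp: koszul_connection_def)

lemma koszul_connection_is_levi_civita: "is_levi_civita g (koszul_connection g)"
  unfolding is_levi_civita_def
proof (intro conjI allI ballI impI)
  fix X Y :: "'m vector_field"
  show "\<not> (X \<in> vector_fields \<and> Y \<in> vector_fields) \<Longrightarrow> koszul_connection g X Y = (\<lambda>p. 0)"
    by (auto simp: koszul_connection_def fun_eq_iff)
  assume X: "X \<in> vector_fields" and Y: "Y \<in> vector_fields"
  show "koszul_connection g X Y \<in> vector_fields" by (rule koszul_connection_field[OF X Y])
  note sX = vector_fieldsD[OF X] and sY = vector_fieldsD[OF Y]
  {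
    fix Z p assume Z: "Z \<in> (vector_fields :: 'm vector_field set)"
    note sZ = vector_fieldsD[OF Z]
    show "koszul_connection g (\<lambda>q. X q + Y q) Z p = koszul_connection g X Z p + koszul_connection g Y Z p"
    proof (cases "p \<in> Sph")
      case True
      show ?thesis
        by (simp add: koszul_connection_eq[OF vector_fields_add[OF X Y] Z True]
          koszul_connection_eq[OF X Z True] koszul_connection_eq[OF Y Z True]
            linear_add[OF linear_sderiv[OF sZ(1) True]] christoffel_bilinear[OF True] tproj_add)
    qed (simp add: koszul_connection_def)
    show "koszul_connection g X (\<lambda>q. Y q + Z q) p = koszul_connection g X Y p + koszul_connection g X Z p"
    proof (cases "p \<in> Sph")
      case True
      show ?thesis
        by (simp add: koszul_connection_eq[OF X vector_fields_add[OF Y Z] True]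
          koszul_connection_eq[OF X Z True] koszul_connection_eq[OF X Y True]
            sderiv_add[OF sY(1) sZ(1) True] christoffel_bilinear[OF True] tproj_add)
    qed (simp add: koszul_connection_def)
    assume p: "p \<in> Sph"
    note T = christoffel_tspace[OF p] and P = tproj_tspace[OF p]
    have "g p (koszul_connection g X Y p) (Z p) = g p (tproj p (sderiv Y p (X p))) (Z p)
       + (dg g p (X p) (Y p) (Z p) + dg g p (Y p) (X p) (Z p) - dg g p (Z p) (X p) (Y p)) / 2"
      by (simp add: koszul_connection_eq[OF X Y p] g_linear[OF p P T] christoffel_inner[OF p sZ(2)])
    moreover have "g p (Y p) (koszul_connection g X Z p) = g p (Y p) (tproj p (sderiv Z p (X p)))
       + (dg g p (X p) (Z p) (Y p) + dg g p (Z p) (X p) (Y p) - dg g p (Y p) (X p) (Z p)) / 2"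
      by (simp add: koszul_connection_eq[OF X Z p] g_linear[OF p P T] christoffel_inner[OF p sY(2)]
        g_sym[of p "Y p" "christoffel g p (X p) (Z p)"])
    ultimately show "sderiv (\<lambda>q. g q (Y q) (Z q)) p (X p) = g p (koszul_connection g X Y p) (Z p)
      + g p (Y p) (koszul_connection g X Z p)"
      using dg_sym[OF p, of "X p" "Z p" "Y p"]
      by (simp add: sderiv_metric[OF p sX(2) Y Z] field_simps)
  }
  fix p :: "real ^ 'm" assume p: "p \<in> Sph"
  show "koszul_connection g X Y p - koszul_connection g Y X p = lie_bracket X Y p"
    using tproj_id[OF lie_bracket_tspace[OF X Y p]]
    by (simp add: koszul_connection_eq[OF X Y p] koszul_connection_eq[OF Y X p]
      christoffel_sym[OF p, of "X p" "Y p"] lie_bracket_def tproj_diff)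
  fix f :: "'m scalar_field" assume f: "f \<in> scalar_fields"
  then have sf: "smooth_on_sphere f" by (simp add: scalar_fields_def)
  show "koszul_connection g (\<lambda>q. f q *\<^sub>R X q) Y p = f p *\<^sub>R koszul_connection g X Y p"
    by (simp add: koszul_connection_eq[OF vector_fields_scale[OF f X] Y p]
      koszul_connection_eq[OF X Y p] christoffel_bilinear[OF p]
      linear_scale[OF linear_sderiv[OF sY(1) p]] tproj_scale scaleR_add_right)
  show "koszul_connection g X (\<lambda>q. f q *\<^sub>R Y q) p = f p *\<^sub>R koszul_connection g X Y p
    + sderiv f p (X p) *\<^sub>R Y p"
    by (simp add: koszul_connection_eq[OF X vector_fields_scale[OF f Y] p]
      koszul_connection_eq[OF X Y p] christoffel_bilinear[OF p]
      sderiv_scaleR[OF sf sY(1) p] tproj_scale tproj_add scaleR_add_right tproj_id[OF sY(2)])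
qed

lemma is_levi_civitaD:
  assumes "is_levi_civita g L"
  shows "\<not> (X \<in> vector_fields \<and> Y \<in> vector_fields) \<Longrightarrow> L X Y = (\<lambda>p. 0)"
    "X \<in> vector_fields \<Longrightarrow> Y \<in> vector_fields \<Longrightarrow> L X Y \<in> vector_fields"
    "X \<in> vector_fields \<Longrightarrow> Y \<in> vector_fields \<Longrightarrow> p \<in> Sph \<Longrightarrow>
      L X Y p - L Y X p = lie_bracket X Y p"
    "X \<in> vector_fields \<Longrightarrow> Y \<in> vector_fields \<Longrightarrow> Z \<in> vector_fields \<Longrightarrow> p \<in> Sph \<Longrightarrow>
      sderiv (\<lambda>q. g q (Y q) (Z q)) p (X p) = g p (L X Y p) (Z p) + g p (Y p) (L X Z p)"
  using assms unfolding is_levi_civita_def by (elim conjE; blast)+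

text \<open>The difference of two Levi-Civita connections, lowered with \<open>g\<close>, is symmetric in the first two
  arguments by torsion-freeness and skew in the last two by metricity; a trilinear expression with
  both symmetries is zero.\<close>

lemma levi_civita_unique:
  assumes N: "is_levi_civita g N" and M: "is_levi_civita g M"
  shows "N = M"
proof (intro ext)
  fix X Y p
  show "N X Y p = M X Y p"
  proof (cases "X \<in> vector_fields \<and> Y \<in> vector_fields \<and> p \<in> Sph")
    case False
    have out: "L X Y p = 0" if L: "is_levi_civita g L" for L
    proof (cases "X \<in> vector_fields \<and> Y \<in> vector_fields")
      case True
      then have "L X Y \<in> vector_fields" using is_levi_civitaD(2)[OF L] by blast
      then show ?thesis using True False by (auto simp: vector_fields_def)
    next
      case False
      then have "L X Y = (\<lambda>p. 0)" using is_levi_civitaD(1)[OF L] by blast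
      then show ?thesis by simp
    qed
    show ?thesis using out[OF N] out[OF M] by simp
  next
    case True
    then have X: "X \<in> vector_fields" and Y: "Y \<in> vector_fields" and p: "p \<in> Sph" by auto
    let ?A = "\<lambda>X Y Z. g p (N X Y p) (Z p) - g p (M X Y p) (Z p)"
    have tan: "N X Y p \<in> tspace p" "M X Y p \<in> tspace p" 
      if "X \<in> vector_fields" "Y \<in> vector_fields" for X Y
    proof -
      have "N X Y \<in> vector_fields" "M X Y \<in> vector_fields"
        using that is_levi_civitaD(2) N M by auto
      then show "N X Y p \<in> tspace p" "M X Y p \<in> tspace p" by (auto dest: vector_fieldsD(2))
    qed
    have tor: "N X Y p - M X Y p = N Y X p - M Y X p"
      if "X \<in> vector_fields" "Y \<in> vector_fields" for X Y
    proof -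
      have "N X Y p - N Y X p = lie_bracket X Y p" "M X Y p - M Y X p = lie_bracket X Y p"
        using that is_levi_civitaD(3) p N M by auto
      then show ?thesis by (simp add: algebra_simps)
    qed
    have s: "?A X Y Z = ?A Y X Z" if "X \<in> vector_fields" "Y \<in> vector_fields" for X Y Z
      using tor[OF that] g_linear(5)[OF p tan[OF that], of "Z p"]
        g_linear(5)[OF p tan[OF that(2,1)], of "Z p"]
      by simp
    have a: "?A X Y Z = - ?A X Z Y"
      if "X \<in> vector_fields" "Y \<in> vector_fields" "Z \<in> vector_fields" for X Y Z
    proof -
      have "sderiv (\<lambda>q. g q (Y q) (Z q)) p (X p) = g p (N X Y p) (Z p) + g p (Y p) (N X Z p)"
        "sderiv (\<lambda>q. g q (Y q) (Z q)) p (X p) = g p (M X Y p) (Z p) + g p (Y p) (M X Z p)"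
        using that is_levi_civitaD(4)[OF N _ _ _ p] is_levi_civitaD(4)[OF M _ _ _ p] by auto
      then show ?thesis using g_sym[of p "Y p"] by simp
    qed
    \<comment> \<open>Six alternating exchanges of arguments return to the start with the sign reversed.\<close>
    have "?A X Y Z = 0" if Z: "Z \<in> vector_fields" for Z
      using s[OF X Y, of Z] a[OF Y X Z] s[OF Y Z, of X] a[OF Z Y X] s[OF Z X, of Y] a[OF X Z Y] by linarith
    then have "g p (N X Y p) z = g p (M X Y p) z" if "z \<in> tspace p" for z
      using const_field[of z] const_field_eq[OF p that] by (metis eq_iff_diff_eq_0)
    then show ?thesis by (rule g_cancel[OF p tan[OF X Y]])
  qed
qed

lemma levi_civita_eq: "levi_civita g = koszul_connection g"
  unfolding levi_civita_def using koszul_connection_is_levi_civita levi_civita_unique by blast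

end

section \<open>The mean curvature of equators\<close>

text \<open>For the inclusion from right to left, the radial projection of \<open>p + t *\<^sub>R v\<close> is a curve in the
  equator with velocity \<open>v\<close> at \<open>t = 0\<close>.\<close>

lemma equator_tangent:
  fixes a p :: "real ^ 'm::finite"
  assumes p: "p \<in> Sph" and ap: "a \<bullet> p = 0"
  shows "tangent_at (Sph \<inter> {x. a \<bullet> x = 0}) p = {v. v \<in> tspace p \<and> a \<bullet> v = 0}"
proof (intro subset_antisym subsetI)
  fix v assume "v \<in> tangent_at (Sph \<inter> {x. a \<bullet> x = 0}) p"
  then obtain c :: "real \<Rightarrow> real ^ 'm" where c: "c 0 = p" "\<And>t. norm (c t) = 1" "\<And>t. a \<bullet> c t = 0"
      "(c has_vector_derivative v) (at 0)"
    unfolding tangent_at_def by auto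
  have "((\<lambda>t. c t \<bullet> c t) has_vector_derivative (c 0 \<bullet> v + v \<bullet> c 0)) (at 0)"
    by (rule bounded_bilinear.has_vector_derivative[OF bounded_bilinear_inner c(4) c(4)])
  moreover have "((\<lambda>t. c t \<bullet> c t) has_vector_derivative 0) (at 0)"
    using c(2) by (simp add: dot_square_norm)
  ultimately have "c 0 \<bullet> v + v \<bullet> c 0 = 0" by (rule vector_derivative_unique_at)
  then have "v \<in> tspace p" using c(1) by (simp add: tspace_iff inner_commute)
  moreover have "((\<lambda>t. a \<bullet> c t) has_vector_derivative (a \<bullet> v)) (at 0)"
    by (rule bounded_linear.has_vector_derivative[OF bounded_linear_inner_right c(4)])
  then have "a \<bullet> v = 0"
    using c(3) by (simp add: vector_derivative_unique_at)
  ultimately show "v \<in> {v. v \<in> tspace p \<and> a \<bullet> v = 0}" by simp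
next
  fix v assume "v \<in> {v. v \<in> tspace p \<and> a \<bullet> v = 0}"
  then have v: "v \<in> tspace p" "a \<bullet> v = 0" by auto
  let ?c = "\<lambda>t. sgn (p + t *\<^sub>R v)"
  have "p \<bullet> (p + t *\<^sub>R v) = 1" for t
    using v(1) Sph_inner[OF p] by (simp add: tspace_iff inner_add_right)
  then have nz: "p + t *\<^sub>R v \<noteq> 0" for t by (metis inner_zero_right zero_neq_one)
  have l: "((\<lambda>t. p + t *\<^sub>R v) has_derivative (\<lambda>h. h *\<^sub>R v)) (at 0)"
    by (auto intro!: derivative_eq_intros)
  have sg: "(sgn has_derivative sderiv (\<lambda>q. q) p) (at (p + 0 *\<^sub>R v))"
    using has_sderiv[OF sph_ident p] by simp
  have "(?c has_derivative (\<lambda>h. sderiv (\<lambda>q. q) p (h *\<^sub>R v))) (at 0)"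
    by (rule has_derivative_compose[OF l sg])
  then have "(?c has_vector_derivative v) (at 0)"
    using v by (simp add: has_vector_derivative_def sderiv_ident[OF p] tspace_iff)
  moreover have "?c 0 = p" using sgn_Sph[OF p] by simp
  moreover have "?c t \<in> Sph \<inter> {x. a \<bullet> x = 0}" for t
    using nz ap v(2) by (simp add: norm_sgn) (simp add: sgn_div_norm inner_add_right)
  ultimately show "v \<in> tangent_at (Sph \<inter> {x. a \<bullet> x = 0}) p"
    unfolding tangent_at_def mem_Collect_eq by (intro exI[of _ ?c]) blast
qed

context sphere_metric begin

definition orthonormal_set :: "real ^ 'm \<Rightarrow> (real ^ 'm) set \<Rightarrow> bool"
  where "orthonormal_set p B \<longleftrightarrow> finite B \<and> B \<subseteq> tspace p \<and>
    (\<forall>v\<in>B. \<forall>w\<in>B. g p v w = (if v = w then 1 else 0))"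

lemma g_sum:
  assumes p: "p \<in> Sph" and B: "finite B" "B \<subseteq> tspace p"
  shows "g p (\<Sum>e\<in>B. c e *\<^sub>R e) w = (\<Sum>e\<in>B. c e * g p e w)"
  using B
proof (induction B rule: finite_induct)
  case (insert e B)
  then have "(\<Sum>e\<in>B. c e *\<^sub>R e) \<in> tspace p" "c e *\<^sub>R e \<in> tspace p" "e \<in> tspace p"
    by (auto intro!: tspace_sum tspace_scale)
  with insert show ?case using g_linear[OF p] by (simp del: mem_sphere_0)
qed (simp add: g_zero)

lemma orthonormal_set_coeff:
  assumes p: "p \<in> Sph" and B: "orthonormal_set p B" and f: "f \<in> B"
  shows "g p (\<Sum>e\<in>B. c e *\<^sub>R e) f = c f"
proof -
  have "g p (\<Sum>e\<in>B. c e *\<^sub>R e) f = (\<Sum>e\<in>B. c e * g p e f)"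
    using B by (intro g_sum[OF p]) (auto simp: orthonormal_set_def)
  also have "\<dots> = (\<Sum>e\<in>B. if e = f then c e else 0)"
    using B f by (intro sum.cong) (auto simp: orthonormal_set_def)
  finally show ?thesis using B f by (simp add: orthonormal_set_def)
qed

lemma orthonormal_set_expand:
  assumes p: "p \<in> Sph" and B: "orthonormal_set p B" and v: "v \<in> span B"
  shows "v = (\<Sum>e\<in>B. g p v e *\<^sub>R e)"
proof -
  have "finite B" using B by (simp add: orthonormal_set_def)
  then obtain c where c: "v = (\<Sum>e\<in>B. c e *\<^sub>R e)" using v by (auto simp: span_finite)
  then have "g p v f = c f" if "f \<in> B" for f using orthonormal_set_coeff[OF p B that] by simp
  then show ?thesis unfolding c by simp
qed

lemma orthonormal_set_independent:
  assumes p: "p \<in> Sph" and B: "orthonormal_set p B"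
  shows "independent B"
proof
  assume "dependent B"
  moreover have "finite B" using B by (simp add: orthonormal_set_def)
  ultimately obtain c where c: "\<exists>v\<in>B. c v \<noteq> 0" "(\<Sum>v\<in>B. c v *\<^sub>R v) = 0"
    by (auto simp: dependent_finite)
  then have "c f = 0" if "f \<in> B" for f using orthonormal_set_coeff[OF p B that, of c] by (simp add: g_zero)
  then show False using c(1) by blast
qed

text \<open>An orthonormal set of maximal size spans, since otherwise a Gram-Schmidt step enlarges it.\<close>

lemma orthonormal_set_exists:
  assumes p: "p \<in> Sph" and W: "subspace W" "W \<subseteq> tspace p"
  shows "\<exists>B. orthonormal_set p B \<and> span B = W"
proof -
  let ?P = "\<lambda>B. orthonormal_set p B \<and> B \<subseteq> W"
  have "orthonormal_set p {}" by (simp add: orthonormal_set_def)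
  then have P0: "?P {}" by simp
  have bd: "card B < Suc (dim W)" if "?P B" for B
    using independent_card_le_dim[of B W] orthonormal_set_independent[OF p] that
      by (simp add: less_Suc_eq_le)
  obtain B where B: "?P B" and max: "\<And>C. ?P C \<Longrightarrow> card C \<le> card B"
    using ex_has_greatest_nat[of ?P "{}" card "Suc (dim W)"] P0 bd by metis
  have fin: "finite B" and BT: "B \<subseteq> tspace p" using B by (auto simp: orthonormal_set_def)
  have "span B = W"
  proof (rule ccontr)
    assume "span B \<noteq> W"
    moreover have "span B \<subseteq> W" using B W span_minimal by blast
    ultimately obtain w where w: "w \<in> W" "w \<notin> span B" by blast
    let ?s = "\<Sum>e\<in>B. g p w e *\<^sub>R e"
    define x where "x = w - ?s"
    have s: "?s \<in> span B" by (intro span_sum span_scale span_base)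
    then have wW: "x \<in> W" unfolding x_def using w(1) W(1) \<open>span B \<subseteq> W\<close> by (auto intro: subspace_diff)
    then have wT: "x \<in> tspace p" using W(2) by blast
    have nz: "x \<noteq> 0" using s w(2) by (auto simp: x_def)
    have orth: "g p x e = 0" if "e \<in> B" for e
      using orthonormal_set_coeff[OF p _ that, of "g p w"] B that g_linear(5)[OF p, of w ?s e]
        w(1) W(2) s \<open>span B \<subseteq> W\<close> by (auto simp: x_def)
    define f where "f = (1 / sqrt (g p x x)) *\<^sub>R x"
    have pos: "g p x x > 0" by (rule g_pos[OF p wT nz])
    have fW: "f \<in> W" unfolding f_def by (rule subspace_scale[OF W(1) wW])
    have ff: "g p f f = 1"
      using pos by (simp add: f_def g_linear[OF p wT wT] field_simps flip: power2_eq_square)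
    have fe: "g p f e = 0" if "e \<in> B" for e
      using orth[OF that] by (simp add: f_def g_linear[OF p wT wT])
    have fB: "f \<notin> B" using fe ff by auto
    have "orthonormal_set p (insert f B)"
      unfolding orthonormal_set_def
    proof (intro conjI ballI)
      show "finite (insert f B)" using fin by simp
      show "insert f B \<subseteq> tspace p" using BT fW W(2) by blast
      fix v u assume "v \<in> insert f B" "u \<in> insert f B"
      then show "g p v u = (if v = u then 1 else 0)"
        using B ff fe fB g_sym[of p v u] unfolding orthonormal_set_def by (metis insertE)
    qed
    then have "card (insert f B) \<le> card B" using max fW B by blast
    then show False using fB fin by simp
  qed
  then show ?thesis using B by blast
qed

text \<open>Expanding one basis in the other, the transition coefficients sum up to the Kronecker delta.\<close>

lemma orthonormal_set_trace:
  assumes p: "p \<in> Sph" and E: "orthonormal_set p E" "span E = tspace p"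
    and F: "orthonormal_set p F" "span F = tspace p"
    and l: "\<And>w. linear (\<lambda>v. b v w)" "\<And>v. linear (b v)"
  shows "(\<Sum>e\<in>E. b e e) = (\<Sum>f\<in>F. b f f :: real)"
proof -
  have ET: "E \<subseteq> tspace p" and FT: "F \<subseteq> tspace p" using E F by (auto simp: orthonormal_set_def)
  have "b e e = (\<Sum>f\<in>F. \<Sum>h\<in>F. g p e f * g p e h * b f h)" if "e \<in> E" for e
  proof -
    have e: "(\<Sum>f\<in>F. g p e f *\<^sub>R f) = e" 
      using orthonormal_set_expand[OF p F(1)] F(2) ET that by auto
    have "b e e = b (\<Sum>f\<in>F. g p e f *\<^sub>R f) (\<Sum>h\<in>F. g p e h *\<^sub>R h)" by (simp add: e)
    also have "\<dots> = (\<Sum>f\<in>F. g p e f * b f (\<Sum>h\<in>F. g p e h *\<^sub>R h))"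
      by (simp only: linear_sum[OF l(1)] linear_scale[OF l(1)] real_scaleR_def)
    also have "\<dots> = (\<Sum>f\<in>F. g p e f * (\<Sum>h\<in>F. g p e h * b f h))"
      by (simp only: linear_sum[OF l(2)] linear_scale[OF l(2)] real_scaleR_def)
    finally show ?thesis by (simp add: sum_distrib_left mult.assoc)
  qed
  then have "(\<Sum>e\<in>E. b e e) = (\<Sum>e\<in>E. \<Sum>f\<in>F. \<Sum>h\<in>F. g p e f * g p e h * b f h)"
    by simp
  also have "\<dots> = (\<Sum>f\<in>F. \<Sum>h\<in>F. (\<Sum>e\<in>E. g p e f * g p e h) * b f h)"
    by (subst sum.swap, rule sum.cong[OF refl], subst sum.swap) (simp add: sum_distrib_right)
  also have "\<dots> = (\<Sum>f\<in>F. \<Sum>h\<in>F. (if h = f then b f h else 0))"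
  proof (intro sum.cong refl)
    fix f h assume fh: "f \<in> F" "h \<in> F"
    have "(\<Sum>e\<in>E. g p e f * g p e h) = (\<Sum>e\<in>E. g p f e * g p e h)" by (intro sum.cong refl) (metis g_sym)
    also have "\<dots> = g p (\<Sum>e\<in>E. g p f e *\<^sub>R e) h"
      using E ET by (simp add: g_sum[OF p] orthonormal_set_def)
    also have "(\<Sum>e\<in>E. g p f e *\<^sub>R e) = f"
      using orthonormal_set_expand[OF p E(1), of f] E(2) FT fh by auto
    finally show "(\<Sum>e\<in>E. g p e f * g p e h) * b f h = (if h = f then b f h else 0)"
      using F(1) fh by (simp add: orthonormal_set_def)
  qed
  also have "\<dots> = (\<Sum>f\<in>F. b f f)" using F(1) by (simp add: orthonormal_set_def)
  finally show ?thesis .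
qed

lemma orthonormal_set_card:
  assumes p: "p \<in> Sph" and E: "orthonormal_set p E" "span E = tspace p"
  shows "card E + 1 = CARD('m)"
proof -
  have "card E = dim (tspace p)"
    using dim_eq_card_independent[OF orthonormal_set_independent[OF p E(1)]] E(2) by (metis dim_span)
  also have "\<dots> = CARD('m) - 1"
    unfolding tspace_def using dim_hyperplane[of p] Sph_nonzero[OF p] by simp
  finally show ?thesis by (simp add: Suc_leI)
qed

text \<open>Equators are totally geodesic for the round metric: if \<open>W\<close> is tangent to the equator along it,
  then differentiating \<open>a \<bullet> W = 0\<close> along a curve in the equator shows that the round derivative of
  \<open>W\<close> is tangent too, hence \<open>g\<close>-orthogonal to \<open>\<nu>\<close>. Only the difference of the connections remains.\<close>

lemma second_fundamental_form_equator:
  assumes p: "p \<in> Sph" and ap: "a \<bullet> p = 0" and M: "M = Sph \<inter> {x. a \<bullet> x = 0}"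
    and nu: "unit_normal g M p \<nu>" and u: "u \<in> tangent_at M p" and w: "w \<in> tangent_at M p"
  shows "second_fundamental_form g M p \<nu> u w = (dg g p u w \<nu> + dg g p w u \<nu> - dg g p \<nu> u w) / 2"
proof -
  let ?T = "(dg g p u w \<nu> + dg g p w u \<nu> - dg g p \<nu> u w) / 2"
  have nuT: "\<nu> \<in> tspace p" and orth: "\<And>v. v \<in> tangent_at M p \<Longrightarrow> g p v \<nu> = 0"
    using nu unfolding unit_normal_def by (auto intro: trans[OF g_sym])
  have tan: "tangent_at M q = {v. v \<in> tspace q \<and> a \<bullet> v = 0}" if "q \<in> M" for q
    using equator_tangent[of q a] that unfolding M by auto
  have pM: "p \<in> M" using p ap M by simp
  have val: "g p (levi_civita g U W p) \<nu> = ?T"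
    if U: "U \<in> vector_fields" "U p = u" and W: "W \<in> vector_fields" "W p = w"
      and WM: "\<And>q. q \<in> M \<Longrightarrow> W q \<in> tangent_at M q" for U W
  proof -
    obtain c :: "real \<Rightarrow> real ^ 'm" where c: "c 0 = p" "\<And>t. c t \<in> M" "(c has_vector_derivative u) (at 0)"
      using u unfolding tangent_at_def by auto
    have "((\<lambda>t. W (c t)) has_vector_derivative sderiv W (c 0) u) (at 0)"
      by (rule sderiv_along_curve[OF vector_fieldsD(1)[OF W(1)] _ c(3)]) (use c(2) M in blast)
    then have "((\<lambda>t. a \<bullet> W (c t)) has_vector_derivative a \<bullet> sderiv W p u) (at 0)"
      unfolding c(1) by (rule bounded_linear.has_vector_derivative[OF bounded_linear_inner_right])
    moreover have "a \<bullet> W (c t) = 0" for t using WM[OF c(2)] tan[OF c(2)] by simp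
    ultimately have "a \<bullet> sderiv W p u = 0" by (simp add: vector_derivative_unique_at)
    then have "a \<bullet> tproj p (sderiv W p u) = 0" using ap by (simp add: tproj_def inner_diff_right)
    then have "g p (tproj p (sderiv W p u)) \<nu> = 0"
      using orth tan[OF pM] tproj_tspace[OF p] by simp
    then have "g p (tproj p (sderiv W p u) + christoffel g p u w) \<nu> = ?T"
      using g_linear(1)[OF p tproj_tspace[OF p] christoffel_tspace[OF p]]
        christoffel_inner[OF p nuT, of u w] by simp
    then show ?thesis using koszul_connection_eq[OF U(1) W(1) p] U(2) W(2) by (simp add: levi_civita_eq)
  qed
  have ext: "const_field x q \<in> tangent_at M q" if "x \<in> tangent_at M p" "q \<in> M" for x q
    using that tan[OF pM] tan[OF that(2)] tproj_tspace[of q x] unfolding M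
    by (simp add: const_field_def) (simp add: tproj_def inner_diff_right)
  have ptw: "const_field x p = x" if "x \<in> tangent_at M p" for x
    using const_field_eq[OF p] that tan[OF pM] by simp
  show ?thesis unfolding second_fundamental_form_def
  proof (rule the_equality)
    show "\<forall>U\<in>vector_fields. \<forall>W\<in>vector_fields. U p = u \<and> W p = w \<and>
       (\<forall>q\<in>M. U q \<in> tangent_at M q \<and> W q \<in> tangent_at M q) \<longrightarrow> g p (levi_civita g U W p) \<nu> = ?T"
      using val by blast
    fix c assume c: "\<forall>U\<in>vector_fields. \<forall>W\<in>vector_fields. U p = u \<and> W p = w \<and>
       (\<forall>q\<in>M. U q \<in> tangent_at M q \<and> W q \<in> tangent_at M q) \<longrightarrow> g p (levi_civita g U W p) \<nu> = c"
    have "g p (levi_civita g (const_field u) (const_field w) p) \<nu> = c"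
      using c const_field ptw[OF u] ptw[OF w] ext[OF u] ext[OF w] by blast
    moreover have "g p (levi_civita g (const_field u) (const_field w) p) \<nu> = ?T"
      by (rule val[OF const_field ptw[OF u] const_field ptw[OF w] ext[OF w]])
    ultimately show "c = ?T" by simp
  qed
qed

text \<open>The vector \<open>gmat g p *v \<nu>\<close> is orthogonal to \<open>p\<close> and to the tangent space of the equator, so it
  is a multiple of \<open>a\<close>. Hence a tangent vector that is \<open>g\<close>-orthogonal to \<open>\<nu>\<close> is tangent to the
  equator.\<close>

lemma orthonormal_set_insert_normal:
  assumes p: "p \<in> Sph" and ap: "a \<bullet> p = 0" and a: "a \<noteq> 0" and M: "M = Sph \<inter> {x. a \<bullet> x = 0}"
    and nu: "unit_normal g M p \<nu>" and B: "orthonormal_set p B" "span B = tangent_at M p"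
  shows "orthonormal_set p (insert \<nu> B)" "span (insert \<nu> B) = tspace p" "\<nu> \<notin> B"
proof -
  have tan: "tangent_at M p = {v. v \<in> tspace p \<and> a \<bullet> v = 0}"
    unfolding M by (rule equator_tangent[OF p ap])
  have nuT: "\<nu> \<in> tspace p" and nn: "g p \<nu> \<nu> = 1"
    and orth: "\<And>v. v \<in> tangent_at M p \<Longrightarrow> g p \<nu> v = 0"
    using nu by (auto simp: unit_normal_def)
  have BM: "B \<subseteq> tangent_at M p" using B(2) span_superset by blast
  show nB: "\<nu> \<notin> B" using nn orth BM by fastforce
  show on: "orthonormal_set p (insert \<nu> B)"
  proof -
    have "g p v \<nu> = 0" "g p \<nu> v = 0" if "v \<in> B" for v
      using orth BM that g_sym[of p v \<nu>] by auto
    then show ?thesis using B(1) nuT nn nB unfolding orthonormal_set_def by auto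
  qed
  let ?G = "gmat g p *v \<nu>"
  let ?b = "?G - ((?G \<bullet> a) / (a \<bullet> a)) *\<^sub>R a"
  have aT: "a \<in> tspace p" using ap by (simp add: tspace_iff inner_commute)
  have "?b \<in> tspace p" by (intro tspace_diff tspace_scale aT gmat_tspace[OF p nuT])
  moreover have "a \<bullet> ?b = 0" using a by (simp add: inner_diff_right inner_commute)
  ultimately have b: "?b \<in> tangent_at M p" using tan by simp
  have "?G \<bullet> ?b = 0"
    using orth[OF b] gmat_inner[OF p nuT \<open>?b \<in> tspace p\<close>] gmat_sym[OF p, of \<nu> ?b] by simp
  then have "?b \<bullet> ?b = 0" using \<open>a \<bullet> ?b = 0\<close> by (simp add: inner_diff_left inner_diff_right)
  then have Ga: "?G = ((?G \<bullet> a) / (a \<bullet> a)) *\<^sub>R a" by simp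
  show "span (insert \<nu> B) = tspace p"
  proof
    show "span (insert \<nu> B) \<subseteq> tspace p"
      using on tspace_subspace by (intro span_minimal) (auto simp: orthonormal_set_def)
    show "tspace p \<subseteq> span (insert \<nu> B)"
    proof
      fix v assume v: "v \<in> tspace p"
      let ?w = "v - g p \<nu> v *\<^sub>R \<nu>"
      have wT: "?w \<in> tspace p" by (intro tspace_diff tspace_scale v nuT)
      have "g p \<nu> ?w = 0"
        using g_linear(5)[OF p v tspace_scale[OF nuT], of "g p \<nu> v" \<nu>] g_linear(2)[OF p nuT nuT] nn
          g_sym[of p \<nu> ?w] g_sym[of p \<nu> v] by simp
      then have "?G \<bullet> ?w = 0" using gmat_inner[OF p nuT wT] gmat_sym[OF p] by simp
      moreover have "?G \<bullet> a \<noteq> 0"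
      proof
        assume "?G \<bullet> a = 0"
        then have "?G = 0" using Ga by simp
        then show False using nn gmat_inner[OF p nuT nuT] by simp
      qed
      ultimately have "a \<bullet> ?w = 0" using Ga a
        by (metis (no_types, lifting) divide_eq_0_iff inner_eq_zero_iff inner_scaleR_left mult_eq_0_iff)
      then have "?w \<in> span B" using wT B(2) tan by simp
      then have "?w \<in> span (insert \<nu> B)" by (meson span_mono subsetD subset_insertI)
      moreover have "g p \<nu> v *\<^sub>R \<nu> \<in> span (insert \<nu> B)" by (intro span_scale span_base) simp
      ultimately show "v \<in> span (insert \<nu> B)" using span_add by fastforce
    qed
  qed
qed

text \<open>Completing the basis of the equator's tangent space by \<open>\<nu>\<close> turns the partial trace into full
  traces, at the price of the single term \<open>dg g p \<nu> \<nu> \<nu>\<close>.\<close>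

lemma mean_curvature_equator:
  assumes p: "p \<in> Sph" and ap: "a \<bullet> p = 0" and a: "a \<noteq> 0" and M: "M = Sph \<inter> {x. a \<bullet> x = 0}"
    and nu: "unit_normal g M p \<nu>" and E: "orthonormal_set p E" "span E = tspace p"
  shows "2 * mean_curvature g M p \<nu>
    = (\<Sum>e\<in>E. 2 * dg g p e e \<nu> - dg g p \<nu> e e) - dg g p \<nu> \<nu> \<nu>"
proof -
  have tan: "tangent_at M p = {v. v \<in> tspace p \<and> a \<bullet> v = 0}"
    unfolding M by (rule equator_tangent[OF p ap])
  then have "tangent_at M p = tspace p \<inter> {v. a \<bullet> v = 0}" by blast
  then have sub: "subspace (tangent_at M p)"
    by (simp add: subspace_inter[OF tspace_subspace subspace_hyperplane])
  have "tangent_at M p \<subseteq> tspace p" using tan by blast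
  from orthonormal_set_exists[OF p sub this] have ex: "\<exists>B. orthonormal_basis_at g M p B"
    unfolding orthonormal_basis_at_def orthonormal_set_def by blast
  define B where "B = (SOME B. orthonormal_basis_at g M p B)"
  have "orthonormal_basis_at g M p B" unfolding B_def using ex by (rule someI_ex)
  then have B: "finite B" "span B = tangent_at M p" "orthonormal_set p B"
    using \<open>tangent_at M p \<subseteq> tspace p\<close> span_superset[of B]
    unfolding orthonormal_basis_at_def orthonormal_set_def by auto
  have BM: "e \<in> B \<Longrightarrow> e \<in> tangent_at M p" for e using B(2) span_base by blast
  note ins = orthonormal_set_insert_normal[OF p ap a M nu B(3,2)]
  let ?b = "\<lambda>x y. 2 * dg g p x y \<nu> - dg g p \<nu> x y"
  have l: "linear (\<lambda>v. ?b v w)" "linear (?b w)" for w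
    by (rule linearI; simp add: dg_add[OF p] dg_scale[OF p] algebra_simps)+
  have "mean_curvature g M p \<nu> = (\<Sum>e\<in>B. second_fundamental_form g M p \<nu> e e)"
    by (simp add: mean_curvature_def B_def)
  also have "\<dots> = (\<Sum>e\<in>B. ?b e e / 2)"
    using second_fundamental_form_equator[OF p ap M nu BM BM] by (intro sum.cong) auto
  finally have "2 * mean_curvature g M p \<nu> = (\<Sum>e\<in>B. ?b e e)"
    by (simp add: sum_divide_distrib[symmetric])
  moreover have "(\<Sum>e\<in>insert \<nu> B. ?b e e) = (\<Sum>e\<in>B. ?b e e) + dg g p \<nu> \<nu> \<nu>"
    using B(1) ins(3) by simp
  moreover have "(\<Sum>e\<in>insert \<nu> B. ?b e e) = (\<Sum>e\<in>E. ?b e e)"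
    by (rule orthonormal_set_trace[OF p ins(1,2) E l])
  ultimately show ?thesis by simp
qed

text \<open>Every \<open>g\<close>-unit tangent vector \<open>\<nu>\<close> at \<open>p\<close> is normal to an equator through \<open>p\<close>, the one with
  Euclidean normal \<open>gmat g p *v \<nu>\<close>.\<close>

lemma equators_minimal_iff_unit:
  "(\<forall>M\<in>equators. minimal_hypersurface g M) \<longleftrightarrow>
   (\<forall>p\<in>Sph. \<forall>E. orthonormal_set p E \<and> span E = tspace p \<longrightarrow>
      (\<forall>\<nu>\<in>tspace p. g p \<nu> \<nu> = 1 \<longrightarrow> dg g p \<nu> \<nu> \<nu> = (\<Sum>e\<in>E. 2 * dg g p e e \<nu> - dg g p \<nu> e e)))"
  (is "?L \<longleftrightarrow> ?R")
proof
  assume L: ?L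
  show ?R
  proof (intro ballI allI impI)
    fix p E \<nu> assume p: "p \<in> (Sph :: (real^'m) set)" and E: "orthonormal_set p E \<and> span E = tspace p"
      and nu: "\<nu> \<in> tspace p" "g p \<nu> \<nu> = 1"
    define a where "a = gmat g p *v \<nu>"
    define M where "M = Sph \<inter> {x. a \<bullet> x = 0}"
    have a: "a \<noteq> 0" using nu gmat_inner[OF p nu(1) nu(1)] unfolding a_def by auto
    have ap: "a \<bullet> p = 0" using gmat_tspace[OF p nu(1)] by (simp add: a_def tspace_iff inner_commute)
    have "unit_normal g M p \<nu>"
      unfolding unit_normal_def M_def equator_tangent[OF p ap]
      using nu gmat_inner[OF p nu(1)] gmat_sym[OF p, of \<nu>] by (auto simp: a_def)
    moreover have "M \<in> equators" using a unfolding equators_def M_def by blast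
    moreover have "p \<in> M" using p ap by (simp add: M_def)
    ultimately have "mean_curvature g M p \<nu> = 0" "unit_normal g M p \<nu>"
      using L by (auto simp: minimal_hypersurface_def)
    then show "dg g p \<nu> \<nu> \<nu> = (\<Sum>e\<in>E. 2 * dg g p e e \<nu> - dg g p \<nu> e e)"
      using mean_curvature_equator[OF p ap a M_def _ conjunct1[OF E] conjunct2[OF E], of \<nu>] by simp
  qed
next
  assume R: ?R
  show ?L
  proof
    fix M :: "(real^'m) set" assume "M \<in> equators"
    then obtain a where a: "a \<noteq> 0" and M: "M = Sph \<inter> {x. a \<bullet> x = 0}" unfolding equators_def by blast
    show "minimal_hypersurface g M" unfolding minimal_hypersurface_def
    proof (intro ballI allI impI)
      fix p \<nu> assume "p \<in> M" and nu: "unit_normal g M p \<nu>"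
      then have p: "p \<in> Sph" and ap: "a \<bullet> p = 0" using M by auto
      obtain E where E: "orthonormal_set p E" "span E = tspace p"
        using orthonormal_set_exists[OF p tspace_subspace subset_refl] by blast
      then have "dg g p \<nu> \<nu> \<nu> = (\<Sum>e\<in>E. 2 * dg g p e e \<nu> - dg g p \<nu> e e)"
        using R p nu unfolding unit_normal_def by blast
      then show "mean_curvature g M p \<nu> = 0"
        using mean_curvature_equator[OF p ap a M nu E] by simp
    qed
  qed
qed

end

section \<open>Minimal equators and the logarithmic derivative of the determinant\<close>

lemma det_replace_row:
  fixes A B :: "real ^ 'n::finite ^ 'n"
  shows "det (\<chi> k. if k = i then B $ i else A $ k)
    = (\<Sum>\<pi> | \<pi> permutes UNIV. of_int (sign \<pi>) * (B $ i $ \<pi> i * (\<Prod>j\<in>UNIV - {i}. A $ j $ \<pi> j)))"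
proof -
  have "(\<Prod>k\<in>UNIV. (\<chi> k. if k = i then B $ i else A $ k) $ k $ \<pi> k)
      = B $ i $ \<pi> i * (\<Prod>j\<in>UNIV - {i}. A $ j $ \<pi> j)" for \<pi>
    by (subst prod.remove[of _ i]) (auto intro!: prod.cong)
  then show ?thesis unfolding det_def by simp
qed

text \<open>Jacobi's formula. Expanding along rows, the derivative is the sum of the determinants with one
  row of \<open>A x\<close> replaced by the corresponding row of \<open>A' h\<close>, and these are found by Cramer's rule.\<close>

lemma has_derivative_det:
  fixes A :: "'a::real_normed_vector \<Rightarrow> real ^ 'n::finite ^ 'n"
  assumes A: "(A has_derivative A') (at x)" and C: "A x ** C = mat 1" "C ** A x = mat 1"
  shows "((\<lambda>x. det (A x)) has_derivative (\<lambda>h. det (A x) * trace (A' h ** C))) (at x)"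
proof -
  have e: "((\<lambda>x. A x $ i $ j) has_derivative (\<lambda>h. A' h $ i $ j)) (at x)" for i j
    by (intro bounded_linear.has_derivative[OF bounded_linear_vec_nth] A)
  have row: "det (\<chi> k. if k = i then B $ i else A x $ k) = (B ** C) $ i $ i * det (A x)" for i B
  proof -
    have "B = (B ** C) ** A x" using C by (simp add: matrix_mul_assoc[symmetric])
    then have "B $ i $ j = (\<Sum>k\<in>UNIV. (B ** C) $ i $ k * A x $ k $ j)" for j
      by (metis (no_types, lifting) matrix_matrix_mult_def sum.cong vec_lambda_beta)
    then have "B $ i = (\<Sum>k\<in>UNIV. (B ** C) $ i $ k *s row k (A x))"
      by (simp add: vec_eq_iff row_def)
    then show ?thesis using cramer_lemma_transpose[of i "(B ** C) $ i" "A x"]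
      by (simp add: row_def cong: if_cong)
  qed
  have "((\<lambda>x. det (A x)) has_derivative (\<lambda>h. \<Sum>\<pi> | \<pi> permutes UNIV. of_int (sign \<pi>) *
      (\<Sum>i\<in>UNIV. A' h $ i $ \<pi> i * (\<Prod>j\<in>UNIV - {i}. A x $ j $ \<pi> j)))) (at x)"
    unfolding det_def by (intro has_derivative_sum has_derivative_mult_right has_derivative_prod e)
  moreover have "(\<Sum>\<pi> | \<pi> permutes UNIV. of_int (sign \<pi>) *
      (\<Sum>i\<in>UNIV. A' h $ i $ \<pi> i * (\<Prod>j\<in>UNIV - {i}. A x $ j $ \<pi> j)))
      = det (A x) * trace (A' h ** C)" for h
    by (simp add: sum_distrib_left sum.swap[of _ UNIV] det_replace_row[symmetric] row trace_def
      mult.commute)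
  ultimately show ?thesis by simp
qed

context sphere_metric begin

text \<open>Jacobi's formula, with the inverse matrix written in a \<open>g\<close>-orthonormal basis of the tangent
  space completed by \<open>p\<close>.\<close>

lemma sderiv_det:
  assumes p: "p \<in> Sph" and u: "u \<in> tspace p" and E: "orthonormal_set p E" "span E = tspace p"
  shows "sderiv (\<lambda>q. det (gmat g q)) p u = det (gmat g p) * (\<Sum>e\<in>E. dg g p u e e)"
proof -
  have "invertible (gmat g p)" using gmat_det_pos[OF p] by (simp add: invertible_det_nz)
  then obtain C where C: "gmat g p ** C = mat 1" "C ** gmat g p = mat 1"
    unfolding invertible_def by blast
  have ET: "E \<subseteq> tspace p" using E by (simp add: orthonormal_set_def)
  \<comment> \<open>The inverse matrix in terms of the orthonormal basis \<open>insert p E\<close>.\<close>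
  have inv: "C *v y = (\<Sum>e\<in>E. (e \<bullet> y) *\<^sub>R e) + (p \<bullet> y) *\<^sub>R p" for y
  proof -
    let ?x = "C *v y"
    have y: "y = gmat g p *v ?x" using C by (simp add: matrix_vector_mul_assoc)
    have "g p (tproj p ?x) e = e \<bullet> y" if "e \<in> E" for e
    proof -
      have eT: "e \<in> tspace p" using that ET by blast
      have "g p (tproj p ?x) e = tproj p ?x \<bullet> (gmat g p *v e)"
        using gmat_inner[OF p tproj_tspace[OF p] eT] by simp
      also have "\<dots> = ?x \<bullet> (gmat g p *v e)" by (rule tproj_inner[OF gmat_tspace[OF p eT]])
      also have "\<dots> = y \<bullet> e" using gmat_sym[OF p] y by metis
      finally show ?thesis by (simp add: inner_commute)
    qed
    then have "tproj p ?x = (\<Sum>e\<in>E. (e \<bullet> y) *\<^sub>R e)"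
      using orthonormal_set_expand[OF p E(1), of "tproj p ?x"] tproj_tspace[OF p] E(2) by simp
    moreover have "p \<bullet> y = p \<bullet> ?x"
      using gmat_sym[OF p, of p ?x] gmat_point[OF p] y by simp
    ultimately show ?thesis by (simp add: tproj_def algebra_simps)
  qed
  let ?A = "dmat g p u"
  have "((\<lambda>x. det (gmat g (sgn x))) has_derivative
      (\<lambda>h. det (gmat g (sgn p)) * trace (sderiv (gmat g) p h ** C))) (at p)"
    by (rule has_derivative_det[OF has_sderiv[OF gmat_smooth p]]) (simp_all add: sgn_Sph[OF p] C)
  from sderivI[OF this, of u]
  have "sderiv (\<lambda>q. det (gmat g q)) p u = det (gmat g p) * trace (?A ** C)"
    by (simp add: sgn_Sph[OF p] dmat_def)
  also have "trace (?A ** C) = trace (C ** ?A)" by (rule trace_mul_sym)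
  also have "\<dots> = (\<Sum>k\<in>UNIV. (C *v (?A *v axis k 1)) $ k)"
    by (simp only: trace_def matrix_vector_mul_assoc) (simp add: matrix_vector_mult_basis column_def)
  also have "\<dots> = (\<Sum>k\<in>UNIV. (\<Sum>e\<in>E. (e \<bullet> (?A *v axis k 1)) * e $ k) + (p \<bullet> (?A *v axis k 1)) * p $ k)"
    unfolding inv by simp
  also have "\<dots> = (\<Sum>e\<in>E. \<Sum>k\<in>UNIV. (e \<bullet> (?A *v axis k 1)) * e $ k)
      + (\<Sum>k\<in>UNIV. (p \<bullet> (?A *v axis k 1)) * p $ k)"
    by (simp add: sum.distrib) (rule sum.swap)
  also have "\<dots> = (\<Sum>e\<in>E. dg g p u e e) + dg g p u p p"
  proof -
    have "(\<Sum>k\<in>UNIV. (v \<bullet> (?A *v axis k 1)) * v $ k) = dg g p u v v" for v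
    proof -
      have "linear (\<lambda>w. v \<bullet> (?A *v w))"
        by (rule linearI) (simp_all add: matrix_vector_right_distrib inner_add_right
          matrix_vector_mult_scaleR)
      from linear_functional_vec[OF this, of v] show ?thesis by (simp add: dg_def inner_vec_def)
    qed
    then show ?thesis by simp
  qed
  finally show ?thesis by (simp add: dg_point[OF p u])
qed

text \<open>The part linear in \<open>u\<close> of the cubic identity at \<open>v + u\<close>, extracted by comparing with \<open>v - u\<close> and
  removing the term cubic in \<open>u\<close>.\<close>

lemma dg_polarized:
  assumes p: "p \<in> Sph" and al: "linear \<alpha>"
    and c: "\<And>v. v \<in> tspace p \<Longrightarrow> dg g p v v v = \<alpha> v * g p v v"
    and u: "u \<in> tspace p" and v: "v \<in> tspace p"
  shows "dg g p u v v + 2 * dg g p v v u = \<alpha> u * g p v v + 2 * \<alpha> v * g p u v"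
proof -
  let ?m = "(-1) *\<^sub>R u"
  have m: "?m \<in> tspace p" by (rule tspace_scale[OF u])
  note G = g_linear[OF p v u] g_linear[OF p v m] g_linear[OF p u u]
    and L = linear_add[OF al] linear_scale[OF al]
  have s: "dg g p v u v = dg g p v v u" "dg g p u u v = dg g p u v u" "g p v u = g p u v"
    by (rule dg_sym[OF p], rule dg_sym[OF p], rule g_sym)
  have 1: "dg g p (v + u) (v + u) (v + u) = \<alpha> (v + u) * g p (v + u) (v + u)"
    by (rule c[OF tspace_add[OF v u]])
  have 2: "dg g p (v + ?m) (v + ?m) (v + ?m) = \<alpha> (v + ?m) * g p (v + ?m) (v + ?m)"
    by (rule c[OF tspace_add[OF v m]])
  have 3: "dg g p v v v + dg g p v v u + dg g p v v u + dg g p v u u + dg g p u v v + 2 * dg g p u v u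
      + dg g p u u u
     = (\<alpha> v + \<alpha> u) * (g p v v + 2 * g p u v + g p u u)"
  proof -
    have "g p (v + u) (v + u) = g p v v + 2 * g p u v + g p u u" by (simp add: G(1,3) s)
    then show ?thesis using 1 by (simp add: dg_add[OF p] L s)
  qed
  have 4: "dg g p v v v - dg g p v v u - dg g p v v u + dg g p v u u - dg g p u v v + 2 * dg g p u v u
      - dg g p u u u
     = (\<alpha> v - \<alpha> u) * (g p v v - 2 * g p u v + g p u u)"
    using 2 unfolding dg_add[OF p] G(6,8) g_linear(3)[OF p v m] dg_scale[OF p] g_linear(2,4)[OF p u u] L
    by (simp add: s g_linear(2,4)[OF p u u] g_linear(2,4)[OF p u v] del: scaleR_minus_left
      scaleR_minus1_left)
      (simp add: algebra_simps)
  have 5: "dg g p u u u = \<alpha> u * g p u u" by (rule c[OF u])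
  show ?thesis using 3 4 5 by (simp add: algebra_simps)
qed

lemma dg_trace_identity:
  assumes p: "p \<in> Sph" and E: "orthonormal_set p E" "span E = tspace p" and al: "linear \<alpha>"
    and c: "\<And>v. v \<in> tspace p \<Longrightarrow> dg g p v v v = \<alpha> v * g p v v" and u: "u \<in> tspace p"
  shows "(\<Sum>e\<in>E. dg g p u e e) + 2 * (\<Sum>e\<in>E. dg g p e e u) = (real CARD('m) + 1) * \<alpha> u"
proof -
  have ET: "E \<subseteq> tspace p" using E by (simp add: orthonormal_set_def)
  have "(\<Sum>e\<in>E. dg g p u e e) + 2 * (\<Sum>e\<in>E. dg g p e e u) = (\<Sum>e\<in>E. dg g p u e e + 2 * dg g p e e u)"
    by (simp add: sum.distrib sum_distrib_left)
  also have "\<dots> = (\<Sum>e\<in>E. \<alpha> u * g p e e + 2 * \<alpha> e * g p u e)"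
    using dg_polarized[OF p al c u] ET by (intro sum.cong) auto
  also have "\<dots> = (\<Sum>e\<in>E. \<alpha> u + 2 * (g p u e * \<alpha> e))"
    using E by (intro sum.cong) (auto simp: orthonormal_set_def)
  also have "\<dots> = real (card E) * \<alpha> u + 2 * (\<Sum>e\<in>E. g p u e * \<alpha> e)"
    by (simp add: sum.distrib sum_distrib_left)
  also have "(\<Sum>e\<in>E. g p u e * \<alpha> e) = \<alpha> (\<Sum>e\<in>E. g p u e *\<^sub>R e)"
    by (simp add: linear_sum[OF al] linear_scale[OF al])
  also have "(\<Sum>e\<in>E. g p u e *\<^sub>R e) = u"
    using orthonormal_set_expand[OF p E(1), of u] u E(2) by simp
  finally have "(\<Sum>e\<in>E. dg g p u e e) + 2 * (\<Sum>e\<in>E. dg g p e e u) = real (card E) * \<alpha> u + 2 * \<alpha> u" .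
  moreover have "real CARD('m) = real (card E) + 1" using orthonormal_set_card[OF p E]
    by (metis of_nat_1 of_nat_add)
  ultimately show ?thesis by (simp add: algebra_simps)
qed

text \<open>With \<open>\<alpha> = 2 * div - tr\<close>, the trace identity \<open>tr + 2 * div = (n + 2) * \<alpha>\<close> gives
  \<open>tr = (n + 1) / 2 * \<alpha>\<close>. Conversely, defining \<open>\<alpha>\<close> by the latter equation, the trace identity
  yields \<open>2 * div - tr = \<alpha>\<close>. Here \<open>CARD('m) = n + 1\<close>.\<close>

lemma unit_condition_iff:
  assumes p: "p \<in> Sph" and E: "orthonormal_set p E" "span E = tspace p"
  shows "(\<forall>\<nu>\<in>tspace p. g p \<nu> \<nu> = 1 \<longrightarrow> dg g p \<nu> \<nu> \<nu> = (\<Sum>e\<in>E. 2 * dg g p e e \<nu> - dg g p \<nu> e e)) \<longleftrightarrow>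
    (\<forall>v\<in>tspace p. dg g p v v v = 2 / real CARD('m) * (\<Sum>e\<in>E. dg g p v e e) * g p v v)"
    (is "?L \<longleftrightarrow> ?R")
proof
  let ?tr = "\<lambda>v. \<Sum>e\<in>E. dg g p v e e" and ?div = "\<lambda>v. \<Sum>e\<in>E. dg g p e e v"
  have ltr: "linear ?tr" and ldiv: "linear ?div"
    by (rule linearI; simp add: dg_add[OF p] dg_scale[OF p] sum.distrib sum_distrib_left)+
  {
    assume L: ?L
    let ?a = "\<lambda>v. 2 * ?div v - ?tr v"
    have la: "linear ?a"
      by (rule linearI; simp add: dg_add[OF p] dg_scale[OF p] sum.distrib sum_distrib_left algebra_simps)
    have c: "dg g p v v v = ?a v * g p v v" if v: "v \<in> tspace p" for v
    proof (cases "v = 0")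
      case True
      then show ?thesis using dg_scale(1)[OF p, of 0 v] by (simp add: g_zero)
    next
      case False
      define s where "s = sqrt (g p v v)"
      have pos: "g p v v > 0" by (rule g_pos[OF p v False])
      then have s: "s > 0" "s * s = g p v v" by (auto simp: s_def)
      let ?n = "(1 / s) *\<^sub>R v"
      have n: "?n \<in> tspace p" by (rule tspace_scale[OF v])
      have "g p ?n ?n = 1" using s pos by (simp add: g_linear[OF p v v] field_simps)
      then have "dg g p ?n ?n ?n = (\<Sum>e\<in>E. 2 * dg g p e e ?n - dg g p ?n e e)" using L n by blast
      also have "\<dots> = ?a ?n" by (simp only: sum_subtractf sum_distrib_left)
      also have "\<dots> = ?a v / s" using linear_scale[OF la, of "1/s" v] by simp
      finally have "dg g p v v v / (s * s * s) = ?a v / s" by (simp add: dg_scale[OF p])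
      then have "dg g p v v v = ?a v * (s * s)" using s(1) by (simp add: field_simps)
      then show ?thesis using s(2) by simp
    qed
    have "?a v = 2 / real CARD('m) * ?tr v" if "v \<in> tspace p" for v
      using dg_trace_identity[OF p E la c that] by (simp add: field_simps)
    then show ?R using c by simp
  }
  {
    assume R: ?R
    let ?a = "\<lambda>v. 2 / real CARD('m) * ?tr v"
    have la: "linear ?a"
      by (rule linearI; simp add: dg_add[OF p] dg_scale[OF p] sum.distrib sum_distrib_left algebra_simps)
    have "?a v = 2 * ?div v - ?tr v" if "v \<in> tspace p" for v
      using dg_trace_identity[OF p E la _ that] R by (simp add: field_simps)
    then show ?L using R by (simp add: sum_subtractf sum_distrib_left)
  }
qed

lemma equators_minimal_iff:
  "(\<forall>M\<in>equators. minimal_hypersurface g M) \<longleftrightarrow>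
   (\<forall>p\<in>Sph. \<forall>v\<in>tspace p. dg g p v v v
      = 2 / real CARD('m) * (sderiv (\<lambda>q. det (gmat g q)) p v / det (gmat g p)) * g p v v)"
proof -
  have "(\<forall>v\<in>tspace p. dg g p v v v
      = 2 / real CARD('m) * (sderiv (\<lambda>q. det (gmat g q)) p v / det (gmat g p)) * g p v v) \<longleftrightarrow>
    (\<forall>E. orthonormal_set p E \<and> span E = tspace p \<longrightarrow>
      (\<forall>\<nu>\<in>tspace p. g p \<nu> \<nu> = 1 \<longrightarrow> dg g p \<nu> \<nu> \<nu> = (\<Sum>e\<in>E. 2 * dg g p e e \<nu> - dg g p \<nu> e e)))"
    (is "?K \<longleftrightarrow> ?U") if p: "p \<in> Sph" for p
  proof -
    have *: "?K \<longleftrightarrow> (\<forall>\<nu>\<in>tspace p. g p \<nu> \<nu> = 1 \<longrightarrow> dg g p \<nu> \<nu> \<nu> = (\<Sum>e\<in>E. 2 * dg g p e e \<nu> - dg g p \<nu> e e))"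
      if E: "orthonormal_set p E" "span E = tspace p" for E
      using gmat_det_pos[OF p] by (simp add: unit_condition_iff[OF p E] sderiv_det[OF p _ E])
    obtain E where E: "orthonormal_set p E" "span E = tspace p"
      using orthonormal_set_exists[OF p tspace_subspace subset_refl] by blast
    show ?thesis using * E by blast
  qed
  then show ?thesis unfolding equators_minimal_iff_unit by blast
qed

end

section \<open>Volume elements\<close>

lemma det_nat_cong:
  assumes "\<And>i j. i < n \<Longrightarrow> j < n \<Longrightarrow> A i j = B i j"
  shows "det_nat n A = det_nat n B"
  unfolding det_nat_def
proof (intro sum.cong refl arg_cong2[of _ _ _ _ times] prod.cong)
  fix \<pi> i assume "\<pi> \<in> {\<pi>. \<pi> permutes {..<n}}" "i \<in> {..<n}"
  then show "A i (\<pi> i) = B i (\<pi> i)"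
    using assms permutes_in_image[of \<pi> "{..<n}" i] by simp
qed

text \<open>Conjugating by the enumeration \<open>\<phi>\<close> of the index type is a sign-preserving bijection between the
  permutations.\<close>

lemma det_nat_eq_det:
  fixes A :: "real ^ 'm::finite ^ 'm"
  assumes \<phi>: "bij_betw \<phi> {..<N} (UNIV :: 'm set)"
  shows "det_nat N (\<lambda>i j. A $ \<phi> i $ \<phi> j) = det A"
proof -
  let ?h = "map_permutation {..<N} \<phi>"
  have img: "\<phi> ` {..<N} = UNIV" and inj: "inj_on \<phi> {..<N}" using \<phi> by (auto simp: bij_betw_def)
  have "bij_betw ?h {\<pi>. \<pi> permutes {..<N}} {\<pi>. \<pi> permutes UNIV}"
    using bij_betw_permutations[OF \<phi>]
    by (simp add: map_permutation_def[abs_def] restrict_id_def img comp_def)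
  then have "det A = (\<Sum>\<pi> | \<pi> permutes {..<N}. of_int (sign (?h \<pi>)) * (\<Prod>k\<in>UNIV. A $ k $ (?h \<pi> k)))"
    unfolding det_def by (subst sum.reindex_bij_betw[symmetric]) auto
  also have "\<dots> = det_nat N (\<lambda>i j. A $ \<phi> i $ \<phi> j)"
    unfolding det_nat_def
  proof (intro sum.cong refl arg_cong2[of _ _ _ _ times])
    fix \<pi> assume \<pi>: "\<pi> \<in> {\<pi>. \<pi> permutes {..<N}}"
    show "of_int (sign (?h \<pi>)) = (of_int (sign \<pi>) :: real)"
      using sign_map_permutation[OF inj, of \<pi>] \<pi> by simp
    have "(\<Prod>k\<in>UNIV. A $ k $ (?h \<pi> k)) = (\<Prod>i<N. A $ \<phi> i $ (?h \<pi> (\<phi> i)))"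
      by (rule prod.reindex_bij_betw[OF \<phi>, symmetric])
    then show "(\<Prod>k\<in>UNIV. A $ k $ (?h \<pi> k)) = (\<Prod>i<N. A $ \<phi> i $ \<phi> (\<pi> i))"
      by (simp add: map_permutation_apply[OF inj])
  qed
  finally show ?thesis by simp
qed

text \<open>A permutation contributes to the larger determinant only if it fixes the last index.\<close>

lemma det_nat_Suc_block:
  assumes off: "\<And>j. j < n \<Longrightarrow> A n j = 0" and one: "A n n = 1"
  shows "det_nat (Suc n) A = det_nat n A"
proof -
  let ?f = "\<lambda>\<pi>. of_int (sign \<pi>) * (\<Prod>i<Suc n. A i (\<pi> i))"
  have "(\<Sum>\<pi> | \<pi> permutes {..<n}. ?f \<pi>) = (\<Sum>\<pi> | \<pi> permutes {..<Suc n}. ?f \<pi>)"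
  proof (rule sum.mono_neutral_left)
    show "finite {\<pi>. \<pi> permutes {..<Suc n}}" by (simp add: finite_permutations)
    show "{\<pi>. \<pi> permutes {..<n}} \<subseteq> {\<pi>. \<pi> permutes {..<Suc n}}"
      using permutes_subset[of _ "{..<n}" "{..<Suc n}"] by auto
    show "\<forall>\<pi>\<in>{\<pi>. \<pi> permutes {..<Suc n}} - {\<pi>. \<pi> permutes {..<n}}. ?f \<pi> = 0"
    proof
      fix \<pi> assume \<pi>: "\<pi> \<in> {\<pi>. \<pi> permutes {..<Suc n}} - {\<pi>. \<pi> permutes {..<n}}"
      then have "\<pi> n \<noteq> n"
        using permutes_superset[of \<pi> "{..<Suc n}" "{..<n}"] by (auto simp: less_Suc_eq)
      moreover have "\<pi> n < Suc n" using \<pi> permutes_in_image[of \<pi> "{..<Suc n}" n] by simp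
      ultimately show "?f \<pi> = 0" using off[of "\<pi> n"] by (simp add: lessThan_Suc)
    qed
  qed
  moreover have "(\<Sum>\<pi> | \<pi> permutes {..<n}. ?f \<pi>)
      = (\<Sum>\<pi> | \<pi> permutes {..<n}. of_int (sign \<pi>) * (\<Prod>i<n. A i (\<pi> i)))"
  proof (intro sum.cong refl)
    fix \<pi> assume "\<pi> \<in> {\<pi>. \<pi> permutes {..<n}}"
    then have "\<pi> n = n" using permutes_not_in[of \<pi> "{..<n}" n] by simp
    then show "?f \<pi> = of_int (sign \<pi>) * (\<Prod>i<n. A i (\<pi> i))" using one by (simp add: lessThan_Suc)
  qed
  ultimately show ?thesis by (simp only: det_nat_def)
qed

text \<open>Completing the tangent vectors by the point itself gives the rows of a square matrix \<open>V\<close>. The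
  Gram matrix, bordered by a trivial row and column, is \<open>V ** G ** transpose V\<close>. The factor \<open>d\<close> is
  the same for all \<open>G\<close>, which allows \<open>g\<close> to be compared with the round metric.\<close>

lemma gram_det:
  fixes p :: "real ^ 'm::finite"
  assumes n: "CARD('m) = Suc n" and p: "p \<in> Sph" and v: "\<And>i. i < n \<Longrightarrow> v i \<in> tspace p"
  shows "\<exists>d. \<forall>G :: real ^ 'm ^ 'm. (\<forall>w. p \<bullet> (G *v w) = p \<bullet> w) \<longrightarrow>
     det_nat n (\<lambda>i j. v i \<bullet> (G *v v j)) = det G * d\<^sup>2"
proof -
  obtain \<phi> where \<phi>: "bij_betw \<phi> {..<Suc n} (UNIV :: 'm set)"
    using ex_bij_betw_nat_finite[of "UNIV :: 'm set"] n by (auto simp: atLeast0LessThan)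
  define u where "u i = (if i < n then v i else p)" for i
  define V :: "real ^ 'm ^ 'm" where "V = (\<chi> k. u (inv_into {..<Suc n} \<phi> k))"
  have Vu: "V $ \<phi> i = u i" if "i < Suc n" for i
    using \<phi> that by (simp add: V_def inv_into_f_f bij_betw_def)
  have "det_nat n (\<lambda>i j. v i \<bullet> (G *v v j)) = det G * (det V)\<^sup>2"
    if G: "\<And>w. p \<bullet> (G *v w) = p \<bullet> w" for G :: "real ^ 'm ^ 'm"
  proof -
    have ent: "(V ** G ** transpose V) $ k $ l = V $ k \<bullet> (G *v V $ l)" for k l
      unfolding matrix_mul_assoc[symmetric]
      by (simp add: matrix_matrix_mult_def inner_vec_def matrix_vector_mult_def transpose_def)
    have "det_nat n (\<lambda>i j. v i \<bullet> (G *v v j)) = det_nat n (\<lambda>i j. u i \<bullet> (G *v u j))"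
      by (rule det_nat_cong) (simp add: u_def)
    also have "\<dots> = det_nat (Suc n) (\<lambda>i j. u i \<bullet> (G *v u j))"
    proof (rule det_nat_Suc_block[symmetric])
      show "u n \<bullet> (G *v u j) = 0" if "j < n" for j
        using v[OF that] that by (simp add: u_def G tspace_iff)
      show "u n \<bullet> (G *v u n) = 1" using Sph_inner[OF p] by (simp add: u_def G)
    qed
    also have "\<dots> = det_nat (Suc n) (\<lambda>i j. (V ** G ** transpose V) $ \<phi> i $ \<phi> j)"
      by (rule det_nat_cong) (simp add: ent Vu)
    also have "\<dots> = det (V ** G ** transpose V)" by (rule det_nat_eq_det[OF \<phi>])
    finally show ?thesis by (simp add: det_mul det_transpose power2_eq_square)
  qed
  then show ?thesis by blast
qed

text \<open>An orthogonal matrix that maps a coordinate vector to \<open>p\<close> maps the others to an orthonormal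
  basis of the tangent space. Such a basis tests the volume elements in the uniqueness of
  densities.\<close>

lemma gram_det_one:
  fixes p :: "real ^ 'm::finite"
  assumes n: "CARD('m) = Suc n" and p: "p \<in> Sph"
  shows "\<exists>v. (\<forall>i<n. v i \<in> tspace p) \<and> det_nat n (\<lambda>i j. v i \<bullet> v j) = 1"
proof -
  obtain \<phi> where \<phi>: "bij_betw \<phi> {..<Suc n} (UNIV :: 'm set)"
    using ex_bij_betw_nat_finite[of "UNIV :: 'm set"] n by (auto simp: atLeast0LessThan)
  have eq: "\<phi> i = \<phi> j \<longleftrightarrow> i = j" if "i < Suc n" "j < Suc n" for i j
    using \<phi> that by (auto simp: bij_betw_def inj_on_def)
  obtain A :: "real ^ 'm ^ 'm" where A: "orthogonal_matrix A" "A *v axis (\<phi> n) 1 = p"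
    using orthogonal_matrix_exists_basis[of p "\<phi> n"] p by auto
  define v where "v i = A *v axis (\<phi> i) 1" for i
  have "orthogonal_transformation ((*v) A)" using A(1) by (simp add: orthogonal_transformation_matrix)
  then have vv: "v i \<bullet> v j = mat 1 $ \<phi> i $ \<phi> j" for i j
    by (simp add: v_def orthogonal_transformation_def inner_axis_axis mat_def)
  have "v i \<in> tspace p" if "i < n" for i
    using vv[of n i] eq[of n i] that A(2) by (simp add: v_def tspace_iff mat_def)
  moreover have "det_nat n (\<lambda>i j. v i \<bullet> v j) = det_nat (Suc n) (\<lambda>i j. v i \<bullet> v j)"
    by (rule det_nat_Suc_block[symmetric]) (simp_all add: vv mat_def eq)
  moreover have "\<dots> = det (mat 1 :: real ^ 'm ^ 'm)"
    unfolding vv by (rule det_nat_eq_det[OF \<phi>])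
  ultimately show ?thesis by auto
qed

text \<open>The function \<open>f\<close> with \<open>dV\<^sub>g = f powr s dV\<close>, where \<open>dV\<close> is the round volume element: the ratio of
  the volume elements is the square root of the determinant.\<close>

definition vol_density :: "('m::finite) tensor2 \<Rightarrow> real \<Rightarrow> 'm scalar_field"
  where "vol_density g s p = (if p \<in> Sph then det (gmat g p) powr (1 / (2 * s)) else 0)"

context sphere_metric begin

lemma volume_factor_iff:
  assumes n: "CARD('m) = Suc n" and s: "s > 0"
  shows "volume_factor s g f \<longleftrightarrow> f = vol_density g s"
proof -
  have vol: "\<exists>d. volume_element g p v = sqrt (det (gmat g p)) * \<bar>d\<bar> \<and> volume_element round_metric p v = \<bar>d\<bar>"
    if p: "p \<in> Sph" and v: "\<forall>i<CARD('m) - 1. v i \<in> tspace p" for p v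
  proof -
    have v': "v i \<in> tspace p" if "i < n" for i using v n that by simp
    obtain d where d: "\<And>G :: real ^ 'm ^ 'm. (\<And>w. p \<bullet> (G *v w) = p \<bullet> w) \<Longrightarrow>
       det_nat n (\<lambda>i j. v i \<bullet> (G *v v j)) = det G * d\<^sup>2"
      using gram_det[OF n p, of v] v' by blast
    have "det_nat n (\<lambda>i j. g p (v i) (v j)) = det_nat n (\<lambda>i j. v i \<bullet> (gmat g p *v v j))"
      by (rule det_nat_cong) (simp add: gmat_inner[OF p v' v'])
    also have "\<dots> = det (gmat g p) * d\<^sup>2"
      by (rule d) (simp add: gmat_sym[OF p] gmat_point[OF p])
    finally have 1: "volume_element g p v = sqrt (det (gmat g p)) * \<bar>d\<bar>"
      by (simp add: volume_element_def n real_sqrt_mult)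
    have "det_nat n (\<lambda>i j. round_metric p (v i) (v j)) = det_nat n (\<lambda>i j. v i \<bullet> (mat 1 *v v j))"
      using p v' by (intro det_nat_cong) (simp add: round_metric_def)
    also have "\<dots> = det (mat 1 :: real ^ 'm ^ 'm) * d\<^sup>2" by (rule d) simp
    finally have 2: "volume_element round_metric p v = \<bar>d\<bar>"
      by (simp add: volume_element_def n)
    show ?thesis using 1 2 by blast
  qed
  show ?thesis
  proof
    assume f: "volume_factor s g f"
    show "f = vol_density g s"
    proof
      fix p
      show "f p = vol_density g s p"
      proof (cases "p \<in> Sph")
        case False
        then show ?thesis using f by (simp add: volume_factor_def scalar_fields_def vol_density_def)
      next
        case p: True
        obtain v where v: "\<forall>i<n. v i \<in> tspace p" and v1: "det_nat n (\<lambda>i j. v i \<bullet> v j) = 1"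
          using gram_det_one[OF n p] by blast
        then have v': "\<forall>i<CARD('m) - 1. v i \<in> tspace p" using n by simp
        have "det_nat n (\<lambda>i j. round_metric p (v i) (v j)) = det_nat n (\<lambda>i j. v i \<bullet> v j)"
          using p v by (intro det_nat_cong) (simp add: round_metric_def)
        then have "volume_element round_metric p v = 1"
          using v1 by (simp add: volume_element_def n)
        moreover have "volume_element g p v = f p powr s * volume_element round_metric p v"
          and pos: "f p > 0"
          using f p v' unfolding volume_factor_def by blast+
        ultimately have "f p powr s = sqrt (det (gmat g p))" using vol[OF p v'] by auto
        then have "f p powr s = det (gmat g p) powr (1 / 2)"
          using gmat_det_pos[OF p] by (simp add: powr_half_sqrt)
        then have "(f p powr s) powr (1 / s) = (det (gmat g p) powr (1 / 2)) powr (1 / s)" by simp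
        then show ?thesis using s pos p by (simp add: powr_powr vol_density_def)
      qed
    qed
  next
    assume f: "f = vol_density g s"
    have "smooth_on_sphere (\<lambda>p. det (gmat g p) powr (1 / (2 * s)))"
      by (rule sph_powr[OF gmat_det_pos sph_det[OF gmat_smooth]])
    then have "smooth_on_sphere f"
      by (rule sph_cong[rotated]) (simp add: f vol_density_def)
    moreover have pos: "f p > 0" if "p \<in> Sph" for p
      using gmat_det_pos[OF that] that by (simp add: f vol_density_def)
    moreover have "f p powr s = sqrt (det (gmat g p))" if "p \<in> Sph" for p
      using gmat_det_pos[OF that] that s by (simp add: f vol_density_def powr_powr powr_half_sqrt)
    then have "volume_element g p v = f p powr s * volume_element round_metric p v"
      if "p \<in> Sph" "\<forall>i<CARD('m) - 1. v i \<in> tspace p" for p v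
      using vol[OF that] that(1) by auto
    moreover have "f p = 0" if "p \<notin> Sph" for p using that by (simp add: f vol_density_def)
    ultimately show "volume_factor s g f"
      unfolding volume_factor_def scalar_fields_def by blast
  qed
qed

end

section \<open>Minimal equators and great circles\<close>

definition great_circle :: "'a::real_vector \<Rightarrow> 'a \<Rightarrow> real \<Rightarrow> 'a"
  where "great_circle p v t = cos t *\<^sub>R p + sin t *\<^sub>R v"

definition great_circle' :: "'a::real_vector \<Rightarrow> 'a \<Rightarrow> real \<Rightarrow> 'a"
  where "great_circle' p v t = - sin t *\<^sub>R p + cos t *\<^sub>R v"

text \<open>For symmetric two-tensors this is the Killing equation of the round metric in integrated form.\<close>

definition great_circle_invariant :: "('m::finite) tensor2 \<Rightarrow> bool"
  where "great_circle_invariant k \<longleftrightarrow>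
    (\<forall>p\<in>Sph. \<forall>v\<in>tspace p. norm v = 1 \<longrightarrow>
      (\<forall>t. k (great_circle p v t) (great_circle' p v t) (great_circle' p v t) = k p v v))"

lemma great_circle_facts:
  assumes p: "p \<in> Sph" and v: "v \<in> tspace p" "norm v = 1"
  shows "great_circle p v t \<in> Sph" "great_circle' p v t \<in> tspace (great_circle p v t)"
    "(great_circle p v has_vector_derivative great_circle' p v t) (at t)"
    "(great_circle' p v has_vector_derivative - great_circle p v t) (at t)"
proof -
  have pp: "p \<bullet> p = 1" "v \<bullet> v = 1" "p \<bullet> v = 0" "v \<bullet> p = 0"
    using Sph_inner[OF p] v by (auto simp: dot_square_norm tspace_iff inner_commute)
  have "great_circle p v t \<bullet> great_circle p v t = (sin t)\<^sup>2 + (cos t)\<^sup>2"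
    unfolding sin_cos_squared_add using pp sin_cos_squared_add[of t]
      by (simp add: great_circle_def inner_add_left inner_add_right power2_eq_square)
  then show "great_circle p v t \<in> Sph" by (simp add: norm_eq_1)
  show "great_circle' p v t \<in> tspace (great_circle p v t)"
    using pp by (simp add: great_circle_def great_circle'_def tspace_iff inner_add_left inner_add_right
      inner_diff_right)
  show "(great_circle p v has_vector_derivative great_circle' p v t) (at t)"
    unfolding great_circle_def[abs_def] great_circle'_def
    by (rule derivative_eq_intros refl | simp)+
  show "(great_circle' p v has_vector_derivative - great_circle p v t) (at t)"
    unfolding great_circle_def great_circle'_def[abs_def]
    by (rule derivative_eq_intros refl | simp)+
qed

context sphere_metric begin

text \<open>The function \<open>F\<close> with \<open>dV\<^sub>g = F powr ((n + 1) / 4) dV\<close>, since \<open>CARD('m) = n + 1\<close>.\<close>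

abbreviation density :: "real ^ 'm \<Rightarrow> real" where "density \<equiv> vol_density g (real CARD('m) / 4)"

lemma density_facts:
  shows "p \<in> Sph \<Longrightarrow> density p > 0" "smooth_on_sphere density"
proof -
  show "p \<in> Sph \<Longrightarrow> density p > 0"
    using gmat_det_pos[of p] by (simp add: vol_density_def)
  have "smooth_on_sphere (\<lambda>p. det (gmat g p) powr (1 / (2 * (real CARD('m) / 4))))"
    by (rule sph_powr[OF gmat_det_pos sph_det[OF gmat_smooth]])
  then show "smooth_on_sphere density"
    by (rule sph_cong[rotated]) (simp add: vol_density_def)
qed

lemma sderiv_density:
  assumes p: "p \<in> Sph"
  shows "sderiv density p v = density p * (2 / real CARD('m) * (sderiv (\<lambda>q. det (gmat g q)) p v / det
    (gmat g p)))"
proof -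
  let ?a = "1 / (2 * (real CARD('m) / 4))" and ?d = "\<lambda>q. det (gmat g q)"
  note sm = sph_det[OF gmat_smooth]
  have pos: "det (gmat g (sgn p)) > 0" using gmat_det_pos[OF p] by (simp add: sgn_Sph[OF p])
  have "((\<lambda>t. t powr ?a) has_derivative (\<lambda>h. (?a * ?d (sgn p) powr (?a - 1)) * h)) (at (?d (sgn p)))"
    using has_real_derivative_powr[OF pos, of ?a] unfolding has_field_derivative_def .
  from has_derivative_compose[OF has_sderiv[OF sm p] this]
  have "sderiv (\<lambda>q. ?d q powr ?a) p v = ?a * ?d (sgn p) powr (?a - 1) * sderiv ?d p v"
    by (rule sderivI)
  moreover have "sderiv density p v = sderiv (\<lambda>q. ?d q powr ?a) p v"
    by (rule sderiv_cong[OF _ sph_powr[OF gmat_det_pos sm] p]) (simp_all add: vol_density_def)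
  moreover have "?d p powr (?a - 1) = density p / ?d p"
    using gmat_det_pos[OF p] p by (simp add: vol_density_def powr_diff)
  ultimately show ?thesis by (simp add: sgn_Sph[OF p] mult.assoc mult.commute[of "det (gmat g p)"])
qed

text \<open>The acceleration of the great circle is normal to the sphere, so only the metric itself is
  differentiated; the subtracted term comes from the logarithmic derivative of \<open>density\<close>.\<close>

lemma great_circle_derivative:
  assumes p: "p \<in> Sph" and v: "v \<in> tspace p" "norm v = 1"
  defines "c \<equiv> great_circle p v" and "c' \<equiv> great_circle' p v"
  shows "((\<lambda>t. g (c t) (c' t) (c' t) / density (c t)) has_real_derivative
    (dg g (c t) (c' t) (c' t) (c' t) - 2 / real CARD('m) *
      (sderiv (\<lambda>q. det (gmat g q)) (c t) (c' t) / det (gmat g (c t))) * g (c t) (c' t) (c' t)) / density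
        (c t)) (at t)"
proof -
  note C = great_circle_facts[OF p v, folded c_def c'_def]
  let ?G = "gmat g (c t)"
  have G: "((\<lambda>t. gmat g (c t)) has_vector_derivative dmat g (c t) (c' t)) (at t)"
    unfolding dmat_def by (rule sderiv_along_curve[OF gmat_smooth C(1,3)])
  have Gc: "((\<lambda>t. gmat g (c t) *v c' t) has_vector_derivative
      (?G *v (- c t) + dmat g (c t) (c' t) *v c' t)) (at t)"
    by (rule bounded_bilinear.has_vector_derivative[OF bounded_bilinear_matrix_vector_mult G C(4)])
  have "((\<lambda>t. c' t \<bullet> (gmat g (c t) *v c' t)) has_vector_derivative
      (c' t \<bullet> (?G *v (- c t) + dmat g (c t) (c' t) *v c' t) + (- c t) \<bullet> (?G *v c' t))) (at t)"
    by (rule bounded_bilinear.has_vector_derivative[OF bounded_bilinear_inner C(4) Gc])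
  moreover have "?G *v (- c t) = - c t"
    using gmat_point[OF C(1)] linear_neg[OF matrix_vector_mul_linear[of ?G], of "c t"] by simp
  moreover have "c t \<bullet> c' t = 0" "c t \<bullet> (?G *v c' t) = 0"
    using C(2) gmat_tspace[OF C(1,2)] by (auto simp: tspace_iff)
  ultimately have 1: "((\<lambda>t. g (c t) (c' t) (c' t)) has_real_derivative dg g (c t) (c' t) (c' t) (c' t))
    (at t)"
    by (simp add: gmat_inner[OF C(1,2,2)] dg_def inner_add_right inner_diff_right inner_commute[of _ "c t"]
        has_real_derivative_iff_has_vector_derivative)
  have 2: "((\<lambda>t. density (c t)) has_real_derivative sderiv density (c t) (c' t)) (at t)"
    using sderiv_along_curve[OF density_facts(2) C(1,3)]
      by (simp add: has_real_derivative_iff_has_vector_derivative)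
  have nz: "density (c t) \<noteq> 0" using density_facts(1)[OF C(1)[of t]] by simp
  have "((\<lambda>t. g (c t) (c' t) (c' t) / density (c t)) has_real_derivative
     (dg g (c t) (c' t) (c' t) (c' t) * density (c t) - g (c t) (c' t) (c' t) * sderiv density (c t) (c'
       t)) / (density (c t) * density (c t))) (at t)"
    by (rule DERIV_divide[OF 1 2 nz])
  then show ?thesis
    by (rule DERIV_cong) (use nz in \<open>simp add: sderiv_density[OF C(1)] divide_simps, simp add:
      algebra_simps\<close>)
qed

lemma equators_minimal_iff_great_circle_invariant:
  "(\<forall>M\<in>equators. minimal_hypersurface g M) \<longleftrightarrow> great_circle_invariant (\<lambda>p v w. g p v w / density p)"
  (is "_ \<longleftrightarrow> ?R")
proof -
  let ?S = "\<lambda>p v. 2 / real CARD('m) * (sderiv (\<lambda>q. det (gmat g q)) p v / det (gmat g p)) * g p v v"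
  have "(\<forall>p\<in>Sph. \<forall>v\<in>tspace p. dg g p v v v = ?S p v) \<longleftrightarrow> ?R"
  proof
    assume L: "\<forall>p\<in>Sph. \<forall>v\<in>tspace p. dg g p v v v = ?S p v"
    show ?R unfolding great_circle_invariant_def
    proof (intro ballI allI impI)
      fix p v t assume p: "p \<in> (Sph :: (real^'m) set)" and v: "v \<in> tspace p" "norm v = 1"
      note C = great_circle_facts[OF p v]
      let ?q = "\<lambda>t. g (great_circle p v t) (great_circle' p v t) (great_circle' p v t) / density
        (great_circle p v t)"
      have "(?q has_real_derivative 0) (at t)" for t
        using great_circle_derivative[OF p v, of t] L C(1)[of t] C(2)[of t] by auto
      then have "?q t = ?q 0" using DERIV_isconst_all by blast
      then show "?q t = g p v v / density p" by (simp add: great_circle_def great_circle'_def)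
    qed
  next
    assume R: ?R
    show "\<forall>p\<in>Sph. \<forall>v\<in>tspace p. dg g p v v v = ?S p v"
    proof (intro ballI)
      fix p v assume p: "p \<in> (Sph :: (real^'m) set)" and v: "v \<in> tspace p"
      show "dg g p v v v = ?S p v"
      proof (cases "v = 0")
        case True
        then show ?thesis using dg_scale(1)[OF p, of 0 v] by (simp add: g_zero)
      next
        case False
        define r where "r = norm v"
        have r: "r > 0" "v = r *\<^sub>R sgn v" using False by (auto simp: r_def sgn_div_norm)
        have s: "sgn v \<in> tspace p" "norm (sgn v) = 1"
          using False v by (auto simp: norm_sgn) (simp add: sgn_div_norm tspace_scale)
        let ?q = "\<lambda>t. g (great_circle p (sgn v) t) (great_circle' p (sgn v) t) (great_circle' p (sgn v)
          t) / density (great_circle p (sgn v) t)"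
        have "?q = (\<lambda>t. g p (sgn v) (sgn v) / density p)"
          using R p s unfolding great_circle_invariant_def by blast
        then have "(?q has_real_derivative 0) (at 0)" by simp
        from DERIV_unique[OF this great_circle_derivative[OF p s, of 0]]
        have "dg g p (sgn v) (sgn v) (sgn v) = ?S p (sgn v)"
          using density_facts(1)[OF p] by (simp add: great_circle_def great_circle'_def)
        then show ?thesis
          using linear_scale[OF linear_sderiv[OF sph_det[OF gmat_smooth] p], of r "sgn v"]
          by (subst (1 2 3) r(2), subst r(2), subst (1 2) r(2))
            (simp add: dg_scale[OF p] g_linear[OF p s(1) s(1)])
      qed
    qed
  qed
  then show ?thesis unfolding equators_minimal_iff .
qed

end

section \<open>Algebraic curvature tensors\<close>

lemma curvature_tensorD:
  assumes "algebraic_curvature_tensor R"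
  shows "linear (\<lambda>x. R x y z w)" "linear (\<lambda>y. R x y z w)" "linear (\<lambda>z. R x y z w)" "linear (\<lambda>w. R x y z w)"
    "R x y z w = - R y x z w" "R x y z w = - R x y w z" "R x y z w = R z w x y"
    "R x y z w + R x z w y + R x w y z = 0"
  using assms unfolding algebraic_curvature_tensor_def by (elim conjE; iprover)+

lemma curvature_tensor_add:
  assumes "algebraic_curvature_tensor R"
  shows "R (x + x') y z w = R x y z w + R x' y z w" "R x (y + y') z w = R x y z w + R x y' z w"
    "R x y (z + z') w = R x y z w + R x y z' w" "R x y z (w + w') = R x y z w + R x y z w'"
    "R (c *\<^sub>R x) y z w = c * R x y z w" "R x (c *\<^sub>R y) z w = c * R x y z w"
    "R x y (c *\<^sub>R z) w = c * R x y z w" "R x y z (c *\<^sub>R w) = c * R x y z w"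
  using curvature_tensorD(1-4)[OF assms] by (simp_all add: linear_iff)

lemma curvature_tensor_same:
  assumes "algebraic_curvature_tensor R"
  shows "R x x z w = 0" "R x y z z = 0"
  using curvature_tensorD(5)[OF assms, of x x z w] curvature_tensorD(6)[OF assms, of x y z z] by auto

lemma curvature_tensor_diff:
  assumes "algebraic_curvature_tensor R" "algebraic_curvature_tensor S"
  shows "algebraic_curvature_tensor (\<lambda>x y z w. R x y z w - S x y z w)"
proof -
  note R = curvature_tensorD[OF assms(1)] and S = curvature_tensorD[OF assms(2)]
  show ?thesis unfolding algebraic_curvature_tensor_def
  proof (intro conjI allI)
    fix x y z w
    show "linear (\<lambda>x. R x y z w - S x y z w)" "linear (\<lambda>y. R x y z w - S x y z w)"
      "linear (\<lambda>z. R x y z w - S x y z w)" "linear (\<lambda>w. R x y z w - S x y z w)"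
      by (intro linear_compose_sub R S)+
    show "R x y z w - S x y z w = - (R y x z w - S y x z w)" 
      using R(5)[of x y z w] S(5)[of x y z w] by linarith
    show "R x y z w - S x y z w = - (R x y w z - S x y w z)" 
      using R(6)[of x y z w] S(6)[of x y z w] by linarith
    show "R x y z w - S x y z w = R z w x y - S z w x y" 
      using R(7)[of x y z w] S(7)[of x y z w] by linarith
    show "R x y z w - S x y z w + (R x z w y - S x z w y) + (R x w y z - S x w y z) = 0" 
      using R(8)[of x y z w] S(8)[of x y z w] by linarith
  qed
qed

text \<open>Polarising the hypothesis makes \<open>D\<close> skew under exchange of the first and third arguments, hence
  totally skew; the Bianchi identity then reads \<open>3 * D x y z w = 0\<close>.\<close>

lemma curvature_tensor_zero:
  assumes D: "algebraic_curvature_tensor D" and z: "\<And>x y. D x y x y = 0"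
  shows "D x y z w = 0"
proof -
  note P = curvature_tensorD[OF D] and A = curvature_tensor_add[OF D]
  have 1: "D x y x w = 0" for x y w
    using z[of x "y + w"] z[of x y] z[of x w] P(7)[of x y x w] by (simp add: A)
  have 2: "D x y z w = - D z y x w" for x y z w
    using 1[of "x + z" y w] 1[of x y w] 1[of z y w] by (simp add: A)
  have 3: "D x y z w = - D x z y w" for x y z w
    using P(5)[of x y z w] 2[of y x z w] P(5)[of z x y w] by linarith
  have "D x z w y = D x y z w" using P(6)[of x z w y] 3[of x z y w] by linarith
  moreover have "D x w y z = D x y z w" using 3[of x w y z] P(6)[of x y w z] by linarith
  ultimately show ?thesis using P(8)[of x y z w] by linarith
qed

text \<open>The values on orthogonal pairs determine those on all pairs, because \<open>R x y x y\<close> depends only on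
  the component of \<open>y\<close> orthogonal to \<open>x\<close>.\<close>

lemma curvature_tensor_eqI:
  assumes R: "algebraic_curvature_tensor R" and S: "algebraic_curvature_tensor S"
    and eq: "\<And>p v. p \<in> Sph \<Longrightarrow> v \<in> tspace p \<Longrightarrow> R p v p v = S p v p v"
  shows "R = S"
proof -
  have D: "algebraic_curvature_tensor (\<lambda>x y z w. R x y z w - S x y z w)"
    by (rule curvature_tensor_diff[OF R S])
  have "R x y x y = S x y x y" for x y
  proof (cases "x = 0")
    case True
    then show ?thesis using curvature_tensor_add(5)[OF R, of 0] curvature_tensor_add(5)[OF S, of 0] by simp
  next
    case False
    let ?p = "sgn x"
    have p: "?p \<in> Sph" by (rule sgn_in_Sph[OF False])
    have x: "x = norm x *\<^sub>R ?p" using False by (simp add: sgn_div_norm)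
    have y: "y = tproj ?p y + (?p \<bullet> y) *\<^sub>R ?p" by (simp add: tproj_def)
    have "T x y x y = (norm x)\<^sup>2 * T ?p (tproj ?p y) ?p (tproj ?p y)"
      if T: "algebraic_curvature_tensor T" for T
    proof -
      have "T x y x y = (norm x)\<^sup>2 * T ?p y ?p y"
        by (subst (1 2) x) (simp add: curvature_tensor_add(5,7)[OF T] power2_eq_square)
      also have "T ?p y ?p y = T ?p (tproj ?p y) ?p (tproj ?p y)"
        by (subst (1 2) y) (simp add: curvature_tensor_add[OF T] curvature_tensor_same[OF T])
      finally show ?thesis .
    qed
    from this[OF R] this[OF S] show ?thesis using eq[OF p tproj_tspace[OF p]] by simp
  qed
  then have "R x y z w - S x y z w = 0" for x y z w
    using curvature_tensor_zero[OF D] by simp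
  then show ?thesis by (simp add: fun_eq_iff)
qed

text \<open>Polarising in both variables gives a form \<open>B x z y w\<close>, symmetric in \<open>x\<close>, \<open>z\<close> and in \<open>y\<close>, \<open>w\<close> and
  under exchange of the two pairs. The tensor \<open>2 / 3 * (B x z y w - B y z x w)\<close> then has the
  symmetries of a curvature tensor. The factor \<open>2 / 3\<close> comes from \<open>2 * B x y x y = - B x x y y\<close>,
  which is the second polarisation of the vanishing of \<open>B x x x w\<close>.\<close>

lemma curvature_tensor_of_biquadratic:
  fixes \<beta> :: "real ^ 'm::finite \<Rightarrow> real ^ 'm \<Rightarrow> real ^ 'm \<Rightarrow> real"
  assumes lin: "\<And>x w. linear (\<lambda>y. \<beta> x y w)" and sym: "\<And>x y w. \<beta> x y w = \<beta> x w y"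
    and swap: "\<And>x y. \<beta> x y y = \<beta> y x x" and van: "\<And>x w. \<beta> x x w = 0"
  shows "\<exists>R. algebraic_curvature_tensor R \<and> (\<forall>x y. R x y x y = \<beta> x y y)"
proof -
  have add: "\<beta> x (y + y') w = \<beta> x y w + \<beta> x y' w" "\<beta> x w (y + y') = \<beta> x w y + \<beta> x w y'" 
    and scale: "\<beta> x (c *\<^sub>R y) w = c * \<beta> x y w" "\<beta> x w (c *\<^sub>R y) = c * \<beta> x w y" for x y y' w c
    using lin[of x w] sym[of x w] by (simp_all add: linear_iff)
  define B where "B x z y w = (\<beta> (y + w) x z - \<beta> y x z - \<beta> w x z) / 2" for x z y w
  have Bx: "B x x y w = \<beta> x y w" for x y w
    using sym[of x w y] by (simp add: B_def swap[of _ x] add)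
  have Badd: "B (x + x') z y w = B x z y w + B x' z y w" "B (c *\<^sub>R x) z y w = c * B x z y w"
    for x x' z y w c
    by (simp_all add: B_def add scale field_simps)
  have Bsym: "B x z y w = B z x y w" "B x z y w = B x z w y" for x z y w
    by (simp_all add: B_def sym[of _ x z] add.commute)
  have Bpair: "B x z y w = B y w x z" for x y z w
  proof -
    have "B (x + z) (x + z) y w = B x x y w + 2 * B x z y w + B z z y w"
      using Bsym(1)[of x "x + z" y w] Bsym(1)[of z "x + z" y w] Bsym(1)[of z x y w] by (simp add: Badd)
    then show ?thesis unfolding Bx by (simp add: B_def[of y w x z])
  qed
  have key: "2 * B x y x y = - B x x y y" for x y
  proof -
    have cub: "B z z z y = 0" for z using Bx van by simp
    have ex: "B (x + c *\<^sub>R y) (x + c *\<^sub>R y) (x + c *\<^sub>R y) y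
       = B x x x y + c * (2 * B x y x y + B x x y y) + c * c * (2 * B x y y y + B y y x y) + c * c * c *
         B y y y y" for c
    proof -
      have e: "B (x + c *\<^sub>R y) (x + c *\<^sub>R y) u y = B x x u y + 2 * c * B x y u y + c * c * B y y u y" for u
        using Bsym(1)[of x "x + c *\<^sub>R y" u y] Bsym(1)[of y "x + c *\<^sub>R y" u y] Bsym(1)[of y x u y]
        by (simp add: Badd algebra_simps)
      have f: "B a b (x + c *\<^sub>R y) y = B a b x y + c * B a b y y" for a b
        using Bpair[of a b "x + c *\<^sub>R y" y] Bpair[of a b x y] Bpair[of a b y y] by (simp add: Badd)
      show ?thesis by (simp add: e f algebra_simps)
    qed
    \<comment> \<open>Comparing \<open>c = 1\<close> with \<open>c = -1\<close> isolates the odd part in \<open>c\<close>, whose cubic term is zero.\<close>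
    show ?thesis using ex[of 1] ex[of "-1"] cub[of x] cub[of y] cub[of "x + 1 *\<^sub>R y"]
      cub[of "x + (-1) *\<^sub>R y"] by simp
  qed
  define R where "R x y z w = 2 / 3 * (B x z y w - B y z x w)" for x y z w
  have anti: "R x y z w = - R y x z w" "R x y z w = - R x y w z" for x y z w
    using Bpair[of x z y w] Bpair[of y z x w] by (simp_all add: R_def field_simps)
  have pair: "R x y z w = R z w x y" for x y z w
    using Bsym(1)[of z x w y] Bsym(2)[of x z w y] Bsym(1)[of w x z y] Bsym(2)[of x w z y] Bpair[of y z x w]
    by (simp add: R_def)
  have bianchi: "R x y z w + R x z w y + R x w y z = 0" for x y z w
    using Bpair[of w y x z] Bsym(2)[of x z w y] Bpair[of x w z y] Bsym(1)[of z y x w]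
      Bpair[of x y w z] Bsym(1)[of w z x y] by (simp add: R_def field_simps)
  have lx: "linear (\<lambda>x. R x y z w)" for y z w
    by (rule linearI) (simp_all add: R_def Bpair[of y z _ w] Badd algebra_simps)
  have "linear (\<lambda>y. R x y z w)" for x z w
    using linear_compose_neg[OF lx[of x z w]] by (simp add: anti(1)[of x _ z w])
  moreover have "linear (\<lambda>z. R x y z w)" for x y w
    using lx[of w x y] by (simp add: pair[of x y _ w])
  moreover have "linear (\<lambda>w. R x y z w)" for x y z
    using linear_compose_neg[OF lx[of z x y]] by (simp add: pair[of x y z] anti(1)[of z _ x y])
  ultimately have "algebraic_curvature_tensor R"
    unfolding algebraic_curvature_tensor_def using lx anti pair bianchi by blast
  moreover have "R x y x y = \<beta> x y y" for x y
    using key[of x y] Bsym(1)[of y x x y] Bx[of x y y] by (simp add: R_def)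
  ultimately show ?thesis by blast
qed

section \<open>Rescaling a metric by its volume density\<close>

lemma sph_reciprocal:
  assumes "\<And>p. p \<in> Sph \<Longrightarrow> f p > 0" "smooth_on_sphere f"
  shows "smooth_on_sphere (\<lambda>p. 1 / f p :: real)"
  by (rule sph_cong[OF _ sph_powr[OF assms, where a = "-1"]])
    (use assms(1) in \<open>simp_all add: powr_minus_divide less_imp_le del: mem_sphere_0\<close>)

lemma riemannian_metric_rescale:
  assumes h: "riemannian_metric h" and \<phi>: "\<And>p. p \<in> Sph \<Longrightarrow> \<phi> p > 0" "smooth_on_sphere \<phi>"
  shows "riemannian_metric (\<lambda>p v w. \<phi> p * h p v w)"
proof -
  interpret sphere_metric h by unfold_locales (rule h)
  show ?thesis unfolding riemannian_metric_def
  proof (intro conjI allI ballI impI)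
    fix p :: "real ^ 'a" and v w assume "\<not> (p \<in> Sph \<and> v \<in> tspace p \<and> w \<in> tspace p)"
    then show "\<phi> p * h p v w = 0" using g_off by simp
  next
    fix p u v w :: "real ^ 'a" and a b assume "p \<in> Sph" "u \<in> tspace p" "v \<in> tspace p" "w \<in> tspace p"
    then show "\<phi> p * h p (a *\<^sub>R u + b *\<^sub>R v) w = a * (\<phi> p * h p u w) + b * (\<phi> p * h p v w)"
      using g_comb by (simp add: algebra_simps del: mem_sphere_0)
  next
    fix p v w show "\<phi> p * h p v w = \<phi> p * h p w v" using g_sym[of p v w] by simp
  next
    fix p v :: "real ^ 'a" assume "p \<in> Sph" "v \<in> tspace p" "v \<noteq> 0"
    then show "0 < \<phi> p * h p v v" using g_pos \<phi>(1) by simp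
  next
    fix X Y :: "'a vector_field" assume "X \<in> vector_fields" "Y \<in> vector_fields"
    then show "smooth_on_sphere (\<lambda>p. \<phi> p * h p (X p) (Y p))"
      by (intro sph_mult \<phi>(2) g_smooth)
  qed
qed

lemma det_nat_scale: "det_nat n (\<lambda>i j. c * A i j) = c ^ n * det_nat n A"
  by (simp add: det_nat_def prod.distrib sum_distrib_left mult.left_commute)

text \<open>Both constructions divide a metric \<open>h\<close> by the function \<open>f\<close> that represents its volume element
  with exponent \<open>s\<close>. The volume element scales by \<open>f powr (- n / 2)\<close>, so the exponent changes to
  \<open>n / 2 - s\<close>; this exchanges \<open>(n - 1) / 4\<close> and \<open>(n + 1) / 4\<close>.\<close>

lemma volume_factor_rescale:
  fixes h :: "('m::finite) tensor2"
  assumes n: "CARD('m) = Suc n" and f: "volume_factor s h f"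
  shows "volume_factor (real n / 2 - s) (\<lambda>p v w. 1 / f p * h p v w) (\<lambda>p. 1 / f p)"
proof -
  have pos: "f p > 0" if "p \<in> Sph" for p using f that unfolding volume_factor_def by blast
  have sm: "smooth_on_sphere f" and off: "p \<notin> Sph \<Longrightarrow> f p = 0" for p
    using f unfolding volume_factor_def scalar_fields_def by blast+
  have "volume_element (\<lambda>p v w. 1 / f p * h p v w) p v
      = (1 / f p) powr (real n / 2 - s) * volume_element round_metric p v"
    if p: "p \<in> Sph" and v: "\<forall>i<CARD('m) - 1. v i \<in> tspace p" for p v
  proof -
    define c where "c = 1 / f p"
    have c: "c > 0" "f p = inverse c" using pos[OF p] by (auto simp: c_def field_simps)
    have "sqrt (c ^ n) = (c powr real n) powr (1 / 2)" using c by (simp add: powr_half_sqrt powr_realpow)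
    then have "sqrt (c ^ n) = c powr (real n / 2)" by (simp add: powr_powr)
    then have "volume_element (\<lambda>p v w. 1 / f p * h p v w) p v = c powr (real n / 2) * volume_element h p v"
      unfolding volume_element_def det_nat_scale by (simp add: n real_sqrt_mult c_def)
    also have "volume_element h p v = f p powr s * volume_element round_metric p v"
      using f p v unfolding volume_factor_def by blast
    also have "f p powr s = c powr (- s)" using c by (simp add: inverse_powr powr_minus)
    finally show ?thesis using powr_add[of c "real n / 2" "- s"] by (simp add: c_def)
  qed
  moreover have "(\<lambda>p. 1 / f p) \<in> scalar_fields"
    using sph_reciprocal[OF pos sm] off by (simp add: scalar_fields_def)
  ultimately show ?thesis using pos unfolding volume_factor_def by simp
qed

section \<open>Killing tensors and curvature tensors\<close>

context sphere_metric begin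

text \<open>Let \<open>v\<close> be the direction of the part of \<open>y\<close> orthogonal to \<open>x = norm x *\<^sub>R p\<close>. Then \<open>\<beta> x y y\<close> is
  the squared area of the parallelogram of \<open>x\<close> and \<open>y\<close> times \<open>g p v v\<close>. Exchanging \<open>x\<close> and \<open>y\<close>
  keeps the area and replaces \<open>p\<close>, \<open>v\<close> by another point and velocity (up to sign) of the same
  great circle.\<close>

lemma great_circle_invariant_swap:
  assumes inv: "great_circle_invariant g"
  defines "\<beta> \<equiv> \<lambda>x y w. (norm x)\<^sup>2 * g (sgn x) (tproj (sgn x) y) (tproj (sgn x) w)"
  shows "\<beta> x y y = \<beta> y x x"
proof -
  show ?thesis
  proof (cases "x = 0 \<or> y = 0")
    case True
    then show ?thesis by (auto simp: \<beta>_def tproj_def g_zero)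
  next
    case False
    then have nz: "x \<noteq> 0" "y \<noteq> 0" by auto
    define p where "p = sgn x"
    define w where "w = tproj p y"
    have p: "p \<in> Sph" unfolding p_def using sgn_in_Sph nz by blast
    have x: "x = norm x *\<^sub>R p" using nz by (simp add: p_def sgn_div_norm)
    have y: "y = (p \<bullet> y) *\<^sub>R p + w" by (simp add: w_def tproj_def)
    have wT: "w \<in> tspace p" unfolding w_def by (rule tproj_tspace[OF p])
    show ?thesis
    proof (cases "w = 0")
      case True
      then obtain a where ya: "y = a *\<^sub>R p" using y by auto
      then have a: "a \<noteq> 0" using nz by auto
      have "sgn y = sgn a *\<^sub>R p" using ya sgn_Sph[OF p] by (simp add: sgn_scaleR)
      moreover have "tproj (sgn a *\<^sub>R p) (norm x *\<^sub>R p) = 0"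
        using a Sph_inner[OF p] by (simp add: tproj_def sgn_if)
      ultimately have "tproj (sgn y) x = 0" using x by metis
      then show ?thesis using True by (simp add: \<beta>_def p_def[symmetric] w_def[symmetric] g_zero)
    next
      case False
      define v where "v = sgn w"
      have w: "w = norm w *\<^sub>R v" and v1: "norm v = 1" using False
        by (auto simp: v_def sgn_div_norm norm_sgn)
      have vT: "v \<in> tspace p" using wT by (simp add: v_def sgn_div_norm tspace_scale)
      have pv: "p \<bullet> p = 1" "v \<bullet> v = 1" "p \<bullet> v = 0" "v \<bullet> p = 0"
        using Sph_inner[OF p] v1 vT by (auto simp: tspace_iff inner_commute dot_square_norm)
      \<comment> \<open>With \<open>t\<close> the angle between \<open>x\<close> and \<open>y\<close>, the direction of \<open>y\<close> is \<open>great_circle p v t\<close>.\<close>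
      define N where "N = norm y"
      have N: "N > 0" using nz by (simp add: N_def)
      have "y \<bullet> y = (p \<bullet> y)\<^sup>2 + (norm w)\<^sup>2"
      proof -
        have yy: "y = (p \<bullet> y) *\<^sub>R p + norm w *\<^sub>R v" using y w by simp
        have "y \<bullet> y = ((p \<bullet> y) *\<^sub>R p + norm w *\<^sub>R v) \<bullet> ((p \<bullet> y) *\<^sub>R p + norm w *\<^sub>R v)"
          using yy by metis
        then show ?thesis by (simp add: inner_add_left inner_add_right pv power2_eq_square)
      qed
      then have N2: "(p \<bullet> y)\<^sup>2 + (norm w)\<^sup>2 = N\<^sup>2" by (simp add: N_def dot_square_norm)
      have "(p \<bullet> y / N)\<^sup>2 + (norm w / N)\<^sup>2 = ((p \<bullet> y)\<^sup>2 + (norm w)\<^sup>2) / N\<^sup>2"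
        by (simp add: power_divide add_divide_distrib)
      then have "(p \<bullet> y / N)\<^sup>2 + (norm w / N)\<^sup>2 = 1" using N unfolding N2 by simp
      then obtain t where t: "p \<bullet> y / N = cos t" "norm w / N = sin t"
        using sincos_total_2pi by metis
      have pw: "p \<bullet> y = N * cos t" "norm w = N * sin t" using t N by (auto simp: field_simps)
      have yc: "y = N *\<^sub>R great_circle p v t"
        using y w pw by (simp add: great_circle_def scaleR_add_right)
      note C = great_circle_facts[OF p vT v1, of t]
      have sy: "sgn y = great_circle p v t"
        using yc N C(1) by (simp add: sgn_div_norm)
      have "tproj (great_circle p v t) x = norm x *\<^sub>R tproj (great_circle p v t) p"
        using x tproj_scale by metis
      also have "tproj (great_circle p v t) p = (- sin t) *\<^sub>R great_circle' p v t"
      proof -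
        have "great_circle p v t \<bullet> p = cos t" by (simp add: great_circle_def inner_add_left pv)
        then have "tproj (great_circle p v t) p = (1 - cos t * cos t) *\<^sub>R p - (cos t * sin t) *\<^sub>R v"
          by (simp add: tproj_def great_circle_def algebra_simps)
        also have "1 - cos t * cos t = sin t * sin t" using sin_cos_squared_add[of t]
          by (simp add: power2_eq_square)
        finally show ?thesis by (simp add: great_circle'_def algebra_simps)
      qed
      finally have tx: "tproj (sgn y) x = (- (norm x * sin t)) *\<^sub>R great_circle' p v t" by (simp add: sy)
      have "\<beta> y x x = N\<^sup>2 * ((norm x * sin t) * ((norm x * sin t) * g (great_circle p v t)
        (great_circle' p v t) (great_circle' p v t)))"
        unfolding \<beta>_def tx unfolding sy
        using g_linear(2,4)[OF C(1,2,2)] by (simp add: N_def del: scaleR_minus_left)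
      also have "g (great_circle p v t) (great_circle' p v t) (great_circle' p v t) = g p v v"
        using inv p vT v1 unfolding great_circle_invariant_def by blast
      also have "N\<^sup>2 * ((norm x * sin t) * ((norm x * sin t) * g p v v))
        = (norm x)\<^sup>2 * (norm w * (norm w * g p v v))"
        by (simp add: pw power2_eq_square)
      also have "norm w * (norm w * g p v v) = g p w w"
        by (subst (3 4) w) (simp add: g_linear(2,4)[OF p vT vT])
      finally show ?thesis by (simp add: \<beta>_def p_def[symmetric] w_def[symmetric])
    qed
  qed
qed

lemma curvature_tensor_of_invariant:
  assumes inv: "great_circle_invariant g"
  shows "\<exists>R. algebraic_curvature_tensor R \<and> (\<forall>p\<in>Sph. \<forall>v\<in>tspace p. R p v p v = g p v v)"
proof -
  define \<beta> where "\<beta> x y w = (norm x)\<^sup>2 * g (sgn x) (tproj (sgn x) y) (tproj (sgn x) w)" for x y w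
  have "linear (\<lambda>y. \<beta> x y w)" for x w
  proof (cases "x = 0")
    case True
    then show ?thesis by (simp add: \<beta>_def linear_zero)
  next
    case False
    then have s: "sgn x \<in> Sph" by (rule sgn_in_Sph)
    note T = tproj_tspace[OF s]
    show ?thesis
      by (rule linearI) (simp_all add: \<beta>_def tproj_add tproj_scale g_linear[OF s T T] algebra_simps)
  qed
  moreover have "\<beta> x y w = \<beta> x w y" for x y w
    using g_sym[of "sgn x" "tproj (sgn x) y"] by (simp add: \<beta>_def)
  moreover have "\<beta> x y y = \<beta> y x x" for x y
    using great_circle_invariant_swap[OF inv] by (simp add: \<beta>_def)
  moreover have "\<beta> x x w = 0" for x w
  proof (cases "x = 0")
    case False
    have "tproj (sgn x) (norm x *\<^sub>R sgn x) = 0"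
      using Sph_inner[OF sgn_in_Sph[OF False]] by (simp add: tproj_def)
    then have "tproj (sgn x) x = 0" using False by (simp add: sgn_div_norm)
    then show ?thesis by (simp add: \<beta>_def g_zero)
  qed (simp add: \<beta>_def)
  ultimately obtain R where R: "algebraic_curvature_tensor R" "\<And>x y. R x y x y = \<beta> x y y"
    using curvature_tensor_of_biquadratic[of \<beta>] by blast
  have "R p v p v = g p v v" if "p \<in> Sph" "v \<in> tspace p" for p v
    using that by (simp add: R(2) \<beta>_def sgn_Sph tproj_id)
  then show ?thesis using R(1) by blast
qed

end

text \<open>Moving along the great circle rotates the pair \<open>p\<close>, \<open>v\<close> in its plane, which leaves its bivector
  unchanged, and \<open>R\<close> depends only on the bivectors of its two pairs of arguments.\<close>

lemma curvature_tensor_great_circle: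
  assumes R: "algebraic_curvature_tensor R"
  shows "R (great_circle p v t) (great_circle' p v t) (great_circle p v t) (great_circle' p v t)
    = R p v p v"
proof -
  note A = curvature_tensor_add[OF R] and S = curvature_tensor_same[OF R] and D = curvature_tensorD[OF R]
  have cs: "cos t * cos t + sin t * sin t = 1" using sin_cos_squared_add2[of t]
    by (simp add: power2_eq_square)
  have 1: "R (great_circle p v t) (great_circle' p v t) z w = R p v z w" for z w
  proof -
    have "R (great_circle p v t) (great_circle' p v t) z w
        = (cos t * cos t) * R p v z w + (- sin t * sin t) * R v p z w"
      by (simp only: great_circle_def great_circle'_def A S) simp
    also have "\<dots> = (cos t * cos t + sin t * sin t) * R p v z w"
      unfolding D(5)[of v p z w] by algebra
    finally show ?thesis by (simp only: cs mult_1)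
  qed
  have "R p v (great_circle p v t) (great_circle' p v t)
    = R (great_circle p v t) (great_circle' p v t) p v" by (rule D(7))
  then show ?thesis using 1 by simp
qed

text \<open>Used to insert smooth maps into the slots of a multilinear map one after the other.\<close>

lemma sph_linear_argument:
  fixes T :: "real ^ 'm::finite \<Rightarrow> real ^ 'k::finite \<Rightarrow> real"
  assumes "\<And>p. linear (T p)" "\<And>i. smooth_on_sphere (\<lambda>p. T p (axis i 1))" "smooth_on_sphere X"
  shows "smooth_on_sphere (\<lambda>p. T p (X p))"
proof -
  have "T p (X p) = (\<Sum>i\<in>UNIV. X p $ i * T p (axis i 1))" for p
    using linear_functional_vec[OF assms(1), of p "X p"] by (simp add: inner_vec_def mult.commute)
  moreover have "smooth_on_sphere (\<lambda>p. \<Sum>i\<in>UNIV. X p $ i * T p (axis i 1))"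
    by (intro sph_sum sph_mult sph_vec_nth assms(2,3))
  ultimately show ?thesis by simp
qed

lemma curvature_tensor_pos:
  assumes R: "R \<in> Curv_plus" and p: "p \<in> Sph" and v: "v \<in> tspace p" "v \<noteq> 0"
  shows "R p v p v > 0"
proof -
  have cR: "algebraic_curvature_tensor R"
    and pR: "\<And>v w. norm v = 1 \<Longrightarrow> norm w = 1 \<Longrightarrow> v \<bullet> w = 0 \<Longrightarrow> R v w v w > 0"
    using R unfolding Curv_plus_def by auto
  have "R p (sgn v) p (sgn v) > 0"
    by (rule pR) (use p v in \<open>auto simp: norm_sgn tspace_iff sgn_div_norm\<close>)
  moreover have "v = norm v *\<^sub>R sgn v" using v(2) by (simp add: sgn_div_norm)
  then have "R p v p v = norm v * (norm v * R p (sgn v) p (sgn v))"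
    using curvature_tensor_add(6,8)[OF cR] by metis
  ultimately show ?thesis using v(2) by simp
qed

lemma k_of_curv_metric:
  fixes R :: "('m::finite) tensor4"
  assumes R: "R \<in> Curv_plus"
  shows "riemannian_metric (k_of_curv R)"
proof -
  have cR: "algebraic_curvature_tensor R" using R unfolding Curv_plus_def by blast
  note A = curvature_tensor_add[OF cR] and L = curvature_tensorD[OF cR]
  have k: "k_of_curv R p v w = R p v p w" if "p \<in> Sph" "v \<in> tspace p" "w \<in> tspace p" for p v w
    using that by (simp add: k_of_curv_def)
  show ?thesis unfolding riemannian_metric_def
  proof (intro conjI allI ballI impI)
    fix p v w :: "real ^ 'm" assume "\<not> (p \<in> Sph \<and> v \<in> tspace p \<and> w \<in> tspace p)"
    then show "k_of_curv R p v w = 0" unfolding k_of_curv_def by (rule if_not_P)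
  next
    fix p u v w :: "real ^ 'm" and a b assume "p \<in> Sph" "u \<in> tspace p" "v \<in> tspace p" "w \<in> tspace p"
    then show "k_of_curv R p (a *\<^sub>R u + b *\<^sub>R v) w = a * k_of_curv R p u w + b * k_of_curv R p v w"
      by (simp add: k A tspace_add tspace_scale del: mem_sphere_0)
  next
    fix p v w :: "real ^ 'm" assume "p \<in> Sph" "v \<in> tspace p" "w \<in> tspace p"
    then show "k_of_curv R p v w = k_of_curv R p w v"
      using L(7)[of p v p w] by (simp add: k)
  next
    fix p v :: "real ^ 'm" assume "p \<in> Sph" "v \<in> tspace p" "v \<noteq> 0"
    then show "0 < k_of_curv R p v v" using curvature_tensor_pos[OF R] by (simp add: k)
  next
    fix X Y :: "'m vector_field" assume X: "X \<in> vector_fields" and Y: "Y \<in> vector_fields"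
    note sX = vector_fieldsD[OF X] and sY = vector_fieldsD[OF Y]
    have 1: "smooth_on_sphere (\<lambda>p. R a b c (Y p))" for a b c
      by (rule sph_linear_argument[OF L(4) sph_const sY(1)])
    have 2: "smooth_on_sphere (\<lambda>p. R a b p (Y p))" for a b
      by (rule sph_linear_argument[OF L(3) 1 sph_ident])
    have 3: "smooth_on_sphere (\<lambda>p. R a (X p) p (Y p))" for a
      by (rule sph_linear_argument[OF L(2) 2 sX(1)])
    have "smooth_on_sphere (\<lambda>p. R p (X p) p (Y p))"
      by (rule sph_linear_argument[OF L(1) 3 sph_ident])
    then show "smooth_on_sphere (\<lambda>p. k_of_curv R p (X p) (Y p))"
      by (rule sph_cong[rotated]) (simp add: k sX(2) sY(2))
  qed
qed

lemma k_of_curv_invariant: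
  fixes R :: "('m::finite) tensor4"
  assumes R: "algebraic_curvature_tensor R"
  shows "great_circle_invariant (k_of_curv R)"
  unfolding great_circle_invariant_def
proof (intro ballI allI impI)
  fix p v :: "real ^ 'm" and t assume p: "p \<in> Sph" and v: "v \<in> tspace p" "norm v = 1"
  show "k_of_curv R (great_circle p v t) (great_circle' p v t) (great_circle' p v t) = k_of_curv R p v v"
    using great_circle_facts(1,2)[OF p v, of t] p v curvature_tensor_great_circle[OF R, of p v t]
    by (simp add: k_of_curv_def)
qed

section \<open>The correspondence\<close>

lemma exponents:
  assumes "CARD('m::finite) = Suc n"
  shows "real n / 2 - (real CARD('m) - 2) / 4 = real CARD('m) / 4"
    "real n / 2 - real CARD('m) / 4 = (real CARD('m) - 2) / 4"
  using assms by (simp_all add: field_simps)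

lemma density_of_metric:
  fixes g :: "('m::finite) tensor2"
  assumes n: "CARD('m) = Suc n" and g: "riemannian_metric g"
  shows "is_F g f \<longleftrightarrow> f = vol_density g (real CARD('m) / 4)"
    "F_of_metric g = vol_density g (real CARD('m) / 4)"
proof -
  interpret sphere_metric g by unfold_locales (rule g)
  show *: "is_F g f \<longleftrightarrow> f = vol_density g (real CARD('m) / 4)" for f
    unfolding is_F_def by (rule volume_factor_iff[OF n]) simp
  show "F_of_metric g = vol_density g (real CARD('m) / 4)" by (simp add: F_of_metric_def *)
qed

lemma density_of_curvature:
  fixes R :: "('m::finite) tensor4"
  assumes n: "CARD('m) = Suc n" "n \<ge> 2" and k: "riemannian_metric (k_of_curv R)"
  shows "is_D R f \<longleftrightarrow> f = D_of_curv R"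
proof -
  interpret sphere_metric "k_of_curv R" by unfold_locales (rule k)
  have "is_D R f \<longleftrightarrow> f = vol_density (k_of_curv R) ((real CARD('m) - 2) / 4)" for f
    unfolding is_D_def by (rule volume_factor_iff[OF n(1)]) (use n in simp)
  then show ?thesis by (simp add: D_of_curv_def)
qed

text \<open>Dividing \<open>k_of_curv R\<close> by its density \<open>D\<close> gives a metric with density \<open>1 / D\<close>, so dividing again
  returns \<open>k_of_curv R\<close>, whose invariance along great circles is the minimality of the equators.\<close>

lemma metric_of_curv_facts:
  fixes R :: "('m::finite) tensor4"
  assumes n: "CARD('m) = Suc n" "n \<ge> 2" and R: "R \<in> Curv_plus"
  shows "metric_of_curv R \<in> minimal_equator_metrics" "k_of_metric (metric_of_curv R) = k_of_curv R"
proof -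
  have cR: "algebraic_curvature_tensor R" using R unfolding Curv_plus_def by blast
  note k = k_of_curv_metric[OF R]
  let ?D = "D_of_curv R" and ?g = "metric_of_curv R"
  have g: "?g = (\<lambda>p v w. 1 / ?D p * k_of_curv R p v w)" by (simp add: fun_eq_iff metric_of_curv_def)
  have D: "volume_factor ((real CARD('m) - 2) / 4) (k_of_curv R) ?D"
    using density_of_curvature[OF n k, of ?D] by (simp add: is_D_def)
  then have Dpos: "\<And>p. p \<in> Sph \<Longrightarrow> ?D p > 0" and Dsm: "smooth_on_sphere ?D"
    unfolding volume_factor_def scalar_fields_def by blast+
  have mg: "riemannian_metric ?g"
    unfolding g by (rule riemannian_metric_rescale[OF k _ sph_reciprocal[OF Dpos Dsm]]) (use Dpos in simp)
  have "is_F ?g (\<lambda>p. 1 / ?D p)"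
    using volume_factor_rescale[OF n(1) D] unfolding is_F_def g exponents(1)[OF n(1)] .
  then have F: "vol_density ?g (real CARD('m) / 4) = (\<lambda>p. 1 / ?D p)" "F_of_metric ?g = (\<lambda>p. 1 / ?D p)"
    using density_of_metric[OF n(1) mg] by simp_all
  have kk: "?g p v w / (1 / ?D p) = k_of_curv R p v w" for p v w
    using Dpos[of p] by (cases "p \<in> Sph") (simp_all add: metric_of_curv_def k_of_curv_def)
  show "k_of_metric ?g = k_of_curv R"
  proof (intro ext)
    fix p v w
    have "k_of_metric ?g p v w = ?g p v w / (1 / ?D p)" by (simp add: k_of_metric_def F(2))
    then show "k_of_metric ?g p v w = k_of_curv R p v w" by (simp only: kk)
  qed
  interpret sphere_metric ?g by unfold_locales (rule mg)
  show "?g \<in> minimal_equator_metrics"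
    using equators_minimal_iff_great_circle_invariant k_of_curv_invariant[OF cR] mg
    unfolding F(1) kk by (simp add: minimal_equator_metrics_def)
qed

text \<open>The Killing tensor \<open>k_of_metric g\<close> has density \<open>1 / F\<close>, which is therefore the function \<open>D\<close> of
  its curvature tensor; dividing by it returns \<open>g\<close>.\<close>

lemma curv_of_metric_facts:
  fixes g :: "('m::finite) tensor2"
  assumes n: "CARD('m) = Suc n" "n \<ge> 2" and g: "g \<in> minimal_equator_metrics"
  shows "\<exists>!R. is_curv_of_metric g R" "curv_of_metric g \<in> Curv_plus" "metric_of_curv (curv_of_metric g) = g"
proof -
  have mg: "riemannian_metric g" and min: "\<forall>M\<in>equators. minimal_hypersurface g M"
    using g unfolding minimal_equator_metrics_def by blast+
  interpret g: sphere_metric g by unfold_locales (rule mg)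
  let ?F = "F_of_metric g"
  note F = density_of_metric(2)[OF n(1) mg]
  have k: "k_of_metric g = (\<lambda>p v w. 1 / ?F p * g p v w)" by (simp add: fun_eq_iff k_of_metric_def)
  have Fpos: "\<And>p. p \<in> Sph \<Longrightarrow> ?F p > 0" and Fsm: "smooth_on_sphere ?F"
    using g.density_facts unfolding F by blast+
  have mk: "riemannian_metric (k_of_metric g)"
    unfolding k by (rule riemannian_metric_rescale[OF mg _ sph_reciprocal[OF Fpos Fsm]]) (use Fpos in simp)
  interpret k: sphere_metric "k_of_metric g" by unfold_locales (rule mk)
  have "great_circle_invariant (k_of_metric g)"
    using g.equators_minimal_iff_great_circle_invariant min unfolding k F by simp
  then have ex: "\<exists>R. is_curv_of_metric g R"
    unfolding is_curv_of_metric_def by (rule k.curvature_tensor_of_invariant)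
  show ex1: "\<exists>!R. is_curv_of_metric g R"
  proof (rule ex_ex1I[OF ex])
    fix R S assume "is_curv_of_metric g R" "is_curv_of_metric g S"
    then show "R = S" unfolding is_curv_of_metric_def by (intro curvature_tensor_eqI) auto
  qed
  let ?R = "curv_of_metric g"
  have "is_curv_of_metric g ?R" unfolding curv_of_metric_def by (rule theI'[OF ex1])
  then have R: "algebraic_curvature_tensor ?R" 
    and Rk: "\<And>p v. p \<in> Sph \<Longrightarrow> v \<in> tspace p \<Longrightarrow> ?R p v p v = k_of_metric g p v v"
    unfolding is_curv_of_metric_def by blast+
  show Rp: "?R \<in> Curv_plus"
    unfolding Curv_plus_def
  proof (intro CollectI conjI allI impI R)
    fix v w :: "real ^ 'm" assume "norm v = 1 \<and> norm w = 1 \<and> v \<bullet> w = 0"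
    then have "v \<in> Sph" "w \<in> tspace v" "w \<noteq> 0" by (auto simp: tspace_iff)
    then show "0 < ?R v w v w" using Rk k.g_pos by simp
  qed
  have kR: "k_of_curv ?R = k_of_metric g"
  proof (intro ext)
    fix p v w
    show "k_of_curv ?R p v w = k_of_metric g p v w"
    proof (cases "p \<in> Sph \<and> v \<in> tspace p \<and> w \<in> tspace p")
      case True
      then have p: "p \<in> Sph" and v: "v \<in> tspace p" and w: "w \<in> tspace p" by auto
      \<comment> \<open>Polarisation: both sides are symmetric bilinear forms with the same diagonal.\<close>
      have "?R p (v + w) p (v + w) = k_of_metric g p (v + w) (v + w)"
        by (rule Rk[OF p tspace_add[OF v w]])
      then have "2 * ?R p v p w = 2 * k_of_metric g p v w"
        using Rk[OF p v] Rk[OF p w] curvature_tensorD(7)[OF R, of p w p v] k.g_sym[of p w v]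
        by (simp add: curvature_tensor_add[OF R] k.g_linear(1,3)[OF p v w])
      then show ?thesis using True by (simp add: k_of_curv_def)
    next
      case False
      then show ?thesis using k.g_off by (auto simp: k_of_curv_def)
    qed
  qed
  have "is_F g ?F" using density_of_metric[OF n(1) mg] by simp
  then have "volume_factor (real CARD('m) / 4) g ?F" by (simp add: is_F_def)
  from volume_factor_rescale[OF n(1) this]
  have "is_D ?R (\<lambda>p. 1 / ?F p)"
    unfolding is_D_def kR k exponents(2)[OF n(1)] .
  then have D: "D_of_curv ?R = (\<lambda>p. 1 / ?F p)"
    using density_of_curvature[OF n k_of_curv_metric[OF Rp]] by simp
  show "metric_of_curv ?R = g"
  proof (intro ext)
    fix p v w
    show "metric_of_curv ?R p v w = g p v w"
      using Fpos[of p] g.g_off[of p v w] unfolding metric_of_curv_def D kR k_of_metric_def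
      by (cases "p \<in> Sph") simp_all
  qed
qed

theorem theorem2p9:
  fixes n :: nat
  assumes "n \<ge> 2" and "CARD('m::finite) = n + 1"
  shows
    "(\<forall>R\<in>(Curv_plus :: 'm tensor4 set).
        riemannian_metric (k_of_curv R) \<and> (\<exists>!D. is_D R D) \<and>
        metric_of_curv R \<in> minimal_equator_metrics) \<and>
     (\<forall>g\<in>(minimal_equator_metrics :: 'm tensor2 set).
        (\<exists>!F. is_F g F) \<and> (\<exists>!R. is_curv_of_metric g R) \<and>
        curv_of_metric g \<in> Curv_plus) \<and>
     (\<forall>g\<in>(minimal_equator_metrics :: 'm tensor2 set). metric_of_curv (curv_of_metric g) = g) \<and>
     (\<forall>R\<in>(Curv_plus :: 'm tensor4 set). curv_of_metric (metric_of_curv R) = R)"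
proof -
  have n: "CARD('m) = Suc n" using assms by simp
  note M = metric_of_curv_facts[OF n assms(1)] and C = curv_of_metric_facts[OF n assms(1)]
  have inverse: "curv_of_metric (metric_of_curv R) = R" if R: "R \<in> Curv_plus" for R :: "'m tensor4"
  proof -
    have "is_curv_of_metric (metric_of_curv R) R"
      using R unfolding is_curv_of_metric_def M(2)[OF R] by (simp add: Curv_plus_def k_of_curv_def)
    then show ?thesis unfolding curv_of_metric_def using C(1)[OF M(1)[OF R]] by (simp add: the1_equality)
  qed
  have D: "\<exists>!D. is_D R D" if "R \<in> Curv_plus" for R :: "'m tensor4"
    using density_of_curvature[OF n assms(1) k_of_curv_metric[OF that]] by simp
  have F: "\<exists>!F. is_F g F" if "g \<in> minimal_equator_metrics" for g :: "'m tensor2"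
    using density_of_metric(1)[OF n, of g] that by (simp add: minimal_equator_metrics_def)
  show ?thesis
    by (intro conjI ballI; (rule k_of_curv_metric D M(1) F C inverse, assumption))
qed

end
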